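(* For $1\le r\le 2$ let $M_r h(x) := \big(M(|h|^r)(x)\big)^{1/r}$, where $M$ is the Hardy--Littlewood maximal function on $\mathbb{R}^3$. (i) If $1 \le r < 2$ and $1\le p\le \frac{4}{3}$, then there is a constant $C=C_{p,r}$ such that $$\|M_r(\widehat{f})\|_{L^2(\mathbb{S}^2)} \le C \|f\|_{L^{p}(\mathbb{R}^3)}$$ for all Schwartz functions $f\in\mathcal{S}(\mathbb{R}^3)$. (ii) If $1\le p<\frac43$, then there is a constant $C=C_p$ such that $$\|M_2(\widehat{f})\|_{L^2(\mathbb{S}^2)} \le C \|f\|_{L^{p}(\mathbb{R}^3)}$$ for all Schwartz functions $f\in\mathcal{S}(\mathbb{R}^3)$.
   Context: The Hardy--Littlewood maximal function is $Mf(x) = \sup_{\rho>0} \frac{1}{|B(x,\rho)|}\int_{B(x,\rho)} |f|$, with $B(x,\rho)$ the ball of radius $\rho$ centered at $x$. The Fourier transform is $\widehat{f}(\xi) = \int_{\mathbb{R}^d} e^{-2\pi i x\cdot \xi} f(x)\,dx$. The sphere $\mathbb{S}^2\subset\mathbb{R}^3$ is equipped with its surface measure. *)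

theory Defs
  imports "HOL-Analysis.Analysis"
begin

(* Iterated partial derivatives: iter_partial [j1, ..., jm] f = D_j1 (... (D_jm f)). *)
fun iter_partial :: "'n::finite list \<Rightarrow> (real^'n \<Rightarrow> complex) \<Rightarrow> real^'n \<Rightarrow> complex" where
  "iter_partial [] f = f"
| "iter_partial (j # js) f = (\<lambda>x. frechet_derivative (iter_partial js f) (at x) (axis j 1))"

(* Differentiability of all iterated partial derivatives is smoothness; it also rules out the
   arbitrary values frechet_derivative takes at points of non-differentiability. *)
definition schwartz :: "(real^'n::finite \<Rightarrow> complex) \<Rightarrow> bool" where
  "schwartz f \<longleftrightarrow>
     (\<forall>js x. iter_partial js f differentiable (at x)) \<and>
     (\<forall>(\<alpha>::'n \<Rightarrow> nat) js. bounded (range (\<lambda>x. (\<Prod>i\<in>UNIV. (x $ i) ^ \<alpha> i) *\<^sub>R iter_partial js f x)))"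

definition fourier :: "('a::euclidean_space \<Rightarrow> complex) \<Rightarrow> 'a \<Rightarrow> complex" where
  "fourier f \<xi> = (LINT x|lborel. exp (- 2 * of_real pi * \<i> * of_real (x \<bullet> \<xi>)) * f x)"

(* Real powers on [0, \<infinity>], for positive exponents only. *)
definition epowr :: "ennreal \<Rightarrow> real \<Rightarrow> ennreal" where
  "epowr a s = (if a = top then top else ennreal (enn2real a powr s))"

definition Lp_norm :: "'a measure \<Rightarrow> real \<Rightarrow> ('a \<Rightarrow> ennreal) \<Rightarrow> ennreal" where
  "Lp_norm M p g = epowr (\<integral>\<^sup>+x. epowr (g x) p \<partial>M) (1 / p)"

definition HL_max :: "('a::euclidean_space \<Rightarrow> 'b::real_normed_vector) \<Rightarrow> 'a \<Rightarrow> ennreal" where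
  "HL_max f x =
     (SUP \<rho>\<in>{0<..}. (\<integral>\<^sup>+y\<in>ball x \<rho>. ennreal (norm (f y)) \<partial>lborel) / emeasure lborel (ball x \<rho>))"

definition HL_max_pow :: "real \<Rightarrow> ('a::euclidean_space \<Rightarrow> 'b::real_normed_vector) \<Rightarrow> 'a \<Rightarrow> ennreal" where
  "HL_max_pow r h x = epowr (HL_max (\<lambda>y. norm (h y) powr r) x) (1 / r)"

(* Surface measure on the unit sphere in polar-coordinate form: the measure of A is the dimension
   times the Lebesgue measure of the cone {t x | 0 < t < 1, x \<in> A}. It is not normalised to a
   probability measure: the lemmas below show that the total mass on the 2-sphere is 4 pi and that
   it is invariant under orthogonal maps, which together determine it. *)
definition sphere_measure :: "'a::euclidean_space measure" where
  "sphere_measure = scale_measure (of_nat DIM('a))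
     (distr (restrict_space lborel (ball 0 1 - {0})) (restrict_space borel (sphere 0 1)) sgn)"

lemma space_sphere_measure: "space sphere_measure = sphere 0 1"
  by (simp add: sphere_measure_def space_scale_measure space_restrict_space)

lemma sets_sphere_measure: "sets sphere_measure = sets (restrict_space borel (sphere 0 1))"
  by (simp add: sphere_measure_def)

lemma measurable_sgn_sphere:
  "sgn \<in> restrict_space lborel (ball (0::'a::euclidean_space) 1 - {0})
           \<rightarrow>\<^sub>M restrict_space borel (sphere 0 1)"
proof (rule measurable_restrict_space2)
  show "sgn \<in> space (restrict_space lborel (ball (0::'a) 1 - {0})) \<rightarrow> sphere 0 1"
    by (auto simp: space_restrict_space norm_sgn)
  have "(\<lambda>x::'a. inverse (norm x) *\<^sub>R x) \<in> borel_measurable borel"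
    by measurable
  then have "(sgn :: 'a \<Rightarrow> 'a) \<in> borel_measurable borel"
    by (simp add: sgn_div_norm[abs_def])
  then show "sgn \<in> borel_measurable (restrict_space lborel (ball (0::'a) 1 - {0}))"
    by (intro measurable_restrict_space1) simp
qed

lemma emeasure_sphere_measure:
  assumes "A \<in> sets (sphere_measure :: 'a::euclidean_space measure)"
  shows "emeasure sphere_measure A = of_nat DIM('a) *
           emeasure lborel {x::'a. x \<noteq> 0 \<and> norm x < 1 \<and> sgn x \<in> A}"
proof -
  have A: "A \<in> sets (restrict_space borel (sphere 0 1))"
    using assms by (simp add: sets_sphere_measure)
  have eq: "sgn -` A \<inter> space (restrict_space lborel (ball (0::'a) 1 - {0}))
            = {x. x \<noteq> 0 \<and> norm x < 1 \<and> sgn x \<in> A}"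
    by (auto simp: space_restrict_space)
  have "emeasure (distr (restrict_space lborel (ball 0 1 - {0}))
                  (restrict_space borel (sphere (0::'a) 1)) sgn) A
        = emeasure (restrict_space lborel (ball 0 1 - {0})) {x. x \<noteq> 0 \<and> norm x < 1 \<and> sgn x \<in> A}"
    by (simp only: emeasure_distr[OF measurable_sgn_sphere A] eq)
  also have "\<dots> = emeasure lborel {x. x \<noteq> 0 \<and> norm x < 1 \<and> sgn x \<in> A}"
    by (rule emeasure_restrict_space) auto
  finally show ?thesis
    by (simp add: sphere_measure_def)
qed

lemma emeasure_sphere_measure_3:
  "emeasure (sphere_measure :: (real^3) measure) (sphere 0 1) = ennreal (4 * pi)"
proof -
  have "{x::real^3. x \<noteq> 0 \<and> norm x < 1 \<and> sgn x \<in> sphere 0 1} = ball 0 1 - {0}"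
    by (auto simp: norm_sgn)
  moreover have "emeasure lborel (ball (0::real^3) 1 - {0}) = emeasure lborel (ball (0::real^3) 1)"
    by (rule emeasure_Diff_null_set) auto
  moreover have "emeasure lborel (ball (0::real^3) 1) = ennreal (4 / 3 * pi)"
    by (simp add: emeasure_ball eval_unit_ball_vol)
  moreover have "sphere (0::real^3) 1 \<in> sets sphere_measure"
    using sets.top[of "sphere_measure :: (real^3) measure"] by (simp add: space_sphere_measure)
  moreover have "(3::ennreal) * ennreal (4 / 3 * pi) = ennreal (4 * pi)"
    by (simp flip: ennreal_numeral ennreal_mult')
  ultimately show ?thesis
    by (simp add: emeasure_sphere_measure)
qed

lemma emeasure_sphere_measure_orthogonal:
  fixes T :: "(real, 'n::{finite,wellorder}) vec \<Rightarrow> (real, 'n::{finite,wellorder}) vec"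
  assumes T: "orthogonal_transformation T" and A: "A \<in> sets sphere_measure"
  shows "T ` A \<in> sets sphere_measure"
    and "emeasure sphere_measure (T ` A) = emeasure sphere_measure A"
proof -
  have lin: "linear T" and nT: "\<And>x. norm (T x) = norm x" and bT: "bij T"
    using T by (auto simp: orthogonal_transformation_linear orthogonal_transformation_norm
        orthogonal_transformation_bij)
  obtain S where S: "orthogonal_transformation S" "\<And>x. S (T x) = x" "\<And>x. T (S x) = x"
    using T bT orthogonal_transformation_inv[OF T]
    by (metis bij_inv_eq_iff)
  have AB: "A \<in> sets borel" "A \<subseteq> sphere 0 1"
    using A by (auto simp: sets_sphere_measure sets_restrict_space)
  have "T ` A = S -` A \<inter> space borel"
    using S by (auto simp: image_iff) metis
  moreover have "S \<in> borel_measurable borel"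
    using S(1) by (intro borel_measurable_continuous_onI linear_continuous_on)
      (simp add: linear_linear orthogonal_transformation_linear)
  ultimately have TA: "T ` A \<in> sets borel"
    using AB(1) by (metis measurable_sets)
  then show TA': "T ` A \<in> sets sphere_measure"
    using AB(2) nT by (auto simp: sets_sphere_measure sets_restrict_space image_iff
        intro!: bexI[of _ "T ` A"])
  let ?C = "\<lambda>A. {x::(real,'n) vec. x \<noteq> 0 \<and> norm x < 1 \<and> sgn x \<in> A}"
  have Cb: "?C B \<in> sets borel \<and> ?C B \<in> lmeasurable" if "B \<in> sets sphere_measure" for B
  proof -
    have eq: "sgn -` B \<inter> space (restrict_space lborel (ball (0::(real,'n) vec) 1 - {0})) = ?C B"
      by (auto simp: space_restrict_space)
    have "?C B \<in> sets (restrict_space lborel (ball (0::(real,'n) vec) 1 - {0}))"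
      using measurable_sets[OF measurable_sgn_sphere, of B] that
      by (simp only: sets_sphere_measure eq)
    moreover have "(ball (0::(real,'n) vec) 1 - {0}) \<inter> space lborel \<in> sets lborel"
      by simp
    ultimately have l: "?C B \<in> sets lborel"
      by (subst (asm) sets_restrict_space_iff) blast+
    then have b: "?C B \<in> sets borel"
      by (simp only: sets_lborel)
    from l have "?C B \<in> sets lebesgue"
      by (rule sets_completionI_sets)
    moreover have "bounded (?C B)"
      by (rule bounded_subset[OF bounded_ball[of 0 1]]) auto
    ultimately have "?C B \<in> lmeasurable"
      by (rule bounded_set_imp_lmeasurable[rotated])
    with b show ?thesis by simp
  qed
  have sgnT: "sgn (T x) = T (sgn x)" for x
    by (simp add: sgn_div_norm nT linear_scale[OF lin])
  have T0: "T x = 0 \<longleftrightarrow> x = 0" for x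
    using nT[of x] by (metis norm_eq_zero)
  have "?C (T ` A) = T ` ?C A"
  proof (intro equalityI subsetI)
    fix x assume x: "x \<in> ?C (T ` A)"
    then obtain a where a: "a \<in> A" "sgn x = T a" by auto
    have "sgn (S x) = a"
      using sgnT[of "S x"] a S(2,3) by metis
    then have "S x \<in> ?C A"
      using x a(1) nT[of "S x"] T0[of "S x"] S(3)[of x] by auto
    then show "x \<in> T ` ?C A"
      by (rule image_eqI[where f = T, OF S(3)[of x, symmetric]])
  qed (auto simp: sgnT nT T0)
  then have "measure lebesgue (?C (T ` A)) = measure lebesgue (?C A)"
    by (simp only: measure_orthogonal_image[OF T conjunct2[OF Cb[OF A]]])
  moreover have "emeasure lborel (?C B) = ennreal (measure lebesgue (?C B))"
    if "B \<in> sets sphere_measure" for B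
  proof -
    have "?C B \<in> sets lborel"
      using Cb[OF that] by (simp only: sets_lborel)
    then have "emeasure lborel (?C B) = emeasure lebesgue (?C B)"
      by (simp only: emeasure_completion main_part sets_completionI_sets)
    also have "\<dots> = ennreal (measure lebesgue (?C B))"
      by (rule emeasure_eq_measure2) (rule conjunct2[OF Cb[OF that]])
    finally show ?thesis .
  qed
  ultimately have "emeasure lborel (?C (T ` A)) = emeasure lborel (?C A)"
    by (simp only: A TA')
  then show "emeasure sphere_measure (T ` A) = emeasure sphere_measure A"
    by (simp add: emeasure_sphere_measure A TA')
qed

end

theory Submission
  imports Defs "HOL-Probability.Characteristic_Functions" "HOL-Probability.Sinc_Integral"
begin

text \<open>
  The estimate is a Stein--Tomas restriction theorem for the sphere in three-dimensional space with
  a maximal function on the left-hand side. At the exponent \<open>p = 4/3\<close> the dual exponent is \<open>4\<close>, and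
  the fourth power of the Fourier transform of \<open>G\<close> integrates to the square of the \<open>L\<^sup>2\<close> norm of
  \<open>G * G\<close>; so everything can be done with positive functions, after Plancherel's inequality has
  removed the oscillation.

  Fix \<open>1 < r < 2\<close>. For a measurable choice of radii \<open>\<rho> x\<close>, let \<open>m x\<close> be the \<open>L\<^sup>r\<close> average of the
  Fourier transform of \<open>f\<close> over the ball of radius \<open>\<rho> x\<close> about \<open>x\<close>. The integral of \<open>m\<^sup>2\<close> can be
  written as the pairing of the Fourier transform of \<open>f\<close> with a function \<open>G\<close> which superposes, with
  weights \<open>m x\<close>, bumps that are supported in the balls about \<open>x\<close> and bounded on average in \<open>L\<^bsup>r'\<^esup>\<close>,
  where \<open>1/r + 1/r' = 1\<close>. By duality it remains to bound \<open>G * G\<close> in \<open>L\<^sup>2\<close> by the square of the \<open>L\<^sup>2\<close> norm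
  of \<open>m\<close>. Testing \<open>G * G\<close> against \<open>W\<close> leads to averages of \<open>W (\<xi> + \<xi>')\<close> over pairs of balls about
  \<open>x\<close> and \<open>x'\<close>, and Hoelder's inequality bounds such an average by \<open>(M (W\<^sup>r) (x + x'))\<^bsup>1/r\<^esup>\<close>, where
  \<open>M\<close> is the ordinary maximal function: the radii have disappeared. What is left is the classical
  bilinear restriction estimate for the function \<open>(M (W\<^sup>r))\<^bsup>1/r\<^esup>\<close>, and that function is controlled in
  \<open>L\<^sup>2\<close> by the Hardy--Littlewood theorem, because \<open>2/r > 1\<close>. This is where \<open>r < 2\<close> enters
  (\<open>trilinear_ball_average\<close>, \<open>shell_bilinear_bound\<close>, \<open>shell_maximal_restriction\<close>).

  The bilinear estimate says that the sum of two independent points of the sphere, which are kept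
  away from being antipodal, has a bounded density. On the sphere itself this is a statement about
  singular measures. It becomes one about volumes when the sphere is thickened to a shell of width
  \<open>\<delta>\<close>: two such shells with centres at distance \<open>\<ge> 1\<close> meet in volume \<open>O(\<delta>\<^sup>2)\<close>
  (\<open>shell_intersection_measure\<close>). Thickening costs nothing, since ball averages at radii \<open>\<ge> \<delta>\<close> change
  only by a constant factor when the centre moves by \<open>\<delta>\<close>; truncating the maximal function to finitely
  many dyadic radii, letting \<open>\<delta>\<close> be the smallest of them, and passing to the limit gives the endpoint
  \<open>sphere_maximal_endpoint\<close>.

  For \<open>p < 4/3\<close> the endpoint is interpolated with the trivial bound of the Fourier transform by the
  \<open>L\<^sup>1\<close> norm, which pays for raising \<open>r\<close> to \<open>2\<close>: pointwise, the square of the Fourier transform is at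
  most a power of the \<open>L\<^sup>1\<close> norm times its \<open>r\<close>-th power. Applied to the dyadic level pieces of \<open>f\<close>,
  this gains a geometric factor that makes the sum over the pieces converge
  (\<open>quadratic_maximal_below_endpoint\<close>). Finally, \<open>M\<^sub>r\<close> increases with \<open>r\<close> (\<open>HL_max_pow_mono\<close>), so the
  remaining cases of the first part follow from these two.
\<close>


section \<open>Measure-theoretic preliminaries\<close>

lemma nn_integral_lborel_affine:
  fixes f :: "'a::euclidean_space \<Rightarrow> ennreal"
  assumes [measurable]: "f \<in> borel_measurable borel" and c: "c \<noteq> 0"
  shows "(\<integral>\<^sup>+x. f x \<partial>lborel) = ennreal (\<bar>c\<bar> ^ DIM('a)) * (\<integral>\<^sup>+x. f (t + c *\<^sub>R x) \<partial>lborel)"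
  by (subst lborel_affine[OF c, of t])
     (simp add: nn_integral_density nn_integral_distr nn_integral_cmult)

lemma nn_integral_lborel_translate:
  fixes f :: "'a::euclidean_space \<Rightarrow> ennreal"
  assumes "f \<in> borel_measurable borel"
  shows "(\<integral>\<^sup>+x. f (t + x) \<partial>lborel) = (\<integral>\<^sup>+x. f x \<partial>lborel)"
  using nn_integral_lborel_affine[OF assms, of 1 t] by simp

lemma nn_integral_lborel_reflect:
  fixes f :: "'a::euclidean_space \<Rightarrow> ennreal"
  assumes "f \<in> borel_measurable borel"
  shows "(\<integral>\<^sup>+x. f (t - x) \<partial>lborel) = (\<integral>\<^sup>+x. f x \<partial>lborel)"
  using nn_integral_lborel_affine[OF assms, of "-1" t] by simp

lemma emeasure_lborel_ball_scale:
  fixes x y :: "'a::euclidean_space"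
  assumes "0 \<le> \<rho>" "0 \<le> c"
  shows "emeasure lborel (ball x (c * \<rho>)) = ennreal (c ^ DIM('a)) * emeasure lborel (ball y \<rho>)"
  using assms by (simp add: emeasure_ball ennreal_mult' [symmetric] power_mult_distrib mult_ac)

lemma emeasure_lborel_ball_pos:
  fixes x :: "'a::euclidean_space"
  assumes "0 < \<rho>"
  shows "emeasure lborel (ball x \<rho>) \<noteq> 0" "emeasure lborel (ball x \<rho>) \<noteq> top"
  using assms unit_ball_vol_pos[of "real DIM('a)"]
  by (auto simp: emeasure_ball ennreal_eq_0_iff not_le intro!: mult_pos_pos)

text \<open>
  Hoelder's inequality with real bounds for the two factors. Young's inequality is applied after
  dividing by the two norms, so the bounds are first taken positive; bounds equal to \<open>0\<close> are reached
  as limits.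
\<close>
lemma Holder_nn_integral:
  fixes f g :: "'a \<Rightarrow> real"
  assumes meas: "f \<in> borel_measurable M" "g \<in> borel_measurable M"
    and nn: "\<And>x. 0 \<le> f x" "\<And>x. 0 \<le> g x"
    and pq: "1 < p" "1 < q" "1 / p + 1 / q = 1"
    and A: "(\<integral>\<^sup>+x. ennreal (f x powr p) \<partial>M) \<le> ennreal A" "0 \<le> A"
    and B: "(\<integral>\<^sup>+x. ennreal (g x powr q) \<partial>M) \<le> ennreal B" "0 \<le> B"
  shows "(\<integral>\<^sup>+x. ennreal (f x * g x) \<partial>M) \<le> ennreal (A powr (1/p) * B powr (1/q))"
proof -
  note [measurable] = meas
  have pos: "(\<integral>\<^sup>+x. ennreal (f x * g x) \<partial>M) \<le> ennreal (A' powr (1/p) * B' powr (1/q))"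
    if A': "A \<le> A'" "0 < A'" and B': "B \<le> B'" "0 < B'" for A' B'
  proof -
    define a b where "a = A' powr (1/p)" and "b = B' powr (1/q)"
    have ab: "0 < a" "0 < b" using A' B' by (auto simp: a_def b_def)
    have ap: "a powr p = A'" and bq: "b powr q = B'"
      using A' B' pq by (auto simp: a_def b_def powr_powr)
    have le: "ennreal (f x * g x) \<le>
        ennreal (a*b / (p*A')) * ennreal (f x powr p) + ennreal (a*b / (q*B')) * ennreal (g x powr q)" for x
    proof -
      have "(f x / a) * (g x / b) \<le> (f x / a) powr p / p + (g x / b) powr q / q"
        using nn[of x] ab by (intro Youngs_inequality[OF pq]) auto
      also have "\<dots> = f x powr p / (p * A') + g x powr q / (q * B')"
        using nn[of x] ab by (simp add: powr_divide ap bq mult_ac)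
      finally have "a * b * ((f x / a) * (g x / b)) \<le> a * b * (f x powr p / (p * A') + g x powr q / (q * B'))"
        using ab by (intro mult_left_mono) auto
      then have "f x * g x \<le> (a*b / (p*A')) * f x powr p + (a*b / (q*B')) * g x powr q"
        using ab by (simp add: field_simps)
      then show ?thesis
        using ab A' B' pq
        by (simp flip: ennreal_mult ennreal_plus add: ennreal_leI)
    qed
    have "(\<integral>\<^sup>+x. ennreal (f x * g x) \<partial>M) \<le>
       (\<integral>\<^sup>+x. ennreal (a*b / (p*A')) * ennreal (f x powr p) + ennreal (a*b / (q*B')) * ennreal (g x powr q) \<partial>M)"
      by (intro nn_integral_mono le)
    also have "\<dots> = ennreal (a*b / (p*A')) * (\<integral>\<^sup>+x. ennreal (f x powr p) \<partial>M)
                 + ennreal (a*b / (q*B')) * (\<integral>\<^sup>+x. ennreal (g x powr q) \<partial>M)"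
      by (simp add: nn_integral_add nn_integral_cmult)
    also have "\<dots> \<le> ennreal (a*b / (p*A')) * ennreal A' + ennreal (a*b / (q*B')) * ennreal B'"
      using A B A' B' by (intro add_mono mult_left_mono) (auto intro: order_trans ennreal_leI)
    also have "\<dots> = ennreal (a * b / p + a * b / q)"
      using ab A' B' pq by (simp flip: ennreal_mult ennreal_plus)
    also have "a * b / p + a * b / q = a * b"
      using pq by (simp add: divide_inverse distrib_left[symmetric])
    finally show ?thesis by (simp add: a_def b_def)
  qed
  have "((\<lambda>e. ennreal ((A + e) powr (1/p) * (B + e) powr (1/q))) \<longlongrightarrow> ennreal ((A + 0) powr (1/p) * (B + 0) powr (1/q))) (at_right 0)"
  proof (intro tendsto_ennrealI tendsto_mult)
    have *: "((\<lambda>e. (C + e) powr (1/s)) \<longlongrightarrow> (C + 0) powr (1/s)) (at_right 0)" if "0 \<le> C" "1 < s" for C s :: real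
      using that by (intro tendsto_powr2 tendsto_intros) 
          (auto simp: eventually_at_right_less intro!: eventually_at_rightI[of 0 1])
    show "((\<lambda>e. (A + e) powr (1/p)) \<longlongrightarrow> (A + 0) powr (1/p)) (at_right 0)"
      "((\<lambda>e. (B + e) powr (1/q)) \<longlongrightarrow> (B + 0) powr (1/q)) (at_right 0)"
      using * A B pq by auto
  qed
  then show ?thesis
    by (rule tendsto_lowerbound[where a = "\<integral>\<^sup>+x. ennreal (f x * g x) \<partial>M", THEN order_trans])
       (auto intro!: eventually_at_rightI[of 0 1] pos simp: A B add_nonneg_pos)
qed

section \<open>The Hardy-Littlewood maximal theorem\<close>

lemma HL_max_ge:
  fixes f :: "'a::euclidean_space \<Rightarrow> 'b::real_normed_vector"
  assumes "0 < \<rho>"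
  shows "(\<integral>\<^sup>+y\<in>ball x \<rho>. ennreal (norm (f y)) \<partial>lborel) \<le> HL_max f x * emeasure lborel (ball x \<rho>)"
proof -
  have "(\<integral>\<^sup>+y\<in>ball x \<rho>. ennreal (norm (f y)) \<partial>lborel) / emeasure lborel (ball x \<rho>) \<le> HL_max f x"
    unfolding HL_max_def using assms by (intro SUP_upper) auto
  then have "(\<integral>\<^sup>+y\<in>ball x \<rho>. ennreal (norm (f y)) \<partial>lborel) / emeasure lborel (ball x \<rho>) * emeasure lborel (ball x \<rho>)
     \<le> HL_max f x * emeasure lborel (ball x \<rho>)"
    by (intro mult_right_mono) auto
  moreover have "(\<integral>\<^sup>+y\<in>ball x \<rho>. ennreal (norm (f y)) \<partial>lborel) / emeasure lborel (ball x \<rho>) * emeasure lborel (ball x \<rho>)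
     = (\<integral>\<^sup>+y\<in>ball x \<rho>. ennreal (norm (f y)) \<partial>lborel)"
    using emeasure_lborel_ball_pos[OF assms, of x]
    by (simp add: ennreal_divide_times top.not_eq_extremum)
  ultimately show ?thesis by simp
qed

text \<open>
  Cross-multiplying with the volume of the ball removes the extended division, and exhibits the
  strict inequality as a condition on a single ball.
\<close>
lemma less_HL_max_iff:
  fixes f :: "'a::euclidean_space \<Rightarrow> 'b::real_normed_vector"
  shows "l < HL_max f x \<longleftrightarrow>
    (\<exists>\<rho>>0. l * emeasure lborel (ball x \<rho>) < (\<integral>\<^sup>+y\<in>ball x \<rho>. ennreal (norm (f y)) \<partial>lborel))"
proof -
  have "l < a / emeasure lborel (ball x \<rho>) \<longleftrightarrow> l * emeasure lborel (ball x \<rho>) < a" if \<rho>: "0 < \<rho>" for \<rho> a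
  proof -
    define v where "v = emeasure lborel (ball x \<rho>)"
    have v: "v \<noteq> 0" "v \<noteq> top"
      using emeasure_lborel_ball_pos[OF \<rho>, of x] by (simp_all add: v_def)
    have "a / v \<le> l \<longleftrightarrow> a \<le> l * v"
    proof
      assume "a / v \<le> l"
      then have "a / v * v \<le> l * v" by (rule mult_right_mono) simp
      then show "a \<le> l * v" using v by (simp add: ennreal_divide_times top.not_eq_extremum)
    next
      assume "a \<le> l * v"
      then show "a / v \<le> l"
        using v by (intro divide_le_posI_ennreal) (simp_all add: zero_less_iff_neq_zero mult.commute)
    qed
    then show ?thesis by (simp add: v_def not_le[symmetric])
  qed
  then show ?thesis unfolding HL_max_def less_SUP_iff by auto
qed

text \<open>
  The maximal function is lower semicontinuous: a ball whose average exceeds \<open>l\<close> can be shrunk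
  slightly without losing this, and then it still fits when the centre is moved.
\<close>
lemma open_HL_max_greater:
  fixes f :: "'a::euclidean_space \<Rightarrow> 'b::real_normed_vector"
  assumes [measurable]: "f \<in> borel_measurable borel"
  shows "open {x. l < HL_max f x}"
proof (rule openI)
  fix x assume "x \<in> {x. l < HL_max f x}"
  then obtain \<rho> where \<rho>: "0 < \<rho>"
    "l * emeasure lborel (ball x \<rho>) < (\<integral>\<^sup>+y\<in>ball x \<rho>. ennreal (norm (f y)) \<partial>lborel)"
    by (auto simp: less_HL_max_iff)
  \<comment> \<open>Continuity from below of this measure lets the ball be shrunk.\<close>
  define N where "N = density lborel (\<lambda>y. ennreal (norm (f y)))"
  have N: "emeasure N (ball z s) = (\<integral>\<^sup>+y\<in>ball z s. ennreal (norm (f y)) \<partial>lborel)" for z s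
    by (simp add: N_def emeasure_density)
  have "(SUP n. emeasure N (ball x (\<rho> - \<rho> / real (Suc n)))) = emeasure N (\<Union>n. ball x (\<rho> - \<rho> / real (Suc n)))"
  proof (rule SUP_emeasure_incseq)
    show "incseq (\<lambda>n. ball x (\<rho> - \<rho> / real (Suc n)))"
      using \<rho> by (auto simp: incseq_def intro!: subset_ball divide_left_mono)
  qed (auto simp: N_def)
  also have "(\<Union>n. ball x (\<rho> - \<rho> / real (Suc n))) = ball x \<rho>"
  proof (intro equalityI subsetI)
    fix y assume "y \<in> ball x \<rho>"
    then have "0 < (\<rho> - dist x y) / \<rho>" using \<rho> by simp
    then obtain n where "inverse (real (Suc n)) < (\<rho> - dist x y) / \<rho>"
      using reals_Archimedean by blast
    then have "dist x y < \<rho> - \<rho> / real (Suc n)"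
      using \<rho> by (simp add: field_simps del: of_nat_Suc)
    then show "y \<in> (\<Union>n. ball x (\<rho> - \<rho> / real (Suc n)))" by auto
  next
    fix y assume "y \<in> (\<Union>n. ball x (\<rho> - \<rho> / real (Suc n)))"
    then obtain n where "dist x y < \<rho> - \<rho> / real (Suc n)" by auto
    moreover have "0 \<le> \<rho> / real (Suc n)" using \<rho> by simp
    ultimately show "y \<in> ball x \<rho>" by simp
  qed
  finally have "l * emeasure lborel (ball x \<rho>) < (SUP n. emeasure N (ball x (\<rho> - \<rho> / real (Suc n))))"
    using \<rho>(2) by (simp only: N)
  then obtain n where n: "l * emeasure lborel (ball x \<rho>) < emeasure N (ball x (\<rho> - \<rho> / real (Suc n)))"
    unfolding less_SUP_iff by blast
  have "x' \<in> {x. l < HL_max f x}" if x': "x' \<in> ball x (\<rho> / real (Suc n))" for x'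
  proof -
    have "ball x (\<rho> - \<rho> / real (Suc n)) \<subseteq> ball x' \<rho>"
    proof
      fix z assume "z \<in> ball x (\<rho> - \<rho> / real (Suc n))"
      then show "z \<in> ball x' \<rho>"
        using x' dist_triangle[of x' z x] by (simp add: dist_commute del: of_nat_Suc)
    qed
    then have "emeasure N (ball x (\<rho> - \<rho> / real (Suc n))) \<le> emeasure N (ball x' \<rho>)"
      by (intro emeasure_mono) (auto simp: N_def)
    moreover have "emeasure lborel (ball x \<rho>) = emeasure lborel (ball x' \<rho>)"
      using \<rho> by (simp add: emeasure_ball)
    ultimately show ?thesis
      using n \<rho> by (auto simp: less_HL_max_iff N)
  qed
  then show "\<exists>e>0. ball x e \<subseteq> {x. l < HL_max f x}"
    using \<rho> by (intro exI[of _ "\<rho> / real (Suc n)"]) auto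
qed

lemma borel_measurable_HL_max [measurable]:
  fixes f :: "'a::euclidean_space \<Rightarrow> 'b::real_normed_vector"
  assumes "f \<in> borel_measurable borel"
  shows "HL_max f \<in> borel_measurable borel"
  by (rule borel_measurableI_greater) (use open_HL_max_greater[OF assms] in simp)

text \<open>
  The weak \<open>(1,1)\<close> inequality. Each point of the superlevel set is the centre of a ball with large
  average; the volumes of these balls are bounded by the integral of \<open>f\<close>, so Vitali's covering lemma
  selects disjoint ones whose fivefold dilations still cover the set.
\<close>
lemma HL_max_weak_type:
  fixes f :: "'a::euclidean_space \<Rightarrow> 'b::real_normed_vector"
  assumes [measurable]: "f \<in> borel_measurable borel" and l: "0 < l"
  shows "ennreal l * emeasure lborel {x. ennreal l < HL_max f x}
      \<le> ennreal (5 ^ DIM('a)) * (\<integral>\<^sup>+y. ennreal (norm (f y)) \<partial>lborel)"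
proof (cases "(\<integral>\<^sup>+y. ennreal (norm (f y)) \<partial>lborel) = top")
  case True
  then show ?thesis by (simp add: ennreal_mult_top)
next
  case False
  then obtain I where I: "(\<integral>\<^sup>+y. ennreal (norm (f y)) \<partial>lborel) = ennreal I" "0 \<le> I"
    by (cases "\<integral>\<^sup>+y. ennreal (norm (f y)) \<partial>lborel") auto
  define S where "S = {x. ennreal l < HL_max f x}"
  define u where "u = unit_ball_vol (real DIM('a))"
  have u: "0 < u" by (simp add: u_def)
  have "\<forall>x\<in>S. \<exists>\<rho>>0. ennreal l * emeasure lborel (ball x \<rho>) < (\<integral>\<^sup>+y\<in>ball x \<rho>. ennreal (norm (f y)) \<partial>lborel)"
    by (auto simp: S_def less_HL_max_iff)
  then obtain \<rho> where \<rho>: "\<And>x. x \<in> S \<Longrightarrow> 0 < \<rho> x"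
    "\<And>x. x \<in> S \<Longrightarrow> ennreal l * emeasure lborel (ball x (\<rho> x)) < (\<integral>\<^sup>+y\<in>ball x (\<rho> x). ennreal (norm (f y)) \<partial>lborel)"
    by metis
  \<comment> \<open>Vitali's lemma requires bounded radii; for \<open>\<rho> x > 1\<close> the radius is at most \<open>\<rho> x ^ d\<close>, which the volume controls.\<close>
  have bound: "\<rho> x \<le> max 1 (I / (l * u))" if x: "x \<in> S" for x
  proof (cases "\<rho> x \<le> 1")
    case False
    have "ennreal l * emeasure lborel (ball x (\<rho> x)) \<le> ennreal I"
    proof -
      have "(\<integral>\<^sup>+y\<in>ball x (\<rho> x). ennreal (norm (f y)) \<partial>lborel) \<le> (\<integral>\<^sup>+y. ennreal (norm (f y)) \<partial>lborel)"
        by (intro nn_integral_mono) (auto simp: indicator_def)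
      then show ?thesis using \<rho>(2)[OF x] I by simp
    qed
    then have "l * (u * \<rho> x ^ DIM('a)) \<le> I"
      using \<rho>(1)[OF x] l I u by (simp add: emeasure_ball u_def flip: ennreal_mult')
    moreover have "\<rho> x ^ 1 \<le> \<rho> x ^ DIM('a)"
      using False by (intro power_increasing) auto
    ultimately have "l * (u * \<rho> x) \<le> I"
      using l u by (smt (verit) mult_left_mono power_one_right mult_pos_pos)
    then show ?thesis using l u by (simp add: field_simps le_max_iff_disj)
  qed simp
  have cover: "S \<subseteq> (\<Union>x\<in>S. ball x (\<rho> x))" using \<rho>(1) by fastforce
  obtain C where C: "countable C" "C \<subseteq> S"
     "pairwise (\<lambda>i j. disjnt (ball i (\<rho> i)) (ball j (\<rho> j))) C"
     "S \<subseteq> (\<Union>x\<in>C. ball x (5 * \<rho> x))"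
    by (rule Vitali_covering_lemma_balls[OF cover, of "max 1 (I / (l * u))"])
       (simp_all add: \<rho>(1) bound)
  have [measurable]: "S \<in> sets borel"
    unfolding S_def by (simp add: open_HL_max_greater)
  have "emeasure lborel S \<le> emeasure lborel (\<Union>x\<in>C. ball x (5 * \<rho> x))"
    using C by (intro emeasure_mono) auto
  also have "\<dots> = (\<integral>\<^sup>+z. indicator (\<Union>x\<in>C. ball x (5 * \<rho> x)) z \<partial>lborel)"
    by (subst nn_integral_indicator) (auto intro!: borel_open open_UN)
  also have "\<dots> \<le> (\<integral>\<^sup>+z. \<integral>\<^sup>+x. indicator (ball x (5 * \<rho> x)) z \<partial>count_space C \<partial>lborel)"
  proof (intro nn_integral_mono)
    fix z :: 'a
    show "indicator (\<Union>x\<in>C. ball x (5 * \<rho> x)) z \<le> (\<integral>\<^sup>+x. indicator (ball x (5 * \<rho> x)) z \<partial>count_space C :: ennreal)"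
    proof (cases "z \<in> (\<Union>x\<in>C. ball x (5 * \<rho> x))")
      case True
      then obtain x where x: "x \<in> C" "z \<in> ball x (5 * \<rho> x)" by auto
      have "(\<integral>\<^sup>+y. indicator {x} y \<partial>count_space C) \<le> (\<integral>\<^sup>+x. indicator (ball x (5 * \<rho> x)) z \<partial>count_space C :: ennreal)"
        using x by (intro nn_integral_mono) (auto simp: indicator_def)
      moreover have "(\<integral>\<^sup>+y. indicator {x} y \<partial>count_space C) = (1::ennreal)"
        using x by (subst nn_integral_indicator) auto
      ultimately show ?thesis using True by simp
    qed simp
  qed
  also have "\<dots> = (\<integral>\<^sup>+x. emeasure lborel (ball x (5 * \<rho> x)) \<partial>count_space C)"
    using C(1) by (subst nn_integral_count_space_nn_integral) (auto intro: borel_measurable_indicator)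
  finally have "ennreal l * emeasure lborel S \<le> ennreal l * (\<integral>\<^sup>+x. emeasure lborel (ball x (5 * \<rho> x)) \<partial>count_space C)"
    by (intro mult_left_mono) auto
  also have "\<dots> = (\<integral>\<^sup>+x. ennreal l * emeasure lborel (ball x (5 * \<rho> x)) \<partial>count_space C)"
    by (simp add: nn_integral_cmult)
  also have "\<dots> \<le> (\<integral>\<^sup>+x. ennreal (5 ^ DIM('a)) * (\<integral>\<^sup>+y\<in>ball x (\<rho> x). ennreal (norm (f y)) \<partial>lborel) \<partial>count_space C)"
  proof (intro nn_integral_mono)
    fix x assume "x \<in> space (count_space C)"
    then have x: "x \<in> S" using C by auto
    have "ennreal l * emeasure lborel (ball x (5 * \<rho> x)) = ennreal (5 ^ DIM('a)) * (ennreal l * emeasure lborel (ball x (\<rho> x)))"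
      using \<rho>(1)[OF x] emeasure_lborel_ball_scale[of "\<rho> x" 5 x x] by (simp add: mult_ac)
    also have "\<dots> \<le> ennreal (5 ^ DIM('a)) * (\<integral>\<^sup>+y\<in>ball x (\<rho> x). ennreal (norm (f y)) \<partial>lborel)"
      using \<rho>(2)[OF x] by (intro mult_left_mono) auto
    finally show "ennreal l * emeasure lborel (ball x (5 * \<rho> x)) \<le> \<dots>" .
  qed
  also have "\<dots> = ennreal (5 ^ DIM('a)) * (\<integral>\<^sup>+x. emeasure (density lborel (\<lambda>y. ennreal (norm (f y)))) (ball x (\<rho> x)) \<partial>count_space C)"
    by (simp add: nn_integral_cmult emeasure_density)
  also have "(\<integral>\<^sup>+x. emeasure (density lborel (\<lambda>y. ennreal (norm (f y)))) (ball x (\<rho> x)) \<partial>count_space C)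
     = emeasure (density lborel (\<lambda>y. ennreal (norm (f y)))) (\<Union>x\<in>C. ball x (\<rho> x))"
  proof (rule emeasure_UN_countable[symmetric])
    show "disjoint_family_on (\<lambda>x. ball x (\<rho> x)) C"
      using C(3) by (auto simp: disjoint_family_on_def pairwise_def disjnt_def)
  qed (use C in auto)
  also have "\<dots> \<le> emeasure (density lborel (\<lambda>y. ennreal (norm (f y)))) (space lborel)"
    by (intro emeasure_mono) auto
  also have "\<dots> = (\<integral>\<^sup>+y. ennreal (norm (f y)) \<partial>lborel)"
    by (simp add: emeasure_density)
  finally show ?thesis unfolding S_def by (simp add: mult_left_mono)
qed

lemma nn_integral_powr_Ioo:
  fixes t b :: real
  assumes "0 < t" "0 \<le> b"
  shows "(\<integral>\<^sup>+l. ennreal (l powr (t - 1)) * indicator {0<..<b} l \<partial>lborel) = ennreal (b powr t / t)"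
proof -
  have "((\<lambda>l. l powr (t - 1)) has_integral (b powr t / t)) {0<..<b}"
    using has_integral_powr_from_0[of "t - 1" b] assms by (simp add: has_integral_Icc_iff_Ioo)
  then show ?thesis
    by (intro nn_integral_has_integral_lebesgue') auto
qed

text \<open>
  Writing a power as an integral over levels reduces the strong-type inequality to distribution
  functions. The value at \<open>\<top>\<close> is the limit of the finite case.
\<close>
lemma epowr_layer_cake:
  assumes s: "0 < s"
  shows "epowr a s = (\<integral>\<^sup>+l. ennreal (s * l powr (s - 1)) * indicator {l. 0 < l \<and> ennreal l < a} l \<partial>lborel)"
proof -
  have *: "(\<integral>\<^sup>+l. ennreal (s * l powr (s - 1)) * indicator {0<..<b} l \<partial>lborel) = ennreal (b powr s)"
    if "0 \<le> b" for b
  proof -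
    have "(\<integral>\<^sup>+l. ennreal (s * l powr (s - 1)) * indicator {0<..<b} l \<partial>lborel)
       = (\<integral>\<^sup>+l. ennreal s * (ennreal (l powr (s - 1)) * indicator {0<..<b} l) \<partial>lborel)"
      using s by (intro nn_integral_cong) (simp add: ennreal_mult' mult.assoc)
    also have "\<dots> = ennreal s * ennreal (b powr s / s)"
      using s that by (subst nn_integral_cmult) (auto simp: nn_integral_powr_Ioo)
    finally show ?thesis using s by (simp flip: ennreal_mult')
  qed
  show ?thesis
  proof (cases a)
    case (real r)
    then have "{l. 0 < l \<and> ennreal l < a} = {0<..<r}" by (auto simp: ennreal_less_iff)
    then show ?thesis using real *[of r] by (simp add: epowr_def)
  next
    case top
    have "(\<integral>\<^sup>+l. ennreal (s * l powr (s - 1)) * indicator {l. 0 < l \<and> ennreal l < a} l \<partial>lborel) = top"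
    proof (rule ccontr)
      assume "(\<integral>\<^sup>+l. ennreal (s * l powr (s - 1)) * indicator {l. 0 < l \<and> ennreal l < a} l \<partial>lborel) \<noteq> top"
      then obtain R where R: "(\<integral>\<^sup>+l. ennreal (s * l powr (s - 1)) * indicator {l. 0 < l \<and> ennreal l < a} l \<partial>lborel) = ennreal R" "0 \<le> R"
        by (cases "\<integral>\<^sup>+l. ennreal (s * l powr (s - 1)) * indicator {l. 0 < l \<and> ennreal l < a} l \<partial>lborel") auto
      define b where "b = (R + 1) powr (1 / s)"
      have "ennreal (b powr s) \<le> ennreal R"
        unfolding R(1)[symmetric] using *[of b, symmetric]
        by (simp add: b_def) (intro nn_integral_mono, auto simp: indicator_def top)
      moreover have "b powr s = R + 1"
        using s R by (simp add: b_def powr_powr)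
      ultimately show False using R by simp
    qed
    then show ?thesis using top by (simp add: epowr_def)
  qed
qed

lemma HL_max_bound_add:
  fixes f g :: "'a::euclidean_space \<Rightarrow> 'b::real_normed_vector"
  assumes [measurable]: "f \<in> borel_measurable borel" "g \<in> borel_measurable borel" and c: "0 \<le> c"
    and le: "\<And>y. norm (f y) \<le> norm (g y) + c"
  shows "HL_max f x \<le> HL_max g x + ennreal c"
  unfolding HL_max_def[of f]
proof (rule SUP_least)
  fix \<rho> :: real assume "\<rho> \<in> {0<..}"
  then have \<rho>: "0 < \<rho>" by simp
  have V: "0 < emeasure lborel (ball x \<rho>)" "emeasure lborel (ball x \<rho>) < top"
    using \<rho> unit_ball_vol_pos[of "real DIM('a)"]
    by (auto simp: emeasure_ball ennreal_zero_less_mult_iff)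
  have [measurable]: "ball x \<rho> \<in> sets borel" by simp
  have "(\<integral>\<^sup>+y\<in>ball x \<rho>. ennreal (norm (f y)) \<partial>lborel)
     \<le> (\<integral>\<^sup>+y. ennreal (norm (g y)) * indicator (ball x \<rho>) y + ennreal c * indicator (ball x \<rho>) y \<partial>lborel)"
    using le c by (intro nn_integral_mono) (auto simp: indicator_def simp flip: ennreal_plus intro!: ennreal_leI)
  also have "\<dots> = (\<integral>\<^sup>+y\<in>ball x \<rho>. ennreal (norm (g y)) \<partial>lborel) + ennreal c * emeasure lborel (ball x \<rho>)"
    by (subst nn_integral_add) (auto simp: nn_integral_cmult_indicator)
  finally have "(\<integral>\<^sup>+y\<in>ball x \<rho>. ennreal (norm (f y)) \<partial>lborel) / emeasure lborel (ball x \<rho>)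
     \<le> ((\<integral>\<^sup>+y\<in>ball x \<rho>. ennreal (norm (g y)) \<partial>lborel) + ennreal c * emeasure lborel (ball x \<rho>)) / emeasure lborel (ball x \<rho>)"
    by (rule divide_right_mono_ennreal)
  also have "\<dots> = (\<integral>\<^sup>+y\<in>ball x \<rho>. ennreal (norm (g y)) \<partial>lborel) / emeasure lborel (ball x \<rho>) + ennreal c"
    using V by (simp add: add_divide_distrib_ennreal ennreal_times_divide[symmetric])
  also have "\<dots> \<le> HL_max g x + ennreal c"
    unfolding HL_max_def using \<rho> by (intro add_mono SUP_upper) auto
  finally show "(\<integral>\<^sup>+y\<in>ball x \<rho>. ennreal (norm (f y)) \<partial>lborel) / emeasure lborel (ball x \<rho>) \<le> HL_max g x + ennreal c" .
qed

text \<open>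
  The part of \<open>f\<close> below \<open>l / 2\<close> contributes at most \<open>l / 2\<close> to any average, so only the part above it
  can make the maximal function exceed \<open>l\<close>. This is the gain over the plain weak-type inequality
  which makes the integral over \<open>l\<close> converge.
\<close>
lemma HL_max_weak_type_truncated:
  fixes f :: "'a::euclidean_space \<Rightarrow> 'b::real_normed_vector"
  assumes [measurable]: "f \<in> borel_measurable borel" and l: "0 < l"
  shows "emeasure lborel {x. ennreal l < HL_max f x}
      \<le> ennreal (2 * 5 ^ DIM('a) / l) * (\<integral>\<^sup>+y. ennreal (norm (f y)) * indicator {y. l / 2 < norm (f y)} y \<partial>lborel)"
proof -
  \<comment> \<open>Replacing \<open>f\<close> by \<open>g\<close> lowers every average by at most \<open>l / 2\<close>.\<close>
  define g where "g y = (if l / 2 < norm (f y) then f y else 0)" for y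
  have [measurable]: "g \<in> borel_measurable borel"
    unfolding g_def by measurable
  have "{x. ennreal l < HL_max f x} \<subseteq> {x. ennreal (l / 2) < HL_max g x}"
  proof safe
    fix x assume "ennreal l < HL_max f x"
    also have "HL_max f x \<le> HL_max g x + ennreal (l / 2)"
      using l by (intro HL_max_bound_add) (auto simp: g_def)
    finally have "ennreal (l/2) + ennreal (l/2) < HL_max g x + ennreal (l / 2)"
      using l by (simp flip: ennreal_plus)
    then show "ennreal (l / 2) < HL_max g x"
      by (meson add_right_mono not_le)
  qed
  then have "ennreal (l/2) * emeasure lborel {x. ennreal l < HL_max f x} \<le> ennreal (l/2) * emeasure lborel {x. ennreal (l / 2) < HL_max g x}"
    by (intro mult_left_mono emeasure_mono) auto
  also have "\<dots> \<le> ennreal (5 ^ DIM('a)) * (\<integral>\<^sup>+y. ennreal (norm (g y)) \<partial>lborel)"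
    using l by (intro HL_max_weak_type) auto
  also have "(\<integral>\<^sup>+y. ennreal (norm (g y)) \<partial>lborel) = (\<integral>\<^sup>+y. ennreal (norm (f y)) * indicator {y. l / 2 < norm (f y)} y \<partial>lborel)"
    by (intro nn_integral_cong) (auto simp: g_def)
  finally have "ennreal (2 / l) * (ennreal (l/2) * emeasure lborel {x. ennreal l < HL_max f x})
     \<le> ennreal (2 / l) * (ennreal (5 ^ DIM('a)) * (\<integral>\<^sup>+y. ennreal (norm (f y)) * indicator {y. l / 2 < norm (f y)} y \<partial>lborel))"
    by (intro mult_left_mono) auto
  moreover have "ennreal (2 / l) * (ennreal (l/2) * z) = z" for z
    using l by (simp add: mult.assoc[symmetric] flip: ennreal_mult')
  moreover have "ennreal (2 / l) * (ennreal (5 ^ DIM('a)) * z) = ennreal (2 * 5 ^ DIM('a) / l) * z" for z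
    using l by (simp add: mult.assoc[symmetric] flip: ennreal_mult')
  ultimately show ?thesis by simp
qed

text \<open>
  Marcinkiewicz interpolation between the truncated weak-type inequality and the trivial bound at
  \<open>\<infinity>\<close>: after Tonelli's theorem, the integral of \<open>l\<^bsup>s-2\<^esup>\<close> up to \<open>2 |f|\<close> is finite exactly because
  \<open>s > 1\<close>.
\<close>
theorem HL_max_strong_type:
  fixes f :: "'a::euclidean_space \<Rightarrow> 'b::real_normed_vector"
  assumes [measurable]: "f \<in> borel_measurable borel" and s: "1 < s"
  shows "(\<integral>\<^sup>+x. epowr (HL_max f x) s \<partial>lborel)
    \<le> ennreal (2 powr s * 5 ^ DIM('a) * s / (s - 1)) * (\<integral>\<^sup>+y. ennreal (norm (f y) powr s) \<partial>lborel)"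
proof -
  have "(\<integral>\<^sup>+x. epowr (HL_max f x) s \<partial>lborel) =
      (\<integral>\<^sup>+x. \<integral>\<^sup>+l. ennreal (s * l powr (s - 1)) * indicator {l. 0 < l \<and> ennreal l < HL_max f x} l \<partial>lborel \<partial>lborel)"
    using s by (simp add: epowr_layer_cake)
  also have "\<dots> = (\<integral>\<^sup>+l. \<integral>\<^sup>+x. ennreal (s * l powr (s - 1)) * indicator {l. 0 < l \<and> ennreal l < HL_max f x} l \<partial>lborel \<partial>lborel)"
    by (rule lborel_pair.Fubini') measurable
  also have "\<dots> \<le> (\<integral>\<^sup>+l. \<integral>\<^sup>+y. ennreal (2 * 5 ^ DIM('a) * s * norm (f y) * (l powr (s - 2))) * indicator {0<..<2 * norm (f y)} l \<partial>lborel \<partial>lborel)"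
  proof (rule nn_integral_mono)
    fix l :: real
    show "(\<integral>\<^sup>+x. ennreal (s * l powr (s - 1)) * indicator {l. 0 < l \<and> ennreal l < HL_max f x} l \<partial>lborel)
      \<le> (\<integral>\<^sup>+y. ennreal (2 * 5 ^ DIM('a) * s * norm (f y) * (l powr (s - 2))) * indicator {0<..<2 * norm (f y)} l \<partial>lborel)"
    proof (cases "0 < l")
      case True
      have "(\<integral>\<^sup>+x. ennreal (s * l powr (s - 1)) * indicator {l. 0 < l \<and> ennreal l < HL_max f x} l \<partial>lborel)
         = (\<integral>\<^sup>+x. ennreal (s * l powr (s - 1)) * indicator {x. ennreal l < HL_max f x} x \<partial>lborel)"
        using True by (intro nn_integral_cong) (auto simp: indicator_def)
      also have "\<dots> = ennreal (s * l powr (s - 1)) * emeasure lborel {x. ennreal l < HL_max f x}"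
        by (intro nn_integral_cmult_indicator) simp
      also have "\<dots> \<le> ennreal (s * l powr (s - 1)) * (ennreal (2 * 5 ^ DIM('a) / l) * (\<integral>\<^sup>+y. ennreal (norm (f y)) * indicator {y. l / 2 < norm (f y)} y \<partial>lborel))"
        using True by (intro mult_left_mono HL_max_weak_type_truncated) auto
      also have "\<dots> = ennreal (s * l powr (s - 1) * (2 * 5 ^ DIM('a) / l)) * (\<integral>\<^sup>+y. ennreal (norm (f y)) * indicator {y. l / 2 < norm (f y)} y \<partial>lborel)"
        using True s by (subst ennreal_mult) (simp_all only: mult.assoc, simp_all)
      also have "\<dots> = (\<integral>\<^sup>+y. ennreal (s * l powr (s - 1) * (2 * 5 ^ DIM('a) / l)) * (ennreal (norm (f y)) * indicator {y. l / 2 < norm (f y)} y) \<partial>lborel)"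
        by (subst nn_integral_cmult) auto
      also have "s * l powr (s - 1) * (2 * 5 ^ DIM('a) / l) = 2 * 5 ^ DIM('a) * s * (l powr (s - 2))"
      proof -
        have "l powr (s - 1) = l powr (s - 2) * l powr 1"
          by (subst powr_add[symmetric]) simp
        then show ?thesis using True by simp
      qed
      also have "(\<integral>\<^sup>+y. ennreal (2 * 5 ^ DIM('a) * s * (l powr (s - 2))) * (ennreal (norm (f y)) * indicator {y. l / 2 < norm (f y)} y) \<partial>lborel)
        = (\<integral>\<^sup>+y. ennreal (2 * 5 ^ DIM('a) * s * norm (f y) * (l powr (s - 2))) * indicator {0<..<2 * norm (f y)} l \<partial>lborel)"
        using True s by (intro nn_integral_cong) (auto simp: indicator_def mult_ac simp flip: ennreal_mult)
      finally show ?thesis .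
    next
      case False
      then show ?thesis by simp
    qed
  qed
  also have "\<dots> = (\<integral>\<^sup>+y. \<integral>\<^sup>+l. ennreal (2 * 5 ^ DIM('a) * s * norm (f y) * (l powr (s - 2))) * indicator {0<..<2 * norm (f y)} l \<partial>lborel \<partial>lborel)"
    by (rule lborel_pair.Fubini') (unfold greaterThanLessThan_def greaterThan_def lessThan_def, measurable)
  also have "\<dots> = (\<integral>\<^sup>+y. ennreal (2 powr s * 5 ^ DIM('a) * s / (s - 1)) * ennreal (norm (f y) powr s) \<partial>lborel)"
  proof (intro nn_integral_cong)
    fix y
    have "(\<integral>\<^sup>+l. ennreal (2 * 5 ^ DIM('a) * s * norm (f y) * (l powr (s - 2))) * indicator {0<..<2 * norm (f y)} l \<partial>lborel)
      = (\<integral>\<^sup>+l. ennreal (2 * 5 ^ DIM('a) * s * norm (f y)) * (ennreal (l powr (s - 1 - 1)) * indicator {0<..<2 * norm (f y)} l) \<partial>lborel)"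
      using s by (intro nn_integral_cong) (simp add: ennreal_mult' mult.assoc)
    also have "\<dots> = ennreal (2 * 5 ^ DIM('a) * s * norm (f y)) * ennreal ((2 * norm (f y)) powr (s - 1) / (s - 1))"
      using s nn_integral_powr_Ioo[of "s - 1" "2 * norm (f y)"] by (subst nn_integral_cmult) auto
    also have "\<dots> = ennreal (2 powr s * 5 ^ DIM('a) * s / (s - 1) * norm (f y) powr s)"
    proof -
      have "(2 * norm (f y)) powr (s - 1) * (2 * norm (f y)) = (2 * norm (f y)) powr s"
        using powr_add[of "2 * norm (f y)" "s - 1" 1] by simp
      then have "2 * 5 ^ DIM('a) * s * norm (f y) * ((2 * norm (f y)) powr (s - 1) / (s - 1))
        = 5 ^ DIM('a) * s / (s - 1) * (2 * norm (f y)) powr s"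
        by (simp add: mult_ac)
      also have "\<dots> = 2 powr s * 5 ^ DIM('a) * s / (s - 1) * norm (f y) powr s"
        by (simp add: powr_mult)
      finally show ?thesis using s by (simp flip: ennreal_mult')
    qed
    also have "\<dots> = ennreal (2 powr s * 5 ^ DIM('a) * s / (s - 1)) * ennreal (norm (f y) powr s)"
      using s by (intro ennreal_mult) auto
    finally show "(\<integral>\<^sup>+l. ennreal (2 * 5 ^ DIM('a) * s * norm (f y) * (l powr (s - 2))) * indicator {0<..<2 * norm (f y)} l \<partial>lborel)
      = ennreal (2 powr s * 5 ^ DIM('a) * s / (s - 1)) * ennreal (norm (f y) powr s)" .
  qed
  also have "\<dots> = ennreal (2 powr s * 5 ^ DIM('a) * s / (s - 1)) * (\<integral>\<^sup>+y. ennreal (norm (f y) powr s) \<partial>lborel)"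
    by (intro nn_integral_cmult) auto
  finally show ?thesis .
qed

section \<open>Geometry of thin spherical shells\<close>

text \<open>
  In the plane the area of an annulus depends only on the difference of the squared radii. The
  reason for working with squared norms below is that this makes the bound uniform: no tangential
  case has to be singled out.
\<close>
lemma annulus_measure:
  fixes A \<epsilon> :: real
  assumes "0 \<le> \<epsilon>"
  shows "emeasure lborel {w :: real \<times> real. A \<le> (norm w)\<^sup>2 \<and> (norm w)\<^sup>2 < A + \<epsilon>} \<le> ennreal (pi * \<epsilon>)"
proof -
  have ball: "emeasure lborel (ball (0 :: real \<times> real) (sqrt t)) = ennreal (pi * t)" if "0 \<le> t" for t
    using that by (simp add: emeasure_ball eval_unit_ball_vol)
  have sq: "(norm w)\<^sup>2 < t \<longleftrightarrow> w \<in> ball (0 :: real \<times> real) (sqrt t)" if "0 \<le> t" for w t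
  proof -
    have "(norm w)\<^sup>2 < t \<longleftrightarrow> norm w < sqrt t"
      using that by (metis norm_ge_zero real_less_rsqrt real_sqrt_less_iff real_sqrt_unique)
    then show ?thesis by simp
  qed
  consider "A + \<epsilon> \<le> 0" | "A \<le> 0" "0 < A + \<epsilon>" | "0 \<le> A" by linarith
  then show ?thesis
  proof cases
    case 1
    have "{w :: real \<times> real. A \<le> (norm w)\<^sup>2 \<and> (norm w)\<^sup>2 < A + \<epsilon>} = {}"
      using 1 by (auto simp: not_less intro: order_trans[OF 1])
    then show ?thesis by (simp only: emeasure_empty) simp
  next
    case 2
    have "emeasure lborel {w :: real \<times> real. A \<le> (norm w)\<^sup>2 \<and> (norm w)\<^sup>2 < A + \<epsilon>}
       \<le> emeasure lborel (ball (0 :: real \<times> real) (sqrt (A + \<epsilon>)))"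
      using 2 by (intro emeasure_mono) (auto simp: sq simp del: mem_ball)
    also have "\<dots> \<le> ennreal (pi * \<epsilon>)"
      using 2 by (simp add: ball ennreal_leI)
    finally show ?thesis .
  next
    case 3
    have "{w :: real \<times> real. A \<le> (norm w)\<^sup>2 \<and> (norm w)\<^sup>2 < A + \<epsilon>}
       = ball 0 (sqrt (A + \<epsilon>)) - ball 0 (sqrt A)"
      using 3 assms by (auto simp: sq simp flip: not_less simp del: mem_ball)
    also have "emeasure lborel \<dots> = ennreal (pi * (A + \<epsilon>)) - ennreal (pi * A)"
      using 3 assms by (subst emeasure_Diff) (auto simp: ball intro!: subset_ball)
    also have "\<dots> = ennreal (pi * \<epsilon>)"
      using 3 assms by (simp add: ennreal_minus algebra_simps)
    finally show ?thesis by simp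
  qed
qed

lemma measurable_real3_coordinates [measurable]:
  "(\<lambda>p :: real \<times> real \<times> real.
      fst p *\<^sub>R axis 3 1 + (fst (snd p) *\<^sub>R axis 1 1 + snd (snd p) *\<^sub>R axis 2 1) :: real^3)
     \<in> borel_measurable borel"
  by (intro borel_measurable_continuous_onI continuous_intros)

text \<open>
  Lebesgue measure on vectors is the product of one axis with a plane, the form in which Tonelli's
  theorem slices it by planes orthogonal to that axis.
\<close>
lemma lborel_real3_coordinates:
  "distr lborel borel (\<lambda>p :: real \<times> real \<times> real.
      fst p *\<^sub>R axis 3 1 + (fst (snd p) *\<^sub>R axis 1 1 + snd (snd p) *\<^sub>R axis 2 1))
     = (lborel :: (real^3) measure)" (is "distr lborel borel ?T = _")
proof (rule lborel_eqI[symmetric])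
  show "sets (distr lborel borel ?T) = sets borel" by simp
  fix l u :: "real^3" assume le: "\<And>b. b \<in> Basis \<Longrightarrow> l \<bullet> b \<le> u \<bullet> b"
  have le': "l $ i \<le> u $ i" for i using le[of "axis i 1"] by (simp add: inner_axis axis_in_Basis_iff)
  have "?T -` box l u \<inter> space lborel
     = {l$3<..<u$3} \<times> {l$1<..<u$1} \<times> {l$2<..<u$2}"
    by (auto simp: mem_box_cart forall_3 axis_def)
  then have "emeasure (distr lborel borel ?T) (box l u) = emeasure lborel ({l$3<..<u$3} \<times> {l$1<..<u$1} \<times> {l$2<..<u$2})"
    by (subst emeasure_distr) (auto intro: measurable_real3_coordinates)
  also have "\<dots> = emeasure lborel {l$3<..<u$3} * (emeasure lborel {l$1<..<u$1} * emeasure lborel {l$2<..<u$2})"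
  proof -
    have times: "emeasure lborel (A \<times> B) = emeasure lborel A * emeasure lborel B"
      if "A \<in> sets borel" "B \<in> sets borel" for A :: "real set" and B :: "'c::euclidean_space set"
      using that by (subst lborel_prod[symmetric], intro lborel.emeasure_pair_measure_Times) auto
    have "{l$1<..<u$1} \<times> {l$2<..<u$2} \<in> sets (borel :: (real \<times> real) measure)"
      by (intro borel_open open_Times) auto
    then show ?thesis by (simp add: times)
  qed
  also have "\<dots> = ennreal ((u$3 - l$3) * ((u$1 - l$1) * (u$2 - l$2)))"
    using le' by (simp add: ennreal_mult)
  also have "(u$3 - l$3) * ((u$1 - l$1) * (u$2 - l$2)) = (\<Prod>i\<in>UNIV. (u - l) \<bullet> axis i 1)"
    unfolding UNIV_3 by (simp add: inner_axis mult_ac)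
  also have "\<dots> = (\<Prod>b\<in>Basis. (u - l) \<bullet> b)"
  proof -
    have B: "(Basis :: (real^3) set) = (\<lambda>i. axis i 1) ` UNIV" by (auto simp: Basis_vec_def)
    have "inj (\<lambda>i::3. axis i (1::real))" by (auto simp: inj_on_def axis_eq_axis)
    then show ?thesis unfolding B by (simp add: prod.reindex)
  qed
  finally show "emeasure (distr lborel borel ?T) (box l u) = ennreal (\<Prod>b\<in>Basis. (u - l) \<bullet> b)" .
qed

lemma slab_in_shell_axis:
  assumes "0 \<le> \<epsilon>" "0 \<le> \<kappa>"
  shows "emeasure lborel {x :: real^3. a \<le> (norm x)\<^sup>2 \<and> (norm x)\<^sup>2 < a + \<epsilon> \<and> b \<le> x $ 3 \<and> x $ 3 \<le> b + \<kappa>}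
     \<le> ennreal (pi * \<epsilon> * \<kappa>)"
proof -
  define S where "S = {x :: real^3. a \<le> (norm x)\<^sup>2 \<and> (norm x)\<^sup>2 < a + \<epsilon> \<and> b \<le> x $ 3 \<and> x $ 3 \<le> b + \<kappa>}"
  define T :: "real \<times> real \<times> real \<Rightarrow> real^3" where
    "T p = fst p *\<^sub>R axis 3 1 + (fst (snd p) *\<^sub>R axis 1 1 + snd (snd p) *\<^sub>R axis 2 1)" for p
  have T [measurable]: "T \<in> borel_measurable borel" and distr_T: "distr lborel borel T = lborel"
    unfolding T_def[abs_def] by (rule measurable_real3_coordinates, rule lborel_real3_coordinates)
  have norm_T: "(norm (T (z, w)))\<^sup>2 = z\<^sup>2 + (norm w)\<^sup>2" for z w
    unfolding power2_norm_eq_inner T_def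
    by (simp add: inner_add_left inner_add_right inner_axis_axis inner_prod_def power2_eq_square)
  have T_3: "T (z, w) $ 3 = z" for z w
    by (simp add: T_def axis_def)
  have S [measurable]: "S \<in> sets borel" unfolding S_def by measurable
  have "emeasure lborel S = emeasure (distr lborel borel T) S"
    by (simp only: distr_T)
  also have "\<dots> = emeasure (lborel \<Otimes>\<^sub>M lborel) (T -` S)"
    by (subst emeasure_distr) (simp_all add: lborel_prod)
  also have "\<dots> = (\<integral>\<^sup>+z. emeasure lborel (Pair z -` (T -` S)) \<partial>lborel)"
    using measurable_sets[OF T S]
    by (intro lborel.emeasure_pair_measure_alt) (simp only: lborel_prod sets_lborel space_borel Int_UNIV_right)
  also have "\<dots> \<le> (\<integral>\<^sup>+z. ennreal (pi * \<epsilon>) * indicator {b..b+\<kappa>} z \<partial>lborel)"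
  proof (rule nn_integral_mono)
    fix z :: real
    show "emeasure lborel (Pair z -` (T -` S)) \<le> ennreal (pi * \<epsilon>) * indicator {b..b+\<kappa>} z"
    proof (cases "z \<in> {b..b+\<kappa>}")
      case True
      have "emeasure lborel (Pair z -` (T -` S))
         \<le> emeasure lborel {w :: real \<times> real. a - z\<^sup>2 \<le> (norm w)\<^sup>2 \<and> (norm w)\<^sup>2 < a - z\<^sup>2 + \<epsilon>}"
      proof (intro emeasure_mono subsetI CollectI)
        fix w assume "w \<in> Pair z -` (T -` S)"
        then have "T (z, w) \<in> S" by simp
        then show "a - z\<^sup>2 \<le> (norm w)\<^sup>2 \<and> (norm w)\<^sup>2 < a - z\<^sup>2 + \<epsilon>"
          unfolding S_def mem_Collect_eq norm_T by linarith
      qed simp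
      also have "\<dots> \<le> ennreal (pi * \<epsilon>)" by (rule annulus_measure[OF assms(1)])
      finally show ?thesis using True by simp
    next
      case False
      then have "Pair z -` (T -` S) = {}" by (auto simp: S_def T_3)
      then show ?thesis by (simp only: emeasure_empty) simp
    qed
  qed
  also have "\<dots> = ennreal (pi * \<epsilon> * \<kappa>)"
    using assms by (simp add: nn_integral_cmult_indicator ennreal_mult)
  finally show ?thesis unfolding S_def .
qed

text \<open>
  By rotation invariance the slab may be taken orthogonal to a coordinate axis. Each of its slices
  is then an annulus.
\<close>
lemma slab_in_shell:
  fixes e :: "real^3"
  assumes "norm e = 1" "0 \<le> \<epsilon>" "0 \<le> \<kappa>"
  shows "emeasure lborel {x :: real^3. a \<le> (norm x)\<^sup>2 \<and> (norm x)\<^sup>2 < a + \<epsilon> \<and> b \<le> x \<bullet> e \<and> x \<bullet> e \<le> b + \<kappa>}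
     \<le> ennreal (pi * \<epsilon> * \<kappa>)" (is "emeasure _ ?S \<le> _")
proof -
  obtain T where T: "orthogonal_transformation T" "T (axis 3 1 :: real^3) = e"
    by (rule orthogonal_transformation_exists_1[of "axis 3 1" e]) (use assms(1) in auto)
  let ?S' = "{x :: real^3. a \<le> (norm x)\<^sup>2 \<and> (norm x)\<^sup>2 < a + \<epsilon> \<and> b \<le> x $ 3 \<and> x $ 3 \<le> b + \<kappa>}"
  have ip: "T x \<bullet> e = x $ 3" for x :: "real^3"
  proof -
    have "T x \<bullet> T (axis 3 1) = x \<bullet> axis 3 1"
      using T(1) by (simp add: orthogonal_transformation_def)
    then show ?thesis by (simp add: T(2) inner_axis)
  qed
  have eq: "?S = T ` ?S'"
  proof (intro equalityI subsetI)
    fix x assume x: "x \<in> ?S"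
    obtain y where y: "x = T y"
      using orthogonal_transformation_surj[OF T(1)] by (metis surjD)
    then show "x \<in> T ` ?S'"
      using x ip[of y] orthogonal_transformation_norm[OF T(1), of y] by auto
  qed (auto simp: ip orthogonal_transformation_norm[OF T(1)])
  have bdd: "bounded {x :: real^3. a \<le> (norm x)\<^sup>2 \<and> (norm x)\<^sup>2 < a + \<epsilon> \<and> P x}" for P
    by (rule bounded_subset[OF bounded_ball[of 0 "sqrt (a + \<epsilon>)"]]) (auto intro: real_less_rsqrt)
  have lm: "{x :: real^3. a \<le> (norm x)\<^sup>2 \<and> (norm x)\<^sup>2 < a + \<epsilon> \<and> b \<le> x \<bullet> v \<and> x \<bullet> v \<le> b + \<kappa>} \<in> lmeasurable" for v
    by (rule bounded_set_imp_lmeasurable[OF bdd]) (intro sets_completionI_sets, simp, measurable)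
  have S': "?S' = {x :: real^3. a \<le> (norm x)\<^sup>2 \<and> (norm x)\<^sup>2 < a + \<epsilon> \<and> b \<le> x \<bullet> axis 3 1 \<and> x \<bullet> axis 3 1 \<le> b + \<kappa>}"
    by (simp add: inner_axis)
  have em: "emeasure lborel A = ennreal (measure lebesgue A)" if "A \<in> lmeasurable" "A \<in> sets borel" for A :: "(real^3) set"
    using that emeasure_eq_measure2[OF that(1)] by (simp add: main_part_sets)
  have "emeasure lborel ?S = ennreal (measure lebesgue ?S)"
    by (rule em[OF lm]) measurable
  also have "\<dots> = ennreal (measure lebesgue ?S')"
    unfolding eq using lm[of "axis 3 1"] by (subst measure_orthogonal_image[OF T(1)]) (simp_all add: S')
  also have "\<dots> = emeasure lborel ?S'"
    using lm[of "axis 3 1"] by (subst em) (simp_all add: S')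
  also have "\<dots> \<le> ennreal (pi * \<epsilon> * \<kappa>)"
    by (rule slab_in_shell_axis[OF assms(2,3)])
  finally show ?thesis .
qed

text \<open>
  Half-open, so that a ball of radius \<open>1 + \<delta>\<close> is the disjoint union of the unit ball and the shell.
\<close>
definition shell :: "real \<Rightarrow> 'a::real_normed_vector set" where
  "shell \<delta> = {x. 1 \<le> norm x \<and> norm x < 1 + \<delta>}"

lemma measurable_shell [measurable]: "(shell \<delta> :: 'a::euclidean_space set) \<in> sets borel"
  unfolding shell_def by measurable

text \<open>
  If \<open>x\<close> and \<open>\<eta> - x\<close> both lie in the shell, then subtracting their squared norms confines the
  component of \<open>x\<close> along \<open>\<eta>\<close> to an interval of length \<open>O(\<delta> / |\<eta>|)\<close>. So the intersection lies in a
  slab of width \<open>O(\<delta>)\<close> inside a shell of width \<open>O(\<delta>)\<close>.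
\<close>
lemma shell_intersection_measure:
  fixes \<eta> :: "real^3"
  assumes \<delta>: "0 < \<delta>" "\<delta> \<le> 1" and \<eta>: "1 \<le> norm \<eta>"
  shows "emeasure lborel {x. x \<in> shell \<delta> \<and> \<eta> - x \<in> shell \<delta>} \<le> ennreal (9 * pi * \<delta>\<^sup>2)"
proof -
  define e where "e = \<eta> /\<^sub>R norm \<eta>"
  have "\<eta> \<noteq> 0" using \<eta> by auto
  then have e: "norm e = 1" by (simp add: e_def)
  define b where "b = (norm \<eta>) / 2 - 3 * \<delta> / 2"
  have "emeasure lborel {x. x \<in> shell \<delta> \<and> \<eta> - x \<in> shell \<delta>}
      \<le> emeasure lborel {x :: real^3. 1 \<le> (norm x)\<^sup>2 \<and> (norm x)\<^sup>2 < 1 + 3 * \<delta> \<and> b \<le> x \<bullet> e \<and> x \<bullet> e \<le> b + 3 * \<delta>}"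
  proof (intro emeasure_mono subsetI CollectI)
    fix x assume "x \<in> {x. x \<in> shell \<delta> \<and> \<eta> - x \<in> shell \<delta>}"
    moreover have *: "1 \<le> (norm z)\<^sup>2 \<and> (norm z)\<^sup>2 < 1 + 3 * \<delta>" if "z \<in> shell \<delta>" for z :: "real^3"
    proof -
      have "1\<^sup>2 \<le> (norm z)\<^sup>2" using that by (intro power_mono) (auto simp: shell_def)
      moreover have "(norm z)\<^sup>2 < (1 + \<delta>)\<^sup>2" using that by (intro power_strict_mono) (auto simp: shell_def)
      moreover have "\<delta>\<^sup>2 \<le> \<delta>" using \<delta> by (simp add: power2_eq_square mult_left_le)
      ultimately show ?thesis by (simp add: power2_sum)
    qed
    ultimately have x: "1 \<le> (norm x)\<^sup>2" "(norm x)\<^sup>2 < 1 + 3 * \<delta>"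
      "1 \<le> (norm (\<eta> - x))\<^sup>2" "(norm (\<eta> - x))\<^sup>2 < 1 + 3 * \<delta>" by auto
    have "(norm (\<eta> - x))\<^sup>2 = (norm \<eta>)\<^sup>2 + (norm x)\<^sup>2 - 2 * (x \<bullet> \<eta>)"
      by (simp add: power2_norm_eq_inner inner_diff inner_commute)
    then have "\<bar>2 * (x \<bullet> \<eta>) - (norm \<eta>)\<^sup>2\<bar> \<le> 3 * \<delta>" using x by simp
    moreover have "x \<bullet> \<eta> = norm \<eta> * (x \<bullet> e)" using \<open>\<eta> \<noteq> 0\<close> by (simp add: e_def)
    ultimately have "\<bar>norm \<eta> * (2 * (x \<bullet> e) - norm \<eta>)\<bar> \<le> 3 * \<delta>"
      by (simp add: power2_eq_square algebra_simps)
    moreover have "1 * \<bar>2 * (x \<bullet> e) - norm \<eta>\<bar> \<le> norm \<eta> * \<bar>2 * (x \<bullet> e) - norm \<eta>\<bar>"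
      using \<eta> by (intro mult_right_mono) auto
    ultimately have "\<bar>2 * (x \<bullet> e) - norm \<eta>\<bar> \<le> 3 * \<delta>"
      using \<eta> by (simp add: abs_mult)
    then show "1 \<le> (norm x)\<^sup>2 \<and> (norm x)\<^sup>2 < 1 + 3 * \<delta> \<and> b \<le> x \<bullet> e \<and> x \<bullet> e \<le> b + 3 * \<delta>"
      using x by (auto simp: b_def abs_le_iff)
  next
    show "{x :: real^3. 1 \<le> (norm x)\<^sup>2 \<and> (norm x)\<^sup>2 < 1 + 3 * \<delta> \<and> b \<le> x \<bullet> e \<and> x \<bullet> e \<le> b + 3 * \<delta>} \<in> sets lborel"
      by measurable
  qed
  also have "\<dots> \<le> ennreal (pi * (3 * \<delta>) * (3 * \<delta>))"
    using \<delta> by (intro slab_in_shell[OF e]) auto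
  also have "\<dots> = ennreal (9 * pi * \<delta>\<^sup>2)" by (simp add: power2_eq_square mult_ac)
  finally show ?thesis .
qed

text \<open>
  The convolution of the indicator of \<open>X\<close> with itself is bounded by the volume of the intersection of
  two shells. The separation hypothesis excludes sums near \<open>0\<close>, where this volume is much
  larger than \<open>\<delta>\<^sup>2\<close>.
\<close>
lemma shell_convolution_bound:
  fixes F :: "real^3 \<Rightarrow> ennreal" and X :: "(real^3) set"
  assumes [measurable]: "F \<in> borel_measurable borel" "X \<in> sets borel"
    and \<delta>: "0 < \<delta>" "\<delta> \<le> 1" and X: "X \<subseteq> shell \<delta>"
    and sep: "\<And>x y. x \<in> X \<Longrightarrow> y \<in> X \<Longrightarrow> 1 \<le> norm (x + y)"
  shows "(\<integral>\<^sup>+x\<in>X. (\<integral>\<^sup>+y\<in>X. F (x + y) \<partial>lborel) \<partial>lborel) \<le> ennreal (9 * pi * \<delta>\<^sup>2) * (\<integral>\<^sup>+z. F z \<partial>lborel)"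
proof -
  have "(\<integral>\<^sup>+x\<in>X. (\<integral>\<^sup>+y\<in>X. F (x + y) \<partial>lborel) \<partial>lborel)
     = (\<integral>\<^sup>+x. (\<integral>\<^sup>+z. F z * indicator X (z - x) * indicator X x \<partial>lborel) \<partial>lborel)"
  proof (rule nn_integral_cong)
    fix x :: "real^3"
    have "(\<integral>\<^sup>+y\<in>X. F (x + y) \<partial>lborel) = (\<integral>\<^sup>+y. F (x + y) * indicator X ((x + y) - x) \<partial>lborel)" by simp
    also have "\<dots> = (\<integral>\<^sup>+z. F z * indicator X (z - x) \<partial>lborel)"
      by (rule nn_integral_lborel_translate) measurable
    finally show "(\<integral>\<^sup>+y\<in>X. F (x + y) \<partial>lborel) * indicator X x = (\<integral>\<^sup>+z. F z * indicator X (z - x) * indicator X x \<partial>lborel)"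
      by (subst nn_integral_multc) auto
  qed
  also have "\<dots> = (\<integral>\<^sup>+z. (\<integral>\<^sup>+x. F z * indicator X (z - x) * indicator X x \<partial>lborel) \<partial>lborel)"
    by (rule lborel_pair.Fubini') measurable
  also have "\<dots> \<le> (\<integral>\<^sup>+z. ennreal (9 * pi * \<delta>\<^sup>2) * F z \<partial>lborel)"
  proof (rule nn_integral_mono)
    fix z :: "real^3"
    have [measurable]: "{x. x \<in> X \<and> z - x \<in> X} \<in> sets borel" by measurable
    have "(\<integral>\<^sup>+x. F z * indicator X (z - x) * indicator X x \<partial>lborel) = (\<integral>\<^sup>+x. F z * indicator {x. x \<in> X \<and> z - x \<in> X} x \<partial>lborel)"
      by (intro nn_integral_cong) (auto simp: indicator_def)
    also have "\<dots> = F z * emeasure lborel {x. x \<in> X \<and> z - x \<in> X}"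
      by (rule nn_integral_cmult_indicator) simp
    also have "\<dots> \<le> F z * ennreal (9 * pi * \<delta>\<^sup>2)"
    proof (cases "1 \<le> norm z")
      case True
      have "emeasure lborel {x. x \<in> X \<and> z - x \<in> X} \<le> emeasure lborel {x. x \<in> shell \<delta> \<and> z - x \<in> shell \<delta>}"
        using X by (intro emeasure_mono) auto
      also have "\<dots> \<le> ennreal (9 * pi * \<delta>\<^sup>2)" by (rule shell_intersection_measure[OF \<delta> True])
      finally show ?thesis by (intro mult_left_mono) auto
    next
      case False
      have "{x. x \<in> X \<and> z - x \<in> X} = {}"
        using False sep[of _ "z - _"] by force
      then show ?thesis by (simp only: emeasure_empty) simp
    qed
    finally show "(\<integral>\<^sup>+x. F z * indicator X (z - x) * indicator X x \<partial>lborel) \<le> ennreal (9 * pi * \<delta>\<^sup>2) * F z"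
      by (simp add: mult.commute)
  qed
  also have "\<dots> = ennreal (9 * pi * \<delta>\<^sup>2) * (\<integral>\<^sup>+z. F z \<partial>lborel)"
    by (rule nn_integral_cmult) simp
  finally show ?thesis .
qed

lemma nn_integral_sphere_measure:
  fixes \<phi> :: "'a::euclidean_space \<Rightarrow> ennreal"
  assumes [measurable]: "\<phi> \<in> borel_measurable borel"
  shows "(\<integral>\<^sup>+\<omega>. \<phi> \<omega> \<partial>sphere_measure) = of_nat DIM('a) * (\<integral>\<^sup>+x\<in>ball 0 1 - {0}. \<phi> (sgn x) \<partial>lborel)"
proof -
  have [measurable]: "ball (0::'a) 1 - {0} \<in> sets borel" by simp
  have "\<phi> \<in> borel_measurable (restrict_space borel (sphere (0::'a) 1))"
    by (rule measurable_restrict_space1) simp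
  then show ?thesis
    by (simp add: sphere_measure_def nn_integral_scale_measure nn_integral_distr[OF measurable_sgn_sphere]
        nn_integral_restrict_space)
qed

lemma measurable_sgn [measurable]: "(sgn :: 'a::euclidean_space \<Rightarrow> 'a) \<in> borel_measurable borel"
proof -
  have "(\<lambda>x::'a. inverse (norm x) *\<^sub>R x) \<in> borel_measurable borel" by measurable
  then show ?thesis by (simp add: sgn_div_norm[abs_def])
qed

text \<open>
  Surface measure is defined through cones in the unit ball, and the function \<open>\<phi> (sgn x)\<close> is
  homogeneous of degree \<open>0\<close>, so its integral over a ball of radius \<open>t\<close> is proportional to \<open>t\<^sup>d\<close>.
  Bernoulli's inequality for \<open>(1 + \<delta>)\<^sup>d - 1\<close> gives the comparison. Boundedness of \<open>\<phi>\<close> allows the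
  integral over the unit ball to be cancelled.
\<close>
lemma nn_integral_sphere_le_shell:
  fixes \<phi> :: "'a::euclidean_space \<Rightarrow> ennreal"
  assumes [measurable]: "\<phi> \<in> borel_measurable borel" and bdd: "\<And>x. \<phi> x \<le> ennreal B" and \<delta>: "0 < \<delta>"
  shows "ennreal \<delta> * (\<integral>\<^sup>+\<omega>. \<phi> \<omega> \<partial>sphere_measure) \<le> (\<integral>\<^sup>+x\<in>shell \<delta>. \<phi> (sgn x) \<partial>lborel)"
proof -
  define d where "d = DIM('a)"
  define I where "I = (\<integral>\<^sup>+x\<in>ball 0 1 - {0}. \<phi> (sgn x) \<partial>lborel)"
  have [measurable]: "ball (0::'a) r - {0} \<in> sets borel" for r by simp
  have scaled: "(\<integral>\<^sup>+x\<in>ball 0 (1 + \<delta>) - {0}. \<phi> (sgn x) \<partial>lborel) = ennreal ((1 + \<delta>) ^ d) * I"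
  proof -
    have "(\<integral>\<^sup>+x\<in>ball 0 (1 + \<delta>) - {0}. \<phi> (sgn x) \<partial>lborel)
       = ennreal (\<bar>1 + \<delta>\<bar> ^ d) * (\<integral>\<^sup>+x. \<phi> (sgn (0 + (1 + \<delta>) *\<^sub>R x)) * indicator (ball 0 (1 + \<delta>) - {0}) (0 + (1 + \<delta>) *\<^sub>R x) \<partial>lborel)"
      unfolding d_def using \<delta> by (intro nn_integral_lborel_affine) auto
    also have "(\<integral>\<^sup>+x. \<phi> (sgn (0 + (1 + \<delta>) *\<^sub>R x)) * indicator (ball 0 (1 + \<delta>) - {0}) (0 + (1 + \<delta>) *\<^sub>R x) \<partial>lborel) = I"
      unfolding I_def using \<delta> by (intro nn_integral_cong) (auto simp: indicator_def sgn_scaleR)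
    finally show ?thesis using \<delta> by simp
  qed
  have split: "ennreal ((1 + \<delta>) ^ d) * I \<le> I + (\<integral>\<^sup>+x\<in>shell \<delta>. \<phi> (sgn x) \<partial>lborel)"
  proof -
    have "(\<integral>\<^sup>+x\<in>ball 0 (1 + \<delta>) - {0}. \<phi> (sgn x) \<partial>lborel)
       \<le> (\<integral>\<^sup>+x. \<phi> (sgn x) * indicator (ball 0 1 - {0}) x + \<phi> (sgn x) * indicator (shell \<delta>) x \<partial>lborel)"
      by (intro nn_integral_mono) (auto simp: indicator_def shell_def)
    also have "\<dots> = I + (\<integral>\<^sup>+x\<in>shell \<delta>. \<phi> (sgn x) \<partial>lborel)"
      unfolding I_def by (intro nn_integral_add) auto
    finally show ?thesis unfolding scaled .
  qed
  have "I \<le> (\<integral>\<^sup>+x. ennreal B * indicator (ball (0::'a) 1) x \<partial>lborel)"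
    unfolding I_def using bdd by (intro nn_integral_mono) (auto simp: indicator_def)
  also have "\<dots> = ennreal B * emeasure lborel (ball (0::'a) 1)"
    by (simp add: nn_integral_cmult_indicator)
  also have "\<dots> < top"
    by (simp add: emeasure_ball ennreal_mult_less_top)
  finally obtain J where J: "I = ennreal J" "0 \<le> J"
    by (cases I) auto
  have "ennreal \<delta> * (of_nat d * I) \<le> (\<integral>\<^sup>+x\<in>shell \<delta>. \<phi> (sgn x) \<partial>lborel)"
  proof (cases "\<integral>\<^sup>+x\<in>shell \<delta>. \<phi> (sgn x) \<partial>lborel")
    case (real R)
    have "(1 + \<delta>) ^ d * J \<le> J + R"
      using split real J \<delta> by (simp flip: ennreal_mult' ennreal_plus)
    moreover have "1 + real d * \<delta> \<le> (1 + \<delta>) ^ d"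
      using \<delta> by (intro Bernoulli_inequality) auto
    ultimately have "(1 + real d * \<delta>) * J \<le> J + R"
      using J(2) by (meson mult_right_mono order_trans)
    then have "\<delta> * (real d * J) \<le> R" by (simp add: algebra_simps)
    then show ?thesis
      using real J \<delta> by (simp add: ennreal_of_nat_eq_real_of_nat flip: ennreal_mult')
  qed simp
  then show ?thesis
    by (simp add: nn_integral_sphere_measure I_def d_def)
qed

lemma lborel_integral_affine:
  fixes f :: "'a::euclidean_space \<Rightarrow> 'b::{banach, second_countable_topology}"
  assumes [measurable]: "f \<in> borel_measurable borel" and c: "c \<noteq> 0"
  shows "(LINT x|lborel. f x) = (\<bar>c\<bar> ^ DIM('a)) *\<^sub>R (LINT x|lborel. f (t + c *\<^sub>R x))"
proof -
  have "(LINT x|lborel. f x) = (LINT x|density (distr lborel borel (\<lambda>x. t + c *\<^sub>R x)) (\<lambda>_. ennreal (\<bar>c\<bar> ^ DIM('a))). f x)"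
    using lborel_affine[OF c, of t] by simp
  also have "\<dots> = (LINT x|distr lborel borel (\<lambda>x. t + c *\<^sub>R x). (\<bar>c\<bar> ^ DIM('a)) *\<^sub>R f x)"
    by (rule integral_density) auto
  also have "\<dots> = (LINT x|lborel. (\<bar>c\<bar> ^ DIM('a)) *\<^sub>R f (t + c *\<^sub>R x))"
    by (rule integral_distr) measurable
  finally show ?thesis by simp
qed

section \<open>The Fourier transform: Plancherel's inequality\<close>

lemma integrable_kernel_mult:
  fixes f E :: "'a::euclidean_space \<Rightarrow> complex"
  assumes f: "integrable lborel f" and E: "E \<in> borel_measurable borel" "\<And>y. norm (E y) \<le> 1"
  shows "integrable lborel (\<lambda>y. E y * f y)"
proof (rule Bochner_Integration.integrable_bound[OF f])
  show "(\<lambda>y. E y * f y) \<in> borel_measurable lborel"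
    using f E by (auto intro!: borel_measurable_times borel_measurable_integrable)
  have "norm (E y) * norm (f y) \<le> 1 * norm (f y)" for y
    using E by (intro mult_right_mono) auto
  then show "AE y in lborel. norm (E y * f y) \<le> norm (f y)"
    by (simp add: norm_mult)
qed

text \<open>
  The one form of Fubini's theorem that is used for oscillating integrals: an integral against a
  kernel of modulus at most \<open>1\<close> can be moved from one integrable function to the other.
\<close>
lemma Fubini_bounded_kernel:
  fixes f :: "'b::euclidean_space \<Rightarrow> complex" and g :: "'a::euclidean_space \<Rightarrow> complex"
  assumes f: "integrable lborel f" and g: "integrable lborel g"
    and E: "(\<lambda>(x, y). E x y) \<in> borel_measurable (borel \<Otimes>\<^sub>M borel)" "\<And>x y. norm (E x y) \<le> 1"
  shows "(LINT x|lborel. g x * (LINT y|lborel. E x y * f y)) = (LINT y|lborel. f y * (LINT x|lborel. E x y * g x))"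
proof -
  have fm [measurable]: "f \<in> borel_measurable borel" and gm [measurable]: "g \<in> borel_measurable borel"
    using f g by (auto dest: borel_measurable_integrable)
  have Em [measurable]: "(\<lambda>p. E (fst p) (snd p)) \<in> borel_measurable (borel \<Otimes>\<^sub>M borel)"
    using E(1) by (simp add: case_prod_beta)
  have "integrable (lborel \<Otimes>\<^sub>M lborel) (\<lambda>p. g (fst p) * (E (fst p) (snd p) * f (snd p)))"
  proof (rule integrableI_bounded)
    show "(\<lambda>p. g (fst p) * (E (fst p) (snd p) * f (snd p))) \<in> borel_measurable (lborel \<Otimes>\<^sub>M lborel)"
      by measurable
    have "(\<integral>\<^sup>+p. ennreal (norm (g (fst p) * (E (fst p) (snd p) * f (snd p)))) \<partial>(lborel \<Otimes>\<^sub>M lborel))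
       \<le> (\<integral>\<^sup>+p. ennreal (norm (g (fst p))) * ennreal (norm (f (snd p))) \<partial>(lborel \<Otimes>\<^sub>M lborel))"
    proof (rule nn_integral_mono)
      fix p :: "'a \<times> 'b"
      have "norm (E (fst p) (snd p)) * norm (f (snd p)) \<le> 1 * norm (f (snd p))"
        using E by (intro mult_right_mono) auto
      then have "norm (g (fst p)) * (norm (E (fst p) (snd p)) * norm (f (snd p))) \<le> norm (g (fst p)) * norm (f (snd p))"
        by (intro mult_left_mono) auto
      then show "ennreal (norm (g (fst p) * (E (fst p) (snd p) * f (snd p)))) \<le> ennreal (norm (g (fst p))) * ennreal (norm (f (snd p)))"
        by (simp add: norm_mult ennreal_leI flip: ennreal_mult)
    qed
    also have "\<dots> = (\<integral>\<^sup>+x. \<integral>\<^sup>+y. ennreal (norm (g x)) * ennreal (norm (f y)) \<partial>lborel \<partial>lborel)"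
    proof -
      have "(\<lambda>p. ennreal (norm (g (fst p))) * ennreal (norm (f (snd p)))) \<in> borel_measurable (lborel \<Otimes>\<^sub>M lborel)"
        by measurable
      from lborel.nn_integral_fst[OF this] show ?thesis by simp
    qed
    also have "\<dots> = (\<integral>\<^sup>+x. ennreal (norm (g x)) \<partial>lborel) * (\<integral>\<^sup>+y. ennreal (norm (f y)) \<partial>lborel)"
      by (simp add: nn_integral_cmult nn_integral_multc)
    also have "\<dots> < \<infinity>"
      using f g by (simp add: integrable_iff_bounded ennreal_mult_less_top)
    finally show "(\<integral>\<^sup>+p. ennreal (norm (g (fst p) * (E (fst p) (snd p) * f (snd p)))) \<partial>(lborel \<Otimes>\<^sub>M lborel)) < \<infinity>" .
  qed
  then have "(LINT y|lborel. LINT x|lborel. g x * (E x y * f y)) = (LINT x|lborel. LINT y|lborel. g x * (E x y * f y))"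
    by (intro lborel_pair.Fubini_integral) (simp add: split_beta')
  moreover have "(LINT y|lborel. g x * (E x y * f y)) = g x * (LINT y|lborel. E x y * f y)" for x
    by simp
  moreover have "(LINT x|lborel. g x * (E x y * f y)) = f y * (LINT x|lborel. E x y * g x)" for y
    by (subst integral_mult_right_zero[symmetric]) (simp add: mult_ac)
  ultimately show ?thesis by simp
qed

definition character :: "'a::euclidean_space \<Rightarrow> 'a \<Rightarrow> complex" where
  "character x \<xi> = exp (- 2 * of_real pi * \<i> * of_real (x \<bullet> \<xi>))"

lemma fourier_eq_character_integral: "fourier f \<xi> = (LINT x|lborel. character x \<xi> * f x)"
  by (simp add: fourier_def character_def)

lemma norm_character [simp]: "norm (character x \<xi>) = 1"
  by (simp add: character_def norm_exp_eq_Re)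

lemma character_commute: "character x \<xi> = character \<xi> x"
  by (simp add: character_def inner_commute)

lemma character_add: "character (x + y) \<xi> = character x \<xi> * character y \<xi>"
  by (simp add: character_def inner_add_left ring_distribs flip: exp_add)

lemma character_diff: "character (x - y) \<xi> = character x \<xi> * cnj (character y \<xi>)"
  by (simp add: character_def exp_cnj inner_diff_left algebra_simps flip: exp_add)

lemma measurable_character [measurable]:
  "(\<lambda>p. character (fst p) (snd p)) \<in> borel_measurable (borel \<Otimes>\<^sub>M (borel :: 'a::euclidean_space measure))"
  unfolding character_def by measurable

lemma measurable_character1 [measurable]: "(\<lambda>x. character x \<xi>) \<in> borel_measurable borel"
  "(\<lambda>x. character \<xi> x) \<in> borel_measurable borel"
  unfolding character_def by measurable

text \<open>
  This identity plays the part of duality: it moves the Fourier transform from \<open>f\<close> onto the test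
  function.
\<close>
lemma fourier_multiplication_formula:
  fixes f g :: "'a::euclidean_space \<Rightarrow> complex"
  assumes "integrable lborel f" "integrable lborel g"
  shows "(LINT \<xi>|lborel. fourier f \<xi> * g \<xi>) = (LINT x|lborel. f x * fourier g x)"
proof -
  have "(LINT \<xi>|lborel. g \<xi> * (LINT x|lborel. character x \<xi> * f x)) = (LINT x|lborel. f x * (LINT \<xi>|lborel. character x \<xi> * g \<xi>))"
    by (rule Fubini_bounded_kernel[OF assms]) (auto simp: case_prod_beta character_commute)
  then show ?thesis
    by (simp add: fourier_eq_character_integral mult.commute[of "g _"] character_commute)
qed

lemma norm_fourier_le:
  assumes "integrable lborel f"
  shows "norm (fourier f \<xi>) \<le> (LINT x|lborel. norm (f x))"
proof -
  have "norm (fourier f \<xi>) \<le> (LINT x|lborel. norm (character x \<xi> * f x))"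
    unfolding fourier_eq_character_integral by (rule integral_norm_bound)
  then show ?thesis by (simp add: norm_mult)
qed

lemma measurable_fourier [measurable]:
  assumes "f \<in> borel_measurable borel"
  shows "fourier f \<in> borel_measurable borel"
proof -
  note [measurable] = assms
  have "(\<lambda>\<xi>. LINT x|lborel. character x \<xi> * f x) \<in> borel_measurable borel"
  proof (rule lborel.borel_measurable_lebesgue_integral)
    show "(\<lambda>(\<xi>, x). character x \<xi> * f x) \<in> borel_measurable (borel \<Otimes>\<^sub>M lborel)"
      unfolding case_prod_beta character_commute[of "snd _"] by measurable
  qed
  then show ?thesis by (simp add: fourier_eq_character_integral[abs_def])
qed

lemma measurable_cnj [measurable (raw)]:
  "f \<in> borel_measurable M \<Longrightarrow> (\<lambda>x. cnj (f x)) \<in> borel_measurable M"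
  by (rule measurable_compose[of f M borel cnj]) (auto intro: borel_measurable_continuous_onI continuous_intros)

text \<open>
  The standard normal density. As a product over the coordinates, its characteristic function is
  the product of the one-dimensional ones.
\<close>
definition gauss :: "'a::euclidean_space \<Rightarrow> real" where
  "gauss x = (\<Prod>b\<in>Basis. std_normal_density (x \<bullet> b))"

lemma norm_square_eq_sum: "(norm x)\<^sup>2 = (\<Sum>b\<in>Basis. (x \<bullet> b)\<^sup>2)"
  unfolding power2_norm_eq_inner euclidean_inner[of x x] by (simp add: power2_eq_square)

lemma gauss_eq:
  fixes x :: "'a::euclidean_space"
  shows "gauss x = gauss (0::'a) * exp (- (norm x)\<^sup>2 / 2)"
proof -
  have std: "std_normal_density t = std_normal_density 0 * exp (- t\<^sup>2 / 2)" for t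
    by (simp add: std_normal_density_def)
  have "gauss x = (\<Prod>b\<in>(Basis::'a set). std_normal_density 0 * exp (- (x \<bullet> b)\<^sup>2 / 2))"
    unfolding gauss_def by (intro prod.cong refl std)
  also have "\<dots> = gauss (0::'a) * exp (\<Sum>b\<in>Basis. - (x \<bullet> b)\<^sup>2 / 2)"
    by (simp add: gauss_def prod.distrib exp_sum)
  also have "(\<Sum>b\<in>Basis. - (x \<bullet> b)\<^sup>2 / 2) = - (norm x)\<^sup>2 / 2"
    by (simp add: norm_square_eq_sum sum_negf sum_divide_distrib)
  finally show ?thesis .
qed

lemma gauss_0_pos: "0 < gauss (0::'a::euclidean_space)"
  unfolding gauss_def by (intro prod_pos) (auto simp: std_normal_density_def)

lemma measurable_gauss [measurable]: "gauss \<in> borel_measurable borel"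
  unfolding gauss_def[abs_def] by measurable

lemma gauss_nonneg [simp]: "0 \<le> gauss x"
  by (simp add: gauss_def prod_nonneg)

lemma nn_integral_gauss: "(\<integral>\<^sup>+x. ennreal (gauss (x::'a::euclidean_space)) \<partial>lborel) = 1"
proof -
  have 1: "(\<integral>\<^sup>+x. ennreal (std_normal_density x) \<partial>lborel) = 1"
    by (subst nn_integral_eq_integral) auto
  have "(\<integral>\<^sup>+x. ennreal (gauss (x::'a)) \<partial>lborel) = (\<integral>\<^sup>+x. (\<Prod>b\<in>Basis. ennreal (std_normal_density ((x::'a) \<bullet> b))) \<partial>lborel)"
    by (simp add: gauss_def prod_ennreal)
  also have "\<dots> = 1"
    by (subst nn_integral_lborel_prod) (simp_all add: 1)
  finally show ?thesis .
qed

lemma gauss_characteristic: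
  fixes s :: "'a::euclidean_space"
  shows "(LINT x|lborel. of_real (gauss x) * exp (\<i> * of_real (s \<bullet> x))) = of_real (exp (- (norm s)\<^sup>2 / 2))"
proof -
  interpret product_sigma_finite "\<lambda>b::'a. lborel :: real measure" ..
  have 1: "(LINT x|lborel. of_real (std_normal_density x) * exp (\<i> * of_real (t * x))) = (of_real (exp (- t\<^sup>2 / 2)) :: complex)" for t :: real
  proof -
    have "char std_normal_distribution t = (LINT x|lborel. std_normal_density x *\<^sub>R iexp (t * x))"
      unfolding char_def by (subst integral_density) auto
    then show ?thesis by (simp add: char_std_normal_distribution scaleR_conv_of_real)
  qed
  have int: "integrable lborel (\<lambda>x. of_real (std_normal_density x) * exp (\<i> * of_real (t * x)) :: complex)" for t :: real
    by (rule Bochner_Integration.integrable_bound[OF integrable_normal_density[where \<mu>=0 and \<sigma>=1]]) (auto simp: norm_mult)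
  define h where "h b x = (of_real (std_normal_density x) * exp (\<i> * of_real ((s \<bullet> b) * x)) :: complex)" for b x
  have "(LINT x|lborel. of_real (gauss x) * exp (\<i> * of_real (s \<bullet> x))) = (LINT x|lborel. (\<Prod>b\<in>Basis. h b ((x::'a) \<bullet> b)))"
  proof (intro Bochner_Integration.integral_cong refl)
    fix x :: 'a
    have "exp (\<i> * of_real (s \<bullet> x)) = exp (\<Sum>b\<in>Basis. \<i> * (of_real ((s \<bullet> b) * (x \<bullet> b)) :: complex))"
      unfolding euclidean_inner[of s x] by (simp add: sum_distrib_left)
    then show "of_real (gauss x) * exp (\<i> * of_real (s \<bullet> x)) = (\<Prod>b\<in>Basis. h b (x \<bullet> b))"
      unfolding h_def prod.distrib gauss_def by (simp only: exp_sum finite_Basis of_real_prod)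
  qed
  also have "\<dots> = (LINT x|(\<Pi>\<^sub>M b\<in>Basis. lborel). (\<Prod>b\<in>Basis. h b (x b)))"
  proof -
    have [measurable]: "(\<lambda>x::'a. \<Prod>b\<in>Basis. h b (x \<bullet> b)) \<in> borel_measurable borel"
      unfolding h_def by measurable
    have [measurable]: "(\<lambda>x. \<Sum>b\<in>Basis. x b *\<^sub>R b :: 'a) \<in> measurable (\<Pi>\<^sub>M b\<in>Basis. lborel) borel"
      by measurable
    have "(LINT x|lborel. (\<Prod>b\<in>Basis. h b ((x::'a) \<bullet> b)))
       = (LINT x|(\<Pi>\<^sub>M b\<in>Basis. lborel). (\<Prod>b\<in>Basis. h b ((\<Sum>c\<in>Basis. x c *\<^sub>R c :: 'a) \<bullet> b)))"
      unfolding lborel_eq[where 'a='a] by (rule integral_distr) measurable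
    also have "\<dots> = (LINT x|(\<Pi>\<^sub>M b\<in>Basis. lborel). (\<Prod>b\<in>Basis. h b (x b)))"
      by (intro Bochner_Integration.integral_cong refl prod.cong) (simp add: inner_sum_left_Basis)
    finally show ?thesis .
  qed
  also have "\<dots> = (\<Prod>b\<in>Basis. LINT x|lborel. h b x)"
    by (rule product_integral_prod) (simp_all only: h_def int finite_Basis)
  also have "\<dots> = of_real (exp (- (norm s)\<^sup>2 / 2))"
  proof -
    have "(LINT x|lborel. h b x) = of_real (exp (- (s \<bullet> b)\<^sup>2 / 2))" for b
      unfolding h_def by (rule 1)
    then have "(\<Prod>b\<in>Basis. LINT x|lborel. h b x) = of_real (exp (\<Sum>b\<in>Basis. - (s \<bullet> b)\<^sup>2 / 2))"
      by (simp add: exp_sum)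
    also have "(\<Sum>b\<in>Basis. - (s \<bullet> b)\<^sup>2 / 2) = - (norm s)\<^sup>2 / 2"
      by (simp add: norm_square_eq_sum sum_negf sum_divide_distrib)
    finally show ?thesis .
  qed
  finally show ?thesis .
qed

text \<open>
  A dilated Gaussian has a Gaussian as its Fourier transform, in the normalisation of the
  characters \<open>exp (- 2 \<pi> i x \<bullet> u)\<close>. This is the characteristic function after a change of variables.
\<close>
lemma fourier_gauss:
  fixes u :: "'a::euclidean_space"
  assumes c: "0 < c"
  shows "(LINT x|lborel. of_real (gauss (c *\<^sub>R x)) * character x u)
     = of_real (gauss ((2 * pi / c) *\<^sub>R u) / (c ^ DIM('a) * gauss (0::'a)))"
proof -
  have "(LINT x|lborel. of_real (gauss (x::'a)) * exp (\<i> * of_real ((- (2 * pi / c) *\<^sub>R u) \<bullet> x)))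
     = of_real (exp (- (norm (- (2 * pi / c) *\<^sub>R u))\<^sup>2 / 2))"
    by (rule gauss_characteristic)
  also have "exp (- (norm (- (2 * pi / c) *\<^sub>R u))\<^sup>2 / 2) = gauss ((2 * pi / c) *\<^sub>R u) / gauss (0::'a)"
  proof -
    have "exp (- (norm v)\<^sup>2 / 2) = gauss v / gauss (0::'a)" for v :: 'a
      using gauss_eq[of v] gauss_0_pos[where 'a='a] by simp
    from this[of "(2 * pi / c) *\<^sub>R u"] show ?thesis by simp
  qed
  also have "(LINT x|lborel. of_real (gauss (x::'a)) * exp (\<i> * of_real ((- (2 * pi / c) *\<^sub>R u) \<bullet> x)))
    = c ^ DIM('a) * (LINT x|lborel. of_real (gauss (c *\<^sub>R x)) * character x u)"
  proof -
    have meas: "(\<lambda>x::'a. of_real (gauss x) * exp (\<i> * of_real ((- (2 * pi / c) *\<^sub>R u) \<bullet> x)) :: complex) \<in> borel_measurable borel"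
      by measurable
    have "(LINT x|lborel. of_real (gauss (x::'a)) * exp (\<i> * of_real ((- (2 * pi / c) *\<^sub>R u) \<bullet> x)))
      = (\<bar>c\<bar> ^ DIM('a)) *\<^sub>R (LINT x|lborel. of_real (gauss (0 + c *\<^sub>R x)) * exp (\<i> * of_real ((- (2 * pi / c) *\<^sub>R u) \<bullet> (0 + c *\<^sub>R x))))"
      using c by (intro lborel_integral_affine meas) auto
    also have "\<dots> = c ^ DIM('a) * (LINT x|lborel. of_real (gauss (c *\<^sub>R x)) * character x u)"
      using c by (simp add: character_def scaleR_conv_of_real inner_commute mult_ac)
    finally show ?thesis .
  qed
  finally show ?thesis
    using c gauss_0_pos[where 'a='a] by (simp add: field_simps)
qed

lemma integral_norm_bound_nn_integral:
  fixes f :: "'a \<Rightarrow> 'b::{banach, second_countable_topology}"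
  shows "ennreal (norm (LINT x|M. f x)) \<le> (\<integral>\<^sup>+x. ennreal (norm (f x)) \<partial>M)"
  by (cases "integrable M f") (auto simp: integral_norm_bound_ennreal not_integrable_integral_eq)

text \<open>
  With a Gaussian weight, the square of the Fourier transform can be integrated by Fubini's
  theorem; the result is a double integral of \<open>H\<close> and its conjugate against a positive kernel
  \<open>K (y - z)\<close> of total mass \<open>1\<close>. Such a quadratic form is at most the \<open>L\<^sup>2\<close> norm squared, by
  \<open>2 |H y| |H z| \<le> |H y|\<^sup>2 + |H z|\<^sup>2\<close>.
\<close>
lemma Plancherel_gauss:
  fixes H :: "'a::euclidean_space \<Rightarrow> complex"
  assumes H: "integrable lborel H" and c: "0 < c"
  shows "(\<integral>\<^sup>+x. ennreal ((norm (fourier H x))\<^sup>2 * (gauss (c *\<^sub>R x) / gauss (0::'a))) \<partial>lborel)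
     \<le> (\<integral>\<^sup>+x. ennreal ((norm (H x))\<^sup>2) \<partial>lborel)"
proof -
  have Hm [measurable]: "H \<in> borel_measurable borel" using H by auto
  define w where "w x = gauss (c *\<^sub>R x) / gauss (0::'a)" for x :: 'a
  \<comment> \<open>The Fourier transform of the weight \<open>w\<close>, by \<open>fourier_gauss\<close>.\<close>
  define K where "K u = gauss ((2 * pi / c) *\<^sub>R u) / (c ^ DIM('a) * (gauss (0::'a))\<^sup>2)" for u :: 'a
  have wm [measurable]: "w \<in> borel_measurable borel" unfolding w_def by measurable
  have Km [measurable]: "K \<in> borel_measurable borel" unfolding K_def by measurable
  have g0: "0 < gauss (0::'a)" by (rule gauss_0_pos)
  have w0: "0 \<le> w x" for x using g0 by (simp add: w_def)
  have K0: "0 \<le> K u" for u using g0 c by (simp add: K_def)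
  have w_int: "integrable lborel w"
  proof -
    have "(\<integral>\<^sup>+x. ennreal (gauss (x::'a)) \<partial>lborel) = ennreal (\<bar>c\<bar> ^ DIM('a)) * (\<integral>\<^sup>+x. ennreal (gauss (0 + c *\<^sub>R (x::'a))) \<partial>lborel)"
      using c by (intro nn_integral_lborel_affine) auto
    then have "(\<integral>\<^sup>+x. ennreal (gauss (c *\<^sub>R (x::'a))) \<partial>lborel) \<noteq> top"
      using c by (auto simp: nn_integral_gauss ennreal_mult_top)
    then have "integrable lborel (\<lambda>x::'a. gauss (c *\<^sub>R x))"
      by (intro integrableI_bounded) (auto simp: top.not_eq_extremum)
    then show ?thesis unfolding w_def by simp
  qed
  have K_hat: "(LINT x|lborel. of_real (w x) * character x u) = of_real (K u)" for u
  proof -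
    have "(LINT x|lborel. of_real (w x) * character x u) = (LINT x|lborel. of_real (gauss (c *\<^sub>R x)) * character x u) / of_real (gauss (0::'a))"
      by (simp add: w_def)
    then show ?thesis
      using c g0 by (simp add: fourier_gauss K_def power2_eq_square)
  qed
  have K_int: "(\<integral>\<^sup>+u. ennreal (K u) \<partial>lborel) = 1"
  proof -
    define \<kappa> where "\<kappa> = 2 * pi / c"
    have \<kappa>: "0 < \<kappa>" using c by (simp add: \<kappa>_def)
    have g0_sq: "(gauss (0::'a))\<^sup>2 = 1 / (2 * pi) ^ DIM('a)"
    proof -
      have "gauss (0::'a) = (1 / sqrt (2 * pi)) ^ DIM('a)"
        unfolding gauss_def std_normal_density_def by (simp add: prod_constant)
      then have "(gauss (0::'a))\<^sup>2 = ((1 / sqrt (2 * pi))\<^sup>2) ^ DIM('a)"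
        by (simp only: power_mult[symmetric] mult.commute)
      also have "(1 / sqrt (2 * pi))\<^sup>2 = 1 / (2 * pi)" by (simp add: power_divide)
      finally show ?thesis by (simp only: power_one_over)
    qed
    have "(\<integral>\<^sup>+u. ennreal (gauss (u::'a)) \<partial>lborel) = ennreal (\<bar>\<kappa>\<bar> ^ DIM('a)) * (\<integral>\<^sup>+u. ennreal (gauss (0 + \<kappa> *\<^sub>R (u::'a))) \<partial>lborel)"
      using \<kappa> by (intro nn_integral_lborel_affine) auto
    then have scale: "ennreal (\<kappa> ^ DIM('a)) * (\<integral>\<^sup>+u. ennreal (gauss (\<kappa> *\<^sub>R (u::'a))) \<partial>lborel) = 1"
      using \<kappa> by (simp add: nn_integral_gauss)
    have K: "K u = \<kappa> ^ DIM('a) * gauss (\<kappa> *\<^sub>R u)" for u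
      using c by (simp add: K_def g0_sq \<kappa>_def power_divide)
    have "(\<integral>\<^sup>+u. ennreal (K u) \<partial>lborel) = (\<integral>\<^sup>+u. ennreal (\<kappa> ^ DIM('a)) * ennreal (gauss (\<kappa> *\<^sub>R (u::'a))) \<partial>lborel)"
      using \<kappa> by (simp add: K ennreal_mult)
    also have "\<dots> = ennreal (\<kappa> ^ DIM('a)) * (\<integral>\<^sup>+u. ennreal (gauss (\<kappa> *\<^sub>R (u::'a))) \<partial>lborel)"
      by (rule nn_integral_cmult) measurable
    finally show ?thesis using scale by simp
  qed
  have K_sym: "K (y - x) = K (x - y)" for x y :: 'a
    using gauss_eq[of "(2 * pi / c) *\<^sub>R (y - x)"] gauss_eq[of "(2 * pi / c) *\<^sub>R (x - y)"]
    by (simp add: K_def norm_minus_commute)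
  have H_cnj: "integrable lborel (\<lambda>x. cnj (H x))" using H by simp
  have bdd: "norm (fourier H x) \<le> (LINT x|lborel. norm (H x))" for x
    by (rule norm_fourier_le[OF H])
  have g_int: "integrable lborel (\<lambda>x. of_real (w x) * cnj (fourier H x))"
  proof (rule Bochner_Integration.integrable_bound)
    show "integrable lborel (\<lambda>x. w x * (LINT x|lborel. norm (H x)))" using w_int by simp
    show "AE x in lborel. norm (of_real (w x) * cnj (fourier H x)) \<le> norm (w x * (LINT x|lborel. norm (H x)))"
      using bdd w0 by (intro AE_I2) (auto simp: norm_mult intro!: mult_left_mono)
  qed measurable
  have g_hat: "fourier (\<lambda>x. of_real (w x) * cnj (fourier H x)) y = (LINT z|lborel. cnj (H z) * of_real (K (y - z)))" for y
  proof -
    have cnj_hat: "cnj (fourier H x) = (LINT z|lborel. cnj (character z x) * cnj (H z))" for x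
      proof -
      have "(LINT z|lborel. cnj (character z x * H z)) = cnj (LINT z|lborel. character z x * H z)"
        by (rule Bochner_Integration.integral_cnj)
      then show ?thesis unfolding fourier_eq_character_integral by (simp only: complex_cnj_mult)
    qed
    have wy: "integrable lborel (\<lambda>x. character x y * complex_of_real (w x))"
      by (rule integrable_kernel_mult) (simp_all add: w_int)
    have "fourier (\<lambda>x. of_real (w x) * cnj (fourier H x)) y
       = (LINT x|lborel. (character x y * of_real (w x)) * (LINT z|lborel. cnj (character z x) * cnj (H z)))"
      unfolding fourier_eq_character_integral[of "\<lambda>x. of_real (w x) * cnj (fourier H x)"] cnj_hat[symmetric]
      by (simp only: mult.assoc)
    also have "\<dots> = (LINT z|lborel. cnj (H z) * (LINT x|lborel. cnj (character z x) * (character x y * of_real (w x))))"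
    proof (rule Fubini_bounded_kernel[OF H_cnj wy])
      show "(\<lambda>(x, z). cnj (character z x)) \<in> borel_measurable (borel \<Otimes>\<^sub>M borel)"
        unfolding case_prod_beta character_commute[of "snd _"] by measurable
    qed simp
    also have "\<dots> = (LINT z|lborel. cnj (H z) * of_real (K (y - z)))"
    proof -
      have "cnj (character z x) * (character x y * of_real (w x)) = of_real (w x) * character x (y - z)" for x z
        by (simp add: character_commute[of x] character_diff)
      then show ?thesis by (simp only: K_hat)
    qed
    finally show ?thesis .
  qed
  have "(LINT x|lborel. fourier H x * (of_real (w x) * cnj (fourier H x)))
      = (LINT y|lborel. H y * (LINT z|lborel. cnj (H z) * of_real (K (y - z))))"
    using fourier_multiplication_formula[OF H g_int] by (simp add: g_hat)
  moreover have "fourier H x * (of_real (w x) * cnj (fourier H x)) = of_real ((norm (fourier H x))\<^sup>2 * w x)" for x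
    by (simp only: of_real_mult complex_norm_square mult_ac)
  ultimately have eq: "of_real (LINT x|lborel. (norm (fourier H x))\<^sup>2 * w x)
      = (LINT y|lborel. H y * (LINT z|lborel. cnj (H z) * of_real (K (y - z))))"
    by (simp flip: integral_complex_of_real)
  have int: "integrable lborel (\<lambda>x. (norm (fourier H x))\<^sup>2 * w x)"
  proof (rule Bochner_Integration.integrable_bound)
    show "integrable lborel (\<lambda>x. w x * (LINT x|lborel. norm (H x))\<^sup>2)" using w_int by simp
    show "AE x in lborel. norm ((norm (fourier H x))\<^sup>2 * w x) \<le> norm (w x * (LINT x|lborel. norm (H x))\<^sup>2)"
      using bdd w0 by (intro AE_I2) (auto simp: mult.commute[of "w _"] intro!: mult_right_mono power_mono)
  qed measurable
  have "(\<integral>\<^sup>+x. ennreal ((norm (fourier H x))\<^sup>2 * w x) \<partial>lborel) = ennreal (LINT x|lborel. (norm (fourier H x))\<^sup>2 * w x)"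
    using int w0 by (intro nn_integral_eq_integral) auto
  also have "\<dots> \<le> ennreal (norm (LINT y|lborel. H y * (LINT z|lborel. cnj (H z) * of_real (K (y - z)))))"
    unfolding eq[symmetric] by (simp add: ennreal_leI)
  also have "\<dots> \<le> (\<integral>\<^sup>+y. ennreal (norm (H y * (LINT z|lborel. cnj (H z) * of_real (K (y - z))))) \<partial>lborel)"
    by (rule integral_norm_bound_nn_integral)
  also have "\<dots> \<le> (\<integral>\<^sup>+y. \<integral>\<^sup>+z. ennreal (norm (H y) * norm (H z) * K (y - z)) \<partial>lborel \<partial>lborel)"
  proof (rule nn_integral_mono)
    fix y
    have "ennreal (norm (LINT z|lborel. cnj (H z) * of_real (K (y - z)))) \<le> (\<integral>\<^sup>+z. ennreal (norm (cnj (H z) * of_real (K (y - z)))) \<partial>lborel)"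
      by (rule integral_norm_bound_nn_integral)
    then have "ennreal (norm (H y)) * ennreal (norm (LINT z|lborel. cnj (H z) * of_real (K (y - z))))
       \<le> ennreal (norm (H y)) * (\<integral>\<^sup>+z. ennreal (norm (H z) * K (y - z)) \<partial>lborel)"
      using K0 by (intro mult_left_mono) (simp_all add: norm_mult)
    also have "\<dots> = (\<integral>\<^sup>+z. ennreal (norm (H y)) * ennreal (norm (H z) * K (y - z)) \<partial>lborel)"
      by (rule nn_integral_cmult[symmetric]) measurable
    finally show "ennreal (norm (H y * (LINT z|lborel. cnj (H z) * of_real (K (y - z))))) \<le> (\<integral>\<^sup>+z. ennreal (norm (H y) * norm (H z) * K (y - z)) \<partial>lborel)"
      using K0 by (simp add: norm_mult ennreal_mult' mult.assoc)
  qed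
  also have "\<dots> \<le> (\<integral>\<^sup>+y. \<integral>\<^sup>+z. ennreal ((norm (H y))\<^sup>2 / 2 * K (y - z)) + ennreal ((norm (H z))\<^sup>2 / 2 * K (y - z)) \<partial>lborel \<partial>lborel)"
  proof (intro nn_integral_mono)
    fix y z
    have "norm (H y) * norm (H z) \<le> (norm (H y))\<^sup>2 / 2 + (norm (H z))\<^sup>2 / 2"
      using sum_squares_bound[of "norm (H y)" "norm (H z)"] by simp
    then have "norm (H y) * norm (H z) * K (y - z) \<le> ((norm (H y))\<^sup>2 / 2 + (norm (H z))\<^sup>2 / 2) * K (y - z)"
      using K0 by (intro mult_right_mono) auto
    then show "ennreal (norm (H y) * norm (H z) * K (y - z)) \<le> ennreal ((norm (H y))\<^sup>2 / 2 * K (y - z)) + ennreal ((norm (H z))\<^sup>2 / 2 * K (y - z))"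
      using K0 by (simp add: distrib_right ennreal_leI flip: ennreal_plus)
  qed
  also have "\<dots> = (\<integral>\<^sup>+y. \<integral>\<^sup>+z. ennreal ((norm (H y))\<^sup>2 / 2 * K (y - z)) \<partial>lborel \<partial>lborel)
      + (\<integral>\<^sup>+y. \<integral>\<^sup>+z. ennreal ((norm (H z))\<^sup>2 / 2 * K (y - z)) \<partial>lborel \<partial>lborel)"
    by (simp add: nn_integral_add)
  also have "(\<integral>\<^sup>+y. \<integral>\<^sup>+z. ennreal ((norm (H z))\<^sup>2 / 2 * K (y - z)) \<partial>lborel \<partial>lborel)
     = (\<integral>\<^sup>+z. \<integral>\<^sup>+y. ennreal ((norm (H z))\<^sup>2 / 2 * K (z - y)) \<partial>lborel \<partial>lborel)"
    by (subst lborel_pair.Fubini') (measurable, simp add: K_sym)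
  also have "(\<integral>\<^sup>+y. \<integral>\<^sup>+z. ennreal ((norm (H y))\<^sup>2 / 2 * K (y - z)) \<partial>lborel \<partial>lborel) = (\<integral>\<^sup>+y. ennreal ((norm (H y))\<^sup>2 / 2) \<partial>lborel)"
  proof (rule nn_integral_cong)
    fix y
    have "(\<integral>\<^sup>+z. ennreal ((norm (H y))\<^sup>2 / 2 * K (y - z)) \<partial>lborel) = ennreal ((norm (H y))\<^sup>2 / 2) * (\<integral>\<^sup>+z. ennreal (K (y - z)) \<partial>lborel)"
    proof -
      have "ennreal ((norm (H y))\<^sup>2 / 2 * K (y - z)) = ennreal ((norm (H y))\<^sup>2 / 2) * ennreal (K (y - z))" for z
        using K0 by (intro ennreal_mult) auto
      then show ?thesis by (simp only:) (rule nn_integral_cmult, measurable)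
    qed
    also have "(\<integral>\<^sup>+z. ennreal (K (y - z)) \<partial>lborel) = 1"
      using nn_integral_lborel_reflect[of "\<lambda>z. ennreal (K z)" y] K_int by simp
    finally show "(\<integral>\<^sup>+z. ennreal ((norm (H y))\<^sup>2 / 2 * K (y - z)) \<partial>lborel) = ennreal ((norm (H y))\<^sup>2 / 2)" by simp
  qed
  also have "(\<integral>\<^sup>+y. ennreal ((norm (H y))\<^sup>2 / 2) \<partial>lborel) + (\<integral>\<^sup>+y. ennreal ((norm (H y))\<^sup>2 / 2) \<partial>lborel) = (\<integral>\<^sup>+y. ennreal ((norm (H y))\<^sup>2) \<partial>lborel)"
    by (subst nn_integral_add[symmetric]) (auto simp flip: ennreal_plus)
  finally show ?thesis by (simp add: w_def)
qed

text \<open>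
  The Gaussian weights increase to \<open>1\<close>, and the weighted bound does not depend on the weight.
\<close>
theorem Plancherel_le:
  fixes H :: "'a::euclidean_space \<Rightarrow> complex"
  assumes H: "integrable lborel H"
  shows "(\<integral>\<^sup>+x. ennreal ((norm (fourier H x))\<^sup>2) \<partial>lborel) \<le> (\<integral>\<^sup>+x. ennreal ((norm (H x))\<^sup>2) \<partial>lborel)"
proof -
  have [measurable]: "H \<in> borel_measurable borel" using H by auto
  define w where "w n x = gauss ((1 / real (Suc n)) *\<^sub>R x) / gauss (0::'a)" for n and x :: 'a
  have w: "w n x = exp (- ((norm x / real (Suc n))\<^sup>2 / 2))" for n x
    using gauss_eq[of "(1 / real (Suc n)) *\<^sub>R x"] gauss_0_pos[where 'a='a] by (simp add: w_def)
  have [measurable]: "w n \<in> borel_measurable borel" for n unfolding w_def by measurable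
  have "(SUP n. ennreal ((norm (fourier H x))\<^sup>2 * w n x)) = ennreal ((norm (fourier H x))\<^sup>2)" for x
  proof (rule LIMSEQ_unique)
    have "incseq (\<lambda>n. w n x)"
      unfolding w incseq_def by (auto intro!: power_mono divide_left_mono)
    then have "incseq (\<lambda>n. ennreal ((norm (fourier H x))\<^sup>2 * w n x))"
      by (auto simp: incseq_def intro!: ennreal_leI mult_left_mono)
    then show "(\<lambda>n. ennreal ((norm (fourier H x))\<^sup>2 * w n x)) \<longlonglongrightarrow> (SUP n. ennreal ((norm (fourier H x))\<^sup>2 * w n x))"
      by (rule LIMSEQ_SUP)
    have "(\<lambda>n. norm x / real (Suc n)) \<longlonglongrightarrow> 0"
      by (intro LIMSEQ_Suc lim_const_over_n)
    then have "(\<lambda>n. w n x) \<longlonglongrightarrow> exp (- (0\<^sup>2 / 2))"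
      unfolding w by (intro tendsto_intros) auto
    then have "(\<lambda>n. (norm (fourier H x))\<^sup>2 * w n x) \<longlonglongrightarrow> (norm (fourier H x))\<^sup>2 * exp (- (0\<^sup>2 / 2))"
      by (intro tendsto_intros)
    then show "(\<lambda>n. ennreal ((norm (fourier H x))\<^sup>2 * w n x)) \<longlonglongrightarrow> ennreal ((norm (fourier H x))\<^sup>2)"
      by (intro tendsto_ennrealI) simp
  qed
  then have "(\<integral>\<^sup>+x. ennreal ((norm (fourier H x))\<^sup>2) \<partial>lborel) = (\<integral>\<^sup>+x. (SUP n. ennreal ((norm (fourier H x))\<^sup>2 * w n x)) \<partial>lborel)"
    by simp
  also have "\<dots> = (SUP n. \<integral>\<^sup>+x. ennreal ((norm (fourier H x))\<^sup>2 * w n x) \<partial>lborel)"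
  proof (rule nn_integral_monotone_convergence_SUP)
    show "incseq (\<lambda>n x. ennreal ((norm (fourier H x))\<^sup>2 * w n x))"
      unfolding incseq_def le_fun_def w
      by (auto intro!: ennreal_leI mult_left_mono power_mono divide_left_mono)
  qed measurable
  also have "\<dots> \<le> (\<integral>\<^sup>+x. ennreal ((norm (H x))\<^sup>2) \<partial>lborel)"
    unfolding w_def by (intro SUP_least Plancherel_gauss[OF H]) simp
  finally show ?thesis .
qed

lemma nn_integral_convolution:
  fixes f g :: "'a::euclidean_space \<Rightarrow> ennreal"
  assumes [measurable]: "f \<in> borel_measurable borel" "g \<in> borel_measurable borel"
  shows "(\<integral>\<^sup>+u. (\<integral>\<^sup>+x. f x * g (u - x) \<partial>lborel) \<partial>lborel) = (\<integral>\<^sup>+x. f x \<partial>lborel) * (\<integral>\<^sup>+x. g x \<partial>lborel)"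
proof -
  have "(\<integral>\<^sup>+u. (\<integral>\<^sup>+x. f x * g (u - x) \<partial>lborel) \<partial>lborel) = (\<integral>\<^sup>+x. (\<integral>\<^sup>+u. f x * g (u - x) \<partial>lborel) \<partial>lborel)"
    by (rule lborel_pair.Fubini') measurable
  also have "\<dots> = (\<integral>\<^sup>+x. f x * (\<integral>\<^sup>+u. g u \<partial>lborel) \<partial>lborel)"
  proof (rule nn_integral_cong)
    fix x
    have "(\<integral>\<^sup>+u. f x * g (u - x) \<partial>lborel) = f x * (\<integral>\<^sup>+u. g (u - x) \<partial>lborel)"
      by (rule nn_integral_cmult) measurable
    also have "(\<integral>\<^sup>+u. g (u - x) \<partial>lborel) = (\<integral>\<^sup>+u. g u \<partial>lborel)"
      using nn_integral_lborel_translate[of g "- x"] by simp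
    finally show "(\<integral>\<^sup>+u. f x * g (u - x) \<partial>lborel) = f x * (\<integral>\<^sup>+u. g u \<partial>lborel)" .
  qed
  also have "\<dots> = (\<integral>\<^sup>+x. f x \<partial>lborel) * (\<integral>\<^sup>+x. g x \<partial>lborel)"
    by (rule nn_integral_multc) measurable
  finally show ?thesis .
qed

lemma fourier_convolution:
  fixes f g :: "'a::euclidean_space \<Rightarrow> complex"
  assumes f: "integrable lborel f" and g: "integrable lborel g"
  defines "h \<equiv> \<lambda>u. LINT x|lborel. f x * g (u - x)"
  shows "integrable lborel h" "fourier h \<xi> = fourier f \<xi> * fourier g \<xi>"
proof -
  have [measurable]: "f \<in> borel_measurable borel" "g \<in> borel_measurable borel" using f g by auto
  have meas: "(\<lambda>p. f (snd p) * g (fst p - snd p)) \<in> borel_measurable (lborel \<Otimes>\<^sub>M lborel)"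
    by measurable
  have int: "integrable (lborel \<Otimes>\<^sub>M lborel) (\<lambda>p. f (snd p) * g (fst p - snd p))"
  proof (rule integrableI_bounded[OF meas])
    have "(\<integral>\<^sup>+p. ennreal (norm (f (snd p) * g (fst p - snd p))) \<partial>(lborel \<Otimes>\<^sub>M lborel))
      = (\<integral>\<^sup>+u. (\<integral>\<^sup>+x. ennreal (norm (f x)) * ennreal (norm (g (u - x))) \<partial>lborel) \<partial>lborel)"
    proof -
      have "(\<lambda>p. ennreal (norm (f (snd p) * g (fst p - snd p)))) \<in> borel_measurable (lborel \<Otimes>\<^sub>M lborel)"
        using meas by measurable
      from lborel.nn_integral_fst[OF this] show ?thesis
        by (simp add: norm_mult ennreal_mult)
    qed
    also have "\<dots> = (\<integral>\<^sup>+x. ennreal (norm (f x)) \<partial>lborel) * (\<integral>\<^sup>+x. ennreal (norm (g x)) \<partial>lborel)"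
      by (rule nn_integral_convolution) measurable
    also have "\<dots> < \<infinity>"
      using f g by (simp add: integrable_iff_bounded ennreal_mult_less_top)
    finally show "(\<integral>\<^sup>+p. ennreal (norm (f (snd p) * g (fst p - snd p))) \<partial>(lborel \<Otimes>\<^sub>M lborel)) < \<infinity>" .
  qed
  show "integrable lborel h"
    unfolding h_def using lborel_pair.integrable_fst'[OF int] by simp
  have intE: "integrable (lborel \<Otimes>\<^sub>M lborel) (\<lambda>p. character (fst p) \<xi> * (f (snd p) * g (fst p - snd p)))"
  proof (rule Bochner_Integration.integrable_bound[OF int])
    show "(\<lambda>p. character (fst p) \<xi> * (f (snd p) * g (fst p - snd p))) \<in> borel_measurable (lborel \<Otimes>\<^sub>M lborel)"
      by measurable
  qed (simp add: norm_mult)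
  have "fourier h \<xi> = (LINT u|lborel. LINT x|lborel. character u \<xi> * (f x * g (u - x)))"
    unfolding fourier_eq_character_integral h_def by simp
  also have "\<dots> = (LINT x|lborel. LINT u|lborel. character u \<xi> * (f x * g (u - x)))"
    using intE by (intro lborel_pair.Fubini_integral[symmetric]) (simp add: split_beta')
  also have "\<dots> = (LINT x|lborel. (character x \<xi> * f x) * fourier g \<xi>)"
  proof (intro Bochner_Integration.integral_cong refl)
    fix x
    have "(LINT u|lborel. character u \<xi> * (f x * g (u - x))) = (LINT u|lborel. character (x + 1 *\<^sub>R u) \<xi> * (f x * g (x + 1 *\<^sub>R u - x)))"
      by (subst lborel_integral_affine[of _ 1 x]) simp_all
    also have "\<dots> = (LINT u|lborel. (character x \<xi> * f x) * (character u \<xi> * g u))"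
      by (simp add: character_add mult_ac)
    also have "\<dots> = (character x \<xi> * f x) * fourier g \<xi>"
      unfolding fourier_eq_character_integral by (rule integral_mult_right_zero)
    finally show "(LINT u|lborel. character u \<xi> * (f x * g (u - x))) = (character x \<xi> * f x) * fourier g \<xi>" .
  qed
  also have "\<dots> = fourier f \<xi> * fourier g \<xi>"
    unfolding fourier_eq_character_integral[of f] by (rule integral_mult_left_zero)
  finally show "fourier h \<xi> = fourier f \<xi> * fourier g \<xi>" .
qed

text \<open>
  The square of the Fourier transform is the Fourier transform of \<open>G * G\<close>. Plancherel's inequality
  then leaves a bound in which only the absolute value of \<open>G\<close> occurs.
\<close>
lemma fourier_L4_bound:
  fixes G :: "'a::euclidean_space \<Rightarrow> complex"
  assumes G: "integrable lborel G"
  shows "(\<integral>\<^sup>+\<xi>. ennreal ((norm (fourier G \<xi>)) ^ 4) \<partial>lborel)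
     \<le> (\<integral>\<^sup>+u. (\<integral>\<^sup>+x. ennreal (norm (G x)) * ennreal (norm (G (u - x))) \<partial>lborel)\<^sup>2 \<partial>lborel)"
proof -
  define h where "h u = (LINT x|lborel. G x * G (u - x))" for u
  have h: "integrable lborel h" "\<And>\<xi>. fourier h \<xi> = fourier G \<xi> * fourier G \<xi>"
    unfolding h_def[abs_def] by (rule fourier_convolution[OF G G])+
  have "(\<integral>\<^sup>+\<xi>. ennreal ((norm (fourier G \<xi>)) ^ 4) \<partial>lborel) = (\<integral>\<^sup>+\<xi>. ennreal ((norm (fourier h \<xi>))\<^sup>2) \<partial>lborel)"
    by (simp add: h norm_mult power4_eq_xxxx power2_eq_square mult_ac)
  also have "\<dots> \<le> (\<integral>\<^sup>+u. ennreal ((norm (h u))\<^sup>2) \<partial>lborel)"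
    by (rule Plancherel_le[OF h(1)])
  also have "\<dots> \<le> (\<integral>\<^sup>+u. (\<integral>\<^sup>+x. ennreal (norm (G x)) * ennreal (norm (G (u - x))) \<partial>lborel)\<^sup>2 \<partial>lborel)"
  proof (rule nn_integral_mono)
    fix u
    have "ennreal (norm (h u)) \<le> (\<integral>\<^sup>+x. ennreal (norm (G x)) * ennreal (norm (G (u - x))) \<partial>lborel)"
      unfolding h_def using integral_norm_bound_nn_integral[of lborel "\<lambda>x. G x * G (u - x)"]
      by (simp add: norm_mult ennreal_mult)
    then have "(ennreal (norm (h u)))\<^sup>2 \<le> (\<integral>\<^sup>+x. ennreal (norm (G x)) * ennreal (norm (G (u - x))) \<partial>lborel)\<^sup>2"
      by (intro power_mono) auto
    then show "ennreal ((norm (h u))\<^sup>2) \<le> (\<integral>\<^sup>+x. ennreal (norm (G x)) * ennreal (norm (G (u - x))) \<partial>lborel)\<^sup>2"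
      by (simp add: ennreal_power)
  qed
  finally show ?thesis .
qed

section \<open>The endpoint estimate on thin shells\<close>

lemma HL_max_le_bound:
  fixes f :: "'a::euclidean_space \<Rightarrow> 'b::real_normed_vector"
  assumes "\<And>y. norm (f y) \<le> B"
  shows "HL_max f x \<le> ennreal B"
  unfolding HL_max_def
proof (rule SUP_least)
  fix \<rho> :: real assume "\<rho> \<in> {0<..}"
  then have \<rho>: "0 < \<rho>" by simp
  have "(\<integral>\<^sup>+y\<in>ball x \<rho>. ennreal (norm (f y)) \<partial>lborel) \<le> (\<integral>\<^sup>+y. ennreal B * indicator (ball x \<rho>) y \<partial>lborel)"
    using assms by (intro nn_integral_mono mult_right_mono ennreal_leI) auto
  also have "\<dots> = ennreal B * emeasure lborel (ball x \<rho>)"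
    by (rule nn_integral_cmult_indicator) simp
  finally show "(\<integral>\<^sup>+y\<in>ball x \<rho>. ennreal (norm (f y)) \<partial>lborel) / emeasure lborel (ball x \<rho>) \<le> ennreal B"
    using emeasure_lborel_ball_pos[OF \<rho>, of x]
    by (intro divide_le_posI_ennreal) (auto simp: zero_less_iff_neq_zero mult.commute)
qed

text \<open>
  For a fixed point \<open>\<xi>'\<close> of the smaller ball, the translate by \<open>\<xi>'\<close> of the larger one lies in the
  ball of twice its radius about \<open>x + x'\<close>.
\<close>
lemma ball_sum_average_le_HL_max_aux:
  fixes H :: "'a::euclidean_space \<Rightarrow> real"
  assumes [measurable]: "H \<in> borel_measurable borel" and H: "\<And>x. 0 \<le> H x" and \<rho>: "0 < \<rho>'" "\<rho>' \<le> \<rho>"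
  shows "(\<integral>\<^sup>+\<xi>'\<in>ball x' \<rho>'. (\<integral>\<^sup>+\<xi>\<in>ball x \<rho>. ennreal (H (\<xi> + \<xi>')) \<partial>lborel) \<partial>lborel)
     \<le> 2 ^ DIM('a) * HL_max H (x + x') * emeasure lborel (ball x \<rho>) * emeasure lborel (ball x' \<rho>')"
proof -
  have [measurable]: "ball z s \<in> sets borel" for z :: 'a and s by simp
  have "(\<integral>\<^sup>+\<xi>'\<in>ball x' \<rho>'. (\<integral>\<^sup>+\<xi>\<in>ball x \<rho>. ennreal (H (\<xi> + \<xi>')) \<partial>lborel) \<partial>lborel)
     \<le> (\<integral>\<^sup>+\<xi>'. (2 ^ DIM('a) * HL_max H (x + x') * emeasure lborel (ball x \<rho>)) * indicator (ball x' \<rho>') \<xi>' \<partial>lborel)"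
  proof (rule nn_integral_mono)
    fix \<xi>' :: 'a
    show "(\<integral>\<^sup>+\<xi>\<in>ball x \<rho>. ennreal (H (\<xi> + \<xi>')) \<partial>lborel) * indicator (ball x' \<rho>') \<xi>'
      \<le> (2 ^ DIM('a) * HL_max H (x + x') * emeasure lborel (ball x \<rho>)) * indicator (ball x' \<rho>') \<xi>'"
    proof (cases "\<xi>' \<in> ball x' \<rho>'")
      case True
      have "(\<integral>\<^sup>+\<xi>\<in>ball x \<rho>. ennreal (H (\<xi> + \<xi>')) \<partial>lborel) = (\<integral>\<^sup>+\<xi>. ennreal (H (\<xi>' + \<xi>)) * indicator (ball x \<rho>) ((\<xi>' + \<xi>) - \<xi>') \<partial>lborel)"
        by (simp add: add.commute)
      also have "\<dots> = (\<integral>\<^sup>+z. ennreal (H z) * indicator (ball x \<rho>) (z - \<xi>') \<partial>lborel)"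
        by (rule nn_integral_lborel_translate) measurable
      also have "\<dots> \<le> (\<integral>\<^sup>+z\<in>ball (x + x') (2 * \<rho>). ennreal (norm (H z)) \<partial>lborel)"
      proof (rule nn_integral_mono)
        fix z
        have "z \<in> ball (x + x') (2 * \<rho>)" if "z - \<xi>' \<in> ball x \<rho>"
        proof -
          have "dist (x + x') z \<le> dist (x + x') (x + \<xi>') + dist (x + \<xi>') z" by (rule dist_triangle)
          also have "\<dots> = dist x' \<xi>' + dist x (z - \<xi>')" by (simp add: dist_norm algebra_simps)
          finally show ?thesis using True that \<rho> by simp
        qed
        then show "ennreal (H z) * indicator (ball x \<rho>) (z - \<xi>') \<le> ennreal (norm (H z)) * indicator (ball (x + x') (2 * \<rho>)) z"
          using H[of z] by (auto simp: indicator_def)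
      qed
      also have "\<dots> \<le> HL_max H (x + x') * emeasure lborel (ball (x + x') (2 * \<rho>))"
        using \<rho> by (intro HL_max_ge) auto
      also have "emeasure lborel (ball (x + x') (2 * \<rho>)) = ennreal (2 ^ DIM('a)) * emeasure lborel (ball x \<rho>)"
        using \<rho> by (intro emeasure_lborel_ball_scale) auto
      finally show ?thesis using True by (simp add: mult_ac flip: ennreal_power)
    qed simp
  qed
  also have "\<dots> = 2 ^ DIM('a) * HL_max H (x + x') * emeasure lborel (ball x \<rho>) * emeasure lborel (ball x' \<rho>')"
    by (rule nn_integral_cmult_indicator) simp
  finally show ?thesis .
qed

lemma ball_sum_average_le_HL_max:
  fixes H :: "'a::euclidean_space \<Rightarrow> real"
  assumes [measurable]: "H \<in> borel_measurable borel" and H: "\<And>x. 0 \<le> H x" and \<rho>: "0 < \<rho>" "0 < \<rho>'"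
  shows "(\<integral>\<^sup>+\<xi>\<in>ball x \<rho>. (\<integral>\<^sup>+\<xi>'\<in>ball x' \<rho>'. ennreal (H (\<xi> + \<xi>')) \<partial>lborel) \<partial>lborel)
     \<le> 2 ^ DIM('a) * HL_max H (x + x') * emeasure lborel (ball x \<rho>) * emeasure lborel (ball x' \<rho>')"
proof (cases "\<rho> \<le> \<rho>'")
  case True
  then show ?thesis
    using ball_sum_average_le_HL_max_aux[OF assms(1,2) \<rho>(1) True, where x = x' and x' = x]
    by (simp add: add.commute mult_ac)
next
  case False
  have [measurable]: "ball z s \<in> sets borel" for z :: 'a and s by simp
  have "(\<integral>\<^sup>+\<xi>\<in>ball x \<rho>. (\<integral>\<^sup>+\<xi>'\<in>ball x' \<rho>'. ennreal (H (\<xi> + \<xi>')) \<partial>lborel) \<partial>lborel)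
     = (\<integral>\<^sup>+\<xi>. (\<integral>\<^sup>+\<xi>'. ennreal (H (\<xi> + \<xi>')) * indicator (ball x' \<rho>') \<xi>' * indicator (ball x \<rho>) \<xi> \<partial>lborel) \<partial>lborel)"
    by (simp add: nn_integral_multc)
  also have "\<dots> = (\<integral>\<^sup>+\<xi>'. (\<integral>\<^sup>+\<xi>. ennreal (H (\<xi> + \<xi>')) * indicator (ball x' \<rho>') \<xi>' * indicator (ball x \<rho>) \<xi> \<partial>lborel) \<partial>lborel)"
    by (rule lborel_pair.Fubini') measurable
  also have "\<dots> = (\<integral>\<^sup>+\<xi>'\<in>ball x' \<rho>'. (\<integral>\<^sup>+\<xi>\<in>ball x \<rho>. ennreal (H (\<xi> + \<xi>')) \<partial>lborel) \<partial>lborel)"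
  proof (rule nn_integral_cong)
    fix \<xi>' :: 'a
    have "(\<integral>\<^sup>+\<xi>. ennreal (H (\<xi> + \<xi>')) * indicator (ball x' \<rho>') \<xi>' * indicator (ball x \<rho>) \<xi> \<partial>lborel)
       = (\<integral>\<^sup>+\<xi>. (ennreal (H (\<xi> + \<xi>')) * indicator (ball x \<rho>) \<xi>) * indicator (ball x' \<rho>') \<xi>' \<partial>lborel)"
      by (simp only: mult_ac)
    also have "\<dots> = (\<integral>\<^sup>+\<xi>\<in>ball x \<rho>. ennreal (H (\<xi> + \<xi>')) \<partial>lborel) * indicator (ball x' \<rho>') \<xi>'"
      by (rule nn_integral_multc) measurable
    finally show "(\<integral>\<^sup>+\<xi>. ennreal (H (\<xi> + \<xi>')) * indicator (ball x' \<rho>') \<xi>' * indicator (ball x \<rho>) \<xi> \<partial>lborel)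
       = (\<integral>\<^sup>+\<xi>\<in>ball x \<rho>. ennreal (H (\<xi> + \<xi>')) \<partial>lborel) * indicator (ball x' \<rho>') \<xi>'" .
  qed
  also have "\<dots> \<le> 2 ^ DIM('a) * HL_max H (x + x') * emeasure lborel (ball x \<rho>) * emeasure lborel (ball x' \<rho>')"
    using False \<rho> by (intro ball_sum_average_le_HL_max_aux assms) auto
  finally show ?thesis .
qed

lemma Holder_nn_integral_pair:
  fixes f g :: "'a::euclidean_space \<Rightarrow> 'b::euclidean_space \<Rightarrow> real"
  assumes meas: "(\<lambda>p. f (fst p) (snd p)) \<in> borel_measurable (borel \<Otimes>\<^sub>M borel)"
      "(\<lambda>p. g (fst p) (snd p)) \<in> borel_measurable (borel \<Otimes>\<^sub>M borel)"
    and nn: "\<And>x y. 0 \<le> f x y" "\<And>x y. 0 \<le> g x y"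
    and pq: "1 < p" "1 < q" "1 / p + 1 / q = 1"
    and A: "(\<integral>\<^sup>+x. \<integral>\<^sup>+y. ennreal (f x y powr p) \<partial>lborel \<partial>lborel) \<le> ennreal A" "0 \<le> A"
    and B: "(\<integral>\<^sup>+x. \<integral>\<^sup>+y. ennreal (g x y powr q) \<partial>lborel \<partial>lborel) \<le> ennreal B" "0 \<le> B"
  shows "(\<integral>\<^sup>+x. \<integral>\<^sup>+y. ennreal (f x y * g x y) \<partial>lborel \<partial>lborel) \<le> ennreal (A powr (1/p) * B powr (1/q))"
proof -
  note [measurable] = meas
  have fst: "(\<integral>\<^sup>+x. \<integral>\<^sup>+y. F x y \<partial>lborel \<partial>lborel) = (\<integral>\<^sup>+z. F (fst z) (snd z) \<partial>(lborel \<Otimes>\<^sub>M lborel))"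
    if "(\<lambda>z. F (fst z) (snd z)) \<in> borel_measurable (borel \<Otimes>\<^sub>M borel)" for F :: "'a \<Rightarrow> 'b \<Rightarrow> ennreal"
  proof -
    have "(\<lambda>z. F (fst z) (snd z)) \<in> borel_measurable (lborel \<Otimes>\<^sub>M lborel)" using that by measurable
    from lborel.nn_integral_fst[OF this] show ?thesis by simp
  qed
  have "(\<integral>\<^sup>+z. ennreal (f (fst z) (snd z) * g (fst z) (snd z)) \<partial>(lborel \<Otimes>\<^sub>M lborel)) \<le> ennreal (A powr (1/p) * B powr (1/q))"
  proof (rule Holder_nn_integral[OF _ _ _ _ pq])
    show "(\<integral>\<^sup>+z. ennreal (f (fst z) (snd z) powr p) \<partial>(lborel \<Otimes>\<^sub>M lborel)) \<le> ennreal A"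
      using A(1) by (subst (asm) fst) auto
    show "(\<integral>\<^sup>+z. ennreal (g (fst z) (snd z) powr q) \<partial>(lborel \<Otimes>\<^sub>M lborel)) \<le> ennreal B"
      using B(1) by (subst (asm) fst) auto
  qed (use nn A B in \<open>auto\<close>)
  then show ?thesis by (subst fst) auto
qed

text \<open>
  The decisive use of Hoelder's inequality, on the product of the two balls with exponents
  \<open>r / (r - 1)\<close> and \<open>r\<close>. It replaces two bumps of unknown radii by an \<open>L\<^sup>r\<close> average of \<open>w\<close> over
  sums of points, which a maximal function at \<open>x + x'\<close> dominates.
\<close>
lemma trilinear_ball_average:
  fixes h w :: "'a::euclidean_space \<Rightarrow> real"
  assumes [measurable]: "h \<in> borel_measurable borel" "w \<in> borel_measurable borel"
    and nn: "\<And>x. 0 \<le> h x" "\<And>x. 0 \<le> w x" and r: "1 < r"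
    and a: "(\<integral>\<^sup>+\<xi>\<in>ball x \<rho>. ennreal (h \<xi> powr r) \<partial>lborel) \<le> ennreal (a * v)" "0 \<le> a" "0 < v"
    and a': "(\<integral>\<^sup>+\<xi>\<in>ball x' \<rho>'. ennreal (h \<xi> powr r) \<partial>lborel) \<le> ennreal (a' * v')" "0 \<le> a'" "0 < v'"
    and b: "(\<integral>\<^sup>+\<xi>\<in>ball x \<rho>. (\<integral>\<^sup>+\<xi>'\<in>ball x' \<rho>'. ennreal (w (\<xi> + \<xi>') powr r) \<partial>lborel) \<partial>lborel) \<le> ennreal (b * v * v')" "0 \<le> b"
  shows "(\<integral>\<^sup>+\<xi>\<in>ball x \<rho>. ennreal (h \<xi> powr (r - 1)) * (\<integral>\<^sup>+\<xi>'\<in>ball x' \<rho>'. ennreal (h \<xi>' powr (r - 1)) * ennreal (w (\<xi> + \<xi>')) \<partial>lborel) \<partial>lborel)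
     \<le> ennreal (v * v' * (a * a') powr (1 - 1 / r) * b powr (1 / r))"
proof -
  have [measurable]: "ball z s \<in> sets borel" for z :: 'a and s by simp
  define f1 where "f1 \<xi> \<xi>' = indicat_real (ball x \<rho>) \<xi> * indicat_real (ball x' \<rho>') \<xi>' * (h \<xi> * h \<xi>') powr (r - 1)" for \<xi> \<xi>'
  define g1 where "g1 \<xi> \<xi>' = indicat_real (ball x \<rho>) \<xi> * indicat_real (ball x' \<rho>') \<xi>' * w (\<xi> + \<xi>')" for \<xi> \<xi>'
  define p where "p = r / (r - 1)"
  have p: "1 < p" "1 / p + 1 / r = 1" "(r - 1) * p = r" "1 / p = 1 - 1 / r"
    using r by (auto simp: p_def field_simps)
  have f1p: "(\<integral>\<^sup>+\<xi>. \<integral>\<^sup>+\<xi>'. ennreal (f1 \<xi> \<xi>' powr p) \<partial>lborel \<partial>lborel) \<le> ennreal ((a * v) * (a' * v'))"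
  proof -
    have "(\<integral>\<^sup>+\<xi>. \<integral>\<^sup>+\<xi>'. ennreal (f1 \<xi> \<xi>' powr p) \<partial>lborel \<partial>lborel)
      = (\<integral>\<^sup>+\<xi>. \<integral>\<^sup>+\<xi>'. (ennreal (h \<xi> powr r) * indicator (ball x \<rho>) \<xi>) * (ennreal (h \<xi>' powr r) * indicator (ball x' \<rho>') \<xi>') \<partial>lborel \<partial>lborel)"
      using p(3) nn by (intro nn_integral_cong) (auto simp: f1_def indicator_def powr_mult powr_powr ennreal_mult)
    also have "\<dots> = (\<integral>\<^sup>+\<xi>. (ennreal (h \<xi> powr r) * indicator (ball x \<rho>) \<xi>) * (\<integral>\<^sup>+\<xi>'\<in>ball x' \<rho>'. ennreal (h \<xi>' powr r) \<partial>lborel) \<partial>lborel)"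
      by (intro nn_integral_cong nn_integral_cmult) measurable
    also have "\<dots> = (\<integral>\<^sup>+\<xi>\<in>ball x \<rho>. ennreal (h \<xi> powr r) \<partial>lborel) * (\<integral>\<^sup>+\<xi>'\<in>ball x' \<rho>'. ennreal (h \<xi>' powr r) \<partial>lborel)"
      by (rule nn_integral_multc) measurable
    also have "\<dots> \<le> ennreal (a * v) * ennreal (a' * v')"
      by (intro mult_mono a a') auto
    finally show ?thesis using a a' by (simp add: ennreal_mult)
  qed
  have g1p: "(\<integral>\<^sup>+\<xi>. \<integral>\<^sup>+\<xi>'. ennreal (g1 \<xi> \<xi>' powr r) \<partial>lborel \<partial>lborel) \<le> ennreal (b * v * v')"
  proof -
    have "(\<integral>\<^sup>+\<xi>. \<integral>\<^sup>+\<xi>'. ennreal (g1 \<xi> \<xi>' powr r) \<partial>lborel \<partial>lborel)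
      = (\<integral>\<^sup>+\<xi>. \<integral>\<^sup>+\<xi>'. (ennreal (w (\<xi> + \<xi>') powr r) * indicator (ball x' \<rho>') \<xi>') * indicator (ball x \<rho>) \<xi> \<partial>lborel \<partial>lborel)"
      by (intro nn_integral_cong) (auto simp: g1_def indicator_def)
    also have "\<dots> = (\<integral>\<^sup>+\<xi>\<in>ball x \<rho>. (\<integral>\<^sup>+\<xi>'\<in>ball x' \<rho>'. ennreal (w (\<xi> + \<xi>') powr r) \<partial>lborel) \<partial>lborel)"
      by (intro nn_integral_cong nn_integral_multc) measurable
    finally show ?thesis using b by simp
  qed
  have "(\<integral>\<^sup>+\<xi>\<in>ball x \<rho>. ennreal (h \<xi> powr (r - 1)) * (\<integral>\<^sup>+\<xi>'\<in>ball x' \<rho>'. ennreal (h \<xi>' powr (r - 1)) * ennreal (w (\<xi> + \<xi>')) \<partial>lborel) \<partial>lborel)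
    = (\<integral>\<^sup>+\<xi>. \<integral>\<^sup>+\<xi>'. ennreal (f1 \<xi> \<xi>' * g1 \<xi> \<xi>') \<partial>lborel \<partial>lborel)"
  proof (rule nn_integral_cong)
    fix \<xi> :: 'a
    have "(\<integral>\<^sup>+\<xi>'. ennreal (f1 \<xi> \<xi>' * g1 \<xi> \<xi>') \<partial>lborel)
      = (\<integral>\<^sup>+\<xi>'. (ennreal (h \<xi> powr (r - 1)) * indicator (ball x \<rho>) \<xi>) * (ennreal (h \<xi>' powr (r - 1)) * ennreal (w (\<xi> + \<xi>')) * indicator (ball x' \<rho>') \<xi>') \<partial>lborel)"
      using nn by (intro nn_integral_cong) (auto simp: f1_def g1_def indicator_def powr_mult ennreal_mult mult.assoc)
    also have "\<dots> = (ennreal (h \<xi> powr (r - 1)) * indicator (ball x \<rho>) \<xi>) * (\<integral>\<^sup>+\<xi>'\<in>ball x' \<rho>'. ennreal (h \<xi>' powr (r - 1)) * ennreal (w (\<xi> + \<xi>')) \<partial>lborel)"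
      by (rule nn_integral_cmult) measurable
    finally show "ennreal (h \<xi> powr (r - 1)) * (\<integral>\<^sup>+\<xi>'\<in>ball x' \<rho>'. ennreal (h \<xi>' powr (r - 1)) * ennreal (w (\<xi> + \<xi>')) \<partial>lborel) * indicator (ball x \<rho>) \<xi> = (\<integral>\<^sup>+\<xi>'. ennreal (f1 \<xi> \<xi>' * g1 \<xi> \<xi>') \<partial>lborel)"
      by (simp only: mult_ac)
  qed
  also have "\<dots> \<le> ennreal (((a * v) * (a' * v')) powr (1 / p) * (b * v * v') powr (1 / r))"
  proof (rule Holder_nn_integral_pair[OF _ _ _ _ p(1) r p(2) f1p _ g1p])
    show "(\<lambda>z. f1 (fst z) (snd z)) \<in> borel_measurable (borel \<Otimes>\<^sub>M borel)"
      "(\<lambda>z. g1 (fst z) (snd z)) \<in> borel_measurable (borel \<Otimes>\<^sub>M borel)"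
      unfolding f1_def g1_def by measurable
  qed (use a a' b nn in \<open>auto simp: f1_def g1_def\<close>)
  also have "((a * v) * (a' * v')) powr (1 / p) * (b * v * v') powr (1 / r) = v * v' * (a * a') powr (1 - 1 / r) * b powr (1 / r)"
  proof -
    have "((a * v) * (a' * v')) powr (1 / p) * (b * v * v') powr (1 / r)
      = (a * a') powr (1 / p) * b powr (1 / r) * ((v * v') powr (1 / p) * (v * v') powr (1 / r))"
      using a a' b by (simp add: powr_mult mult_ac)
    also have "(v * v') powr (1 / p) * (v * v') powr (1 / r) = v * v'"
      using p(2) a a' by (simp flip: powr_add)
    finally show ?thesis by (simp add: p(4) mult_ac)
  qed
  finally show ?thesis .
qed

text \<open>
  The product of the constants from doubling the radius (\<open>8\<close>), from \<open>shell_convolution_bound\<close>, and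
  from \<open>HL_max_strong_type\<close> with exponent \<open>2 / r\<close> in dimension \<open>3\<close>.
\<close>
definition shell_const :: "real \<Rightarrow> real" where
  "shell_const r = 8 powr (2 / r) * (9 * pi) * (2 powr (2 / r) * 5 ^ 3 * (2 / r) / (2 / r - 1))"

lemma shell_const_nonneg:
  assumes "0 < r" "r < 2"
  shows "0 \<le> shell_const r"
  unfolding shell_const_def using assms
  by (intro mult_nonneg_nonneg divide_nonneg_nonneg) (simp_all add: field_simps)

text \<open>
  The Cauchy--Schwarz inequality on pairs of points of the shell separates the weights \<open>m\<close> from the
  maximal function at \<open>x + x'\<close>. The former integrate to \<open>S\<^sup>2\<close>; for the latter the density bound for
  sums of shell points leads to the full space, where the Hardy--Littlewood theorem with exponent
  \<open>2 / r > 1\<close> returns to \<open>w\<close>.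
\<close>
lemma shell_bilinear_bound:
  fixes w m :: "real^3 \<Rightarrow> real" and X :: "(real^3) set"
  assumes [measurable]: "w \<in> borel_measurable borel" "m \<in> borel_measurable borel" "X \<in> sets borel"
    and nn: "\<And>x. 0 \<le> w x" "\<And>x. 0 \<le> m x" and wB: "\<And>x. w x \<le> B"
    and r: "1 < r" "r < 2"
    and \<delta>: "0 < \<delta>" "\<delta> \<le> 1" and X: "X \<subseteq> shell \<delta>"
    and sep: "\<And>x y. x \<in> X \<Longrightarrow> y \<in> X \<Longrightarrow> 1 \<le> norm (x + y)"
    and S: "(\<integral>\<^sup>+x\<in>X. ennreal ((m x)\<^sup>2) \<partial>lborel) = ennreal S" "0 \<le> S"
    and q: "(\<integral>\<^sup>+u. ennreal ((w u)\<^sup>2) \<partial>lborel) = ennreal q" "0 \<le> q"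
  shows "(\<integral>\<^sup>+x\<in>X. (\<integral>\<^sup>+x'\<in>X. ennreal (m x * m x' * (8 * enn2real (HL_max (\<lambda>u. w u powr r) (x + x'))) powr (1 / r)) \<partial>lborel) \<partial>lborel)
     \<le> ennreal (sqrt (shell_const r) * \<delta> * S * sqrt q)"
proof -
  define M where "M z = enn2real (HL_max (\<lambda>u. w u powr r) z)" for z
  have [measurable]: "M \<in> borel_measurable borel" unfolding M_def[abs_def] by measurable
  have M0: "0 \<le> M z" for z by (simp add: M_def)
  have M: "HL_max (\<lambda>u. w u powr r) z = ennreal (M z)" for z
  proof -
    have "HL_max (\<lambda>u. w u powr r) z \<le> ennreal (B powr r)"
      using wB nn r by (intro HL_max_le_bound) (auto intro!: powr_mono2)
    then have "HL_max (\<lambda>u. w u powr r) z < top" by (rule le_less_trans) simp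
    then show ?thesis by (simp add: M_def)
  qed
  define s where "s = 2 / r"
  have s: "1 < s" using r by (simp add: s_def field_simps)
  define D where "D = 2 powr s * 5 ^ 3 * s / (s - 1)"
  have D: "0 \<le> D" using s by (simp add: D_def)
  have HL: "(\<integral>\<^sup>+z. ennreal (M z powr s) \<partial>lborel) \<le> ennreal (D * q)"
  proof -
    have "(\<integral>\<^sup>+z. ennreal (M z powr s) \<partial>lborel) = (\<integral>\<^sup>+z. epowr (HL_max (\<lambda>u. w u powr r) z) s \<partial>lborel)"
      by (simp add: M epowr_def M0)
    also have "\<dots> \<le> ennreal D * (\<integral>\<^sup>+u. ennreal (norm (w u powr r) powr s) \<partial>lborel)"
      using HL_max_strong_type[of "\<lambda>u. w u powr r" s] s by (simp add: D_def)
    also have "(\<integral>\<^sup>+u. ennreal (norm (w u powr r) powr s) \<partial>lborel) = ennreal q"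
    proof -
      have "norm (w u powr r) powr s = (w u)\<^sup>2" for u
        using nn r by (simp add: powr_powr s_def flip: powr_numeral)
      then show ?thesis using q by simp
    qed
    finally show ?thesis using D q by (simp add: ennreal_mult)
  qed
  define f1 where "f1 x x' = indicat_real X x * indicat_real X x' * (m x * m x')" for x x'
  define g1 where "g1 x x' = indicat_real X x * indicat_real X x' * (8 * M (x + x')) powr (1 / r)" for x x'
  have f1p: "(\<integral>\<^sup>+x. \<integral>\<^sup>+x'. ennreal (f1 x x' powr 2) \<partial>lborel \<partial>lborel) \<le> ennreal (S * S)"
  proof -
    have "(\<integral>\<^sup>+x. \<integral>\<^sup>+x'. ennreal (f1 x x' powr 2) \<partial>lborel \<partial>lborel)
      = (\<integral>\<^sup>+x. \<integral>\<^sup>+x'. (ennreal ((m x)\<^sup>2) * indicator X x) * (ennreal ((m x')\<^sup>2) * indicator X x') \<partial>lborel \<partial>lborel)"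
      using nn by (intro nn_integral_cong) (auto simp: f1_def indicator_def power_mult_distrib ennreal_mult)
    also have "\<dots> = (\<integral>\<^sup>+x. (ennreal ((m x)\<^sup>2) * indicator X x) * ennreal S \<partial>lborel)"
      unfolding S(1)[symmetric] by (intro nn_integral_cong nn_integral_cmult) measurable
    also have "\<dots> = ennreal S * ennreal S"
      by (subst nn_integral_multc) (auto simp: S)
    finally show ?thesis using S by (simp add: ennreal_mult)
  qed
  have g1p: "(\<integral>\<^sup>+x. \<integral>\<^sup>+x'. ennreal (g1 x x' powr 2) \<partial>lborel \<partial>lborel) \<le> ennreal (shell_const r * \<delta>\<^sup>2 * q)"
  proof -
    have "(\<integral>\<^sup>+x. \<integral>\<^sup>+x'. ennreal (g1 x x' powr 2) \<partial>lborel \<partial>lborel)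
      = (\<integral>\<^sup>+x. \<integral>\<^sup>+x'. (ennreal ((8 * M (x + x')) powr s) * indicator X x') * indicator X x \<partial>lborel \<partial>lborel)"
    proof (intro nn_integral_cong)
      fix x x'
      have "((8 * M (x + x')) powr (1 / r))\<^sup>2 = (8 * M (x + x')) powr s"
        using M0 by (simp add: s_def powr_powr flip: powr_numeral)
      then show "ennreal (g1 x x' powr 2) = (ennreal ((8 * M (x + x')) powr s) * indicator X x') * indicator X x"
        by (auto simp: g1_def indicator_def)
    qed
    also have "\<dots> = (\<integral>\<^sup>+x\<in>X. (\<integral>\<^sup>+x'\<in>X. ennreal ((8 * M (x + x')) powr s) \<partial>lborel) \<partial>lborel)"
      by (intro nn_integral_cong nn_integral_multc) measurable
    also have "\<dots> \<le> ennreal (9 * pi * \<delta>\<^sup>2) * (\<integral>\<^sup>+z. ennreal ((8 * M z) powr s) \<partial>lborel)"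
      by (rule shell_convolution_bound[OF _ _ \<delta> X sep]) measurable
    also have "(\<integral>\<^sup>+z. ennreal ((8 * M z) powr s) \<partial>lborel) = ennreal (8 powr s) * (\<integral>\<^sup>+z. ennreal (M z powr s) \<partial>lborel)"
      using M0 by (subst nn_integral_cmult[symmetric]) (auto simp: powr_mult ennreal_mult)
    also have "ennreal (9 * pi * \<delta>\<^sup>2) * (ennreal (8 powr s) * (\<integral>\<^sup>+z. ennreal (M z powr s) \<partial>lborel))
      \<le> ennreal (9 * pi * \<delta>\<^sup>2) * (ennreal (8 powr s) * ennreal (D * q))"
      by (intro mult_left_mono HL) auto
    also have "\<dots> = ennreal (9 * pi * \<delta>\<^sup>2 * (8 powr s * (D * q)))"
      using D q by (simp flip: ennreal_mult)
    also have "9 * pi * \<delta>\<^sup>2 * (8 powr s * (D * q)) = shell_const r * \<delta>\<^sup>2 * q"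
      by (simp add: shell_const_def D_def s_def)
    finally show ?thesis .
  qed
  have c0: "0 \<le> shell_const r"
    using r by (intro shell_const_nonneg) auto
  have "(\<integral>\<^sup>+x\<in>X. (\<integral>\<^sup>+x'\<in>X. ennreal (m x * m x' * (8 * M (x + x')) powr (1 / r)) \<partial>lborel) \<partial>lborel)
     = (\<integral>\<^sup>+x. \<integral>\<^sup>+x'. (ennreal (m x * m x' * (8 * M (x + x')) powr (1 / r)) * indicator X x') * indicator X x \<partial>lborel \<partial>lborel)"
    by (intro nn_integral_cong nn_integral_multc[symmetric]) measurable
  also have "\<dots> = (\<integral>\<^sup>+x. \<integral>\<^sup>+x'. ennreal (f1 x x' * g1 x x') \<partial>lborel \<partial>lborel)"
    by (intro nn_integral_cong) (auto simp: f1_def g1_def indicator_def)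
  also have "\<dots> \<le> ennreal ((S * S) powr (1 / 2) * (shell_const r * \<delta>\<^sup>2 * q) powr (1 / 2))"
  proof (rule Holder_nn_integral_pair[OF _ _ _ _ _ _ _ f1p _ g1p])
    show "(\<lambda>z. f1 (fst z) (snd z)) \<in> borel_measurable (borel \<Otimes>\<^sub>M borel)"
      "(\<lambda>z. g1 (fst z) (snd z)) \<in> borel_measurable (borel \<Otimes>\<^sub>M borel)"
      unfolding f1_def g1_def by measurable
  qed (use c0 q S nn in \<open>auto simp: f1_def g1_def\<close>)
  also have "(S * S) powr (1 / 2) * (shell_const r * \<delta>\<^sup>2 * q) powr (1 / 2) = sqrt (shell_const r) * \<delta> * S * sqrt q"
    using c0 q S \<delta> by (simp add: powr_half_sqrt real_sqrt_mult)
  finally show ?thesis by (simp add: M_def)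
qed

lemma cnj_sgn_mult: "cnj (sgn z) * z = of_real (norm z)"
proof (cases "z = 0")
  case False
  then show ?thesis
  proof -
    have "cnj (sgn z) * z = (z * cnj z) / of_real (norm z)"
      by (simp add: sgn_div_norm scaleR_conv_of_real divide_inverse mult_ac)
    also have "\<dots> = of_real (norm z)"
      using False by (simp add: complex_norm_square[symmetric] power2_eq_square)
    finally show ?thesis .
  qed
qed simp

text \<open>
  The maximal restriction theorem at the endpoint for a shell in place of the sphere, with the
  supremum over radii replaced by an arbitrary measurable choice of radii. The factor \<open>\<delta>\<close> is the
  volume of the shell, so after division by it the estimate is uniform in the thickness. The lower
  bound for the radii makes \<open>G\<close> bounded, hence all quantities finite.

  The proof is duality followed by self-improvement: with \<open>S\<close> the quantity to be bounded and \<open>q\<close> the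
  square of the \<open>L\<^sup>2\<close> norm of \<open>|G| * |G|\<close>, duality gives \<open>S \<le> \<Phi>\<^bsup>3/4\<^esup> q\<^bsup>1/4\<^esup>\<close> and the bilinear bound
  gives \<open>q \<le> c \<delta> S \<surd>q\<close>. As \<open>S\<close> and \<open>q\<close> are finite, they can be cancelled.
\<close>
proposition shell_maximal_restriction:
  fixes f :: "real^3 \<Rightarrow> complex" and \<rho> :: "real^3 \<Rightarrow> real" and X :: "(real^3) set"
  assumes f: "integrable lborel f"
    and \<rho> [measurable]: "\<rho> \<in> borel_measurable borel" and \<rho>0: "0 < \<rho>\<^sub>0" "\<And>x. \<rho>\<^sub>0 \<le> \<rho> x"
    and X [measurable]: "X \<in> sets borel"
    and r: "1 < r" "r < 2"
    and \<delta>: "0 < \<delta>" "\<delta> \<le> 1" and X_shell: "X \<subseteq> shell \<delta>"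
    and sep: "\<And>x y. x \<in> X \<Longrightarrow> y \<in> X \<Longrightarrow> 1 \<le> norm (x + y)"
    and \<Phi>: "(\<integral>\<^sup>+x. ennreal (norm (f x) powr (4/3)) \<partial>lborel) \<le> ennreal \<Phi>" "0 \<le> \<Phi>"
  shows "(\<integral>\<^sup>+x\<in>X. epowr ((\<integral>\<^sup>+\<xi>\<in>ball x (\<rho> x). ennreal (norm (fourier f \<xi>) powr r) \<partial>lborel)
              / emeasure lborel (ball x (\<rho> x))) (2 / r) \<partial>lborel)
     \<le> ennreal (sqrt (shell_const r) * \<delta> * \<Phi> powr (3/2))"
proof -
  have fm [measurable]: "f \<in> borel_measurable borel" using f by auto
  define N where "N = (LINT x|lborel. norm (f x))"
  have N0: "0 \<le> N" by (simp add: N_def)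
  define h where "h \<xi> = norm (fourier f \<xi>)" for \<xi>
  have h [measurable]: "h \<in> borel_measurable borel" unfolding h_def by measurable
  have h0: "0 \<le> h \<xi>" and hN: "h \<xi> \<le> N" for \<xi>
    using norm_fourier_le[OF f] by (auto simp: h_def N_def)
  define v where "v x = unit_ball_vol 3 * \<rho> x ^ 3" for x
  have \<rho>_pos: "0 < \<rho> x" for x using \<rho>0 by (meson less_le_trans)
  have v_pos: "0 < v x" for x using \<rho>_pos by (simp add: v_def)
  have v: "emeasure lborel (ball x (\<rho> x)) = ennreal (v x)" for x
    using \<rho>_pos[of x] by (simp add: v_def emeasure_ball)
  have [measurable]: "v \<in> borel_measurable borel" unfolding v_def by measurable
  define I where "I x \<xi> = (if dist x \<xi> < \<rho> x then 1 else 0 :: real)" for x \<xi>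
  have I_ball: "ennreal (I x \<xi>) = indicator (ball x (\<rho> x)) \<xi>" for x \<xi>
    by (simp add: I_def indicator_def)
  have I0: "0 \<le> I x \<xi>" for x \<xi> by (simp add: I_def)
  have I_meas [measurable]: "(\<lambda>p. I (fst p) (snd p)) \<in> borel_measurable (borel \<Otimes>\<^sub>M borel)"
    unfolding I_def by measurable
  have [measurable]: "I x \<in> borel_measurable borel" for x
    unfolding I_def by measurable

  define J where "J x = (\<integral>\<^sup>+\<xi>\<in>ball x (\<rho> x). ennreal (h \<xi> powr r) \<partial>lborel)" for x
  have J_alt: "J x = (\<integral>\<^sup>+\<xi>. ennreal (h \<xi> powr r) * ennreal (I x \<xi>) \<partial>lborel)" for x
    by (simp add: J_def I_ball)
  have [measurable]: "J \<in> borel_measurable borel"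
    unfolding J_alt[abs_def] by measurable
  have J_le: "J x \<le> ennreal (N powr r * v x)" for x
  proof -
    have "J x \<le> (\<integral>\<^sup>+\<xi>. ennreal (N powr r) * indicator (ball x (\<rho> x)) \<xi> \<partial>lborel)"
      unfolding J_def using h0 hN r by (intro nn_integral_mono mult_right_mono ennreal_leI powr_mono2) auto
    also have "\<dots> = ennreal (N powr r) * ennreal (v x)"
      by (subst nn_integral_cmult_indicator) (simp_all add: v)
    finally show ?thesis using v_pos[of x] by (simp add: ennreal_mult)
  qed
  define a where "a x = enn2real (J x) / v x" for x
  have [measurable]: "a \<in> borel_measurable borel" unfolding a_def by measurable
  have a0: "0 \<le> a x" for x using v_pos[of x] by (simp add: a_def)
  have J_a: "J x = ennreal (a x * v x)" for x
  proof -
    have "J x < top" using J_le[of x] by (rule le_less_trans) simp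
    then show ?thesis using v_pos[of x] by (simp add: a_def)
  qed
  have aN: "a x \<le> N powr r" for x
    using J_le[of x] v_pos[of x] a0[of x] unfolding J_a by simp
  define m where "m x = a x powr (1 / r)" for x
  have [measurable]: "m \<in> borel_measurable borel" unfolding m_def by measurable
  have m0: "0 \<le> m x" for x by (simp add: m_def)
  have mN: "m x \<le> N" for x
  proof -
    have "m x \<le> (N powr r) powr (1 / r)"
      unfolding m_def using r by (intro powr_mono2 aN a0) auto
    then show ?thesis using r N0 by (simp add: powr_powr)
  qed
  have m_powr: "m x powr s = a x powr (s / r)" for x s by (simp add: m_def powr_powr)
  have goal_eq: "epowr (J x / emeasure lborel (ball x (\<rho> x))) (2 / r) = ennreal ((m x)\<^sup>2)" for x
  proof -
    have "J x / emeasure lborel (ball x (\<rho> x)) = ennreal (a x)"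
      using v_pos[of x] a0[of x] by (simp add: J_a v divide_ennreal)
    then show ?thesis
      using m0[of x] a0[of x] m_powr[of x 2] by (simp add: epowr_def)
  qed

  have X_fin: "emeasure lborel X < top"
  proof -
    have "emeasure lborel X \<le> emeasure lborel (ball (0::real^3) 2)"
      using X_shell \<delta> by (intro emeasure_mono) (auto simp: shell_def)
    also have "\<dots> < top" by (simp add: emeasure_ball)
    finally show ?thesis .
  qed
  define V where "V = measure lborel X"
  have V: "emeasure lborel X = ennreal V" "0 \<le> V"
    using X_fin by (simp_all add: V_def emeasure_eq_ennreal_measure top.not_eq_extremum)
  have "(\<integral>\<^sup>+x\<in>X. ennreal ((m x)\<^sup>2) \<partial>lborel) \<le> (\<integral>\<^sup>+x. ennreal (N\<^sup>2) * indicator X x \<partial>lborel)"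
    using m0 mN by (intro nn_integral_mono mult_right_mono ennreal_leI power_mono) auto
  also have "\<dots> = ennreal (N\<^sup>2 * V)"
    using V by (simp add: nn_integral_cmult_indicator ennreal_mult)
  finally obtain S where S: "(\<integral>\<^sup>+x\<in>X. ennreal ((m x)\<^sup>2) \<partial>lborel) = ennreal S" "0 \<le> S"
    by (cases "\<integral>\<^sup>+x\<in>X. ennreal ((m x)\<^sup>2) \<partial>lborel") (auto simp: top_unique)

  define c where "c x = m x powr (2 - r) / v x" for x
  have [measurable]: "c \<in> borel_measurable borel" unfolding c_def by measurable
  have c0: "0 \<le> c x" for x using v_pos[of x] by (simp add: c_def)
  \<comment> \<open>The exponents are chosen so that pairing \<open>\<kappa> x\<close> with \<open>h\<close> gives \<open>(m x)\<^sup>2\<close>; \<open>\<phi>\<close> below supplies the phase which makes this pairing one with the Fourier transform of \<open>f\<close>.\<close>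
  define \<kappa> where "\<kappa> x \<xi> = indicat_real X x * c x * (I x \<xi> * h \<xi> powr (r - 1))" for x \<xi>
  have \<kappa>0: "0 \<le> \<kappa> x \<xi>" for x \<xi> using c0 I0 by (simp add: \<kappa>_def)
  have \<kappa>_meas [measurable]: "(\<lambda>p. \<kappa> (fst p) (snd p)) \<in> borel_measurable (borel \<Otimes>\<^sub>M borel)"
    unfolding \<kappa>_def by measurable
  have [measurable]: "(\<lambda>p. \<kappa> (snd p) (fst p)) \<in> borel_measurable (borel \<Otimes>\<^sub>M borel)"
    unfolding \<kappa>_def I_def by measurable
  have [measurable]: "(\<lambda>z. \<kappa> (fst (fst z)) (snd z)) \<in> borel_measurable ((borel \<Otimes>\<^sub>M borel) \<Otimes>\<^sub>M borel)"
    unfolding \<kappa>_def I_def by measurable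
  have [measurable]: "(\<lambda>x. \<kappa> x \<xi>) \<in> borel_measurable borel" "(\<lambda>\<xi>. \<kappa> x \<xi>) \<in> borel_measurable borel" for x \<xi>
    unfolding \<kappa>_def I_def by measurable
  have \<kappa>_integral: "(\<integral>\<^sup>+\<xi>. ennreal (\<kappa> x \<xi>) * Y \<xi> \<partial>lborel)
      = indicator X x * ennreal (c x) * (\<integral>\<^sup>+\<xi>\<in>ball x (\<rho> x). ennreal (h \<xi> powr (r - 1)) * Y \<xi> \<partial>lborel)"
    if [measurable]: "Y \<in> borel_measurable borel" for x Y
  proof -
    have [measurable]: "ball x (\<rho> x) \<in> sets borel" by simp
    have "(\<integral>\<^sup>+\<xi>. ennreal (\<kappa> x \<xi>) * Y \<xi> \<partial>lborel)
       = (\<integral>\<^sup>+\<xi>. (indicator X x * ennreal (c x)) * (ennreal (h \<xi> powr (r - 1)) * Y \<xi> * indicator (ball x (\<rho> x)) \<xi>) \<partial>lborel)"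
      using c0[of x] by (intro nn_integral_cong) (auto simp: \<kappa>_def I_def indicator_def ennreal_mult mult.assoc)
    also have "\<dots> = indicator X x * ennreal (c x) * (\<integral>\<^sup>+\<xi>\<in>ball x (\<rho> x). ennreal (h \<xi> powr (r - 1)) * Y \<xi> \<partial>lborel)"
      by (rule nn_integral_cmult) measurable
    finally show ?thesis .
  qed

  define v0 where "v0 = unit_ball_vol 3 * \<rho>\<^sub>0 ^ 3"
  have v0: "0 < v0" "v0 \<le> v x" for x
    using \<rho>0 by (auto simp: v0_def v_def intro!: mult_left_mono power_mono)
  have h_powr_le: "h \<xi> powr (r - 1) \<le> N powr (r - 1)" for \<xi>
    using h0 hN r by (intro powr_mono2) auto
  have m_powr_le: "m x powr (2 - r) \<le> N powr (2 - r)" for x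
    using m0 mN r by (intro powr_mono2) auto
  \<comment> \<open>Crude bounds, depending on \<open>\<rho>\<^sub>0\<close>, whose only purpose is finiteness of \<open>q\<close>.\<close>
  define \<Gamma> where "\<Gamma> = N powr (2 - r) / v0 * N powr (r - 1) * V"
  have \<Gamma>0: "0 \<le> \<Gamma>" using v0(1) V by (simp add: \<Gamma>_def)
  have gn_le: "(\<integral>\<^sup>+x. ennreal (\<kappa> x \<xi>) \<partial>lborel) \<le> ennreal \<Gamma>" for \<xi>
  proof -
    have "\<kappa> x \<xi> \<le> (N powr (2 - r) / v0 * N powr (r - 1)) * indicat_real X x" for x
    proof -
      have "c x \<le> N powr (2 - r) / v0"
        unfolding c_def using v0 m_powr_le by (intro frac_le) auto
      moreover have "I x \<xi> * h \<xi> powr (r - 1) \<le> 1 * N powr (r - 1)"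
        by (rule mult_mono) (simp_all add: I_def h_powr_le)
      ultimately have "c x * (I x \<xi> * h \<xi> powr (r - 1)) \<le> N powr (2 - r) / v0 * (1 * N powr (r - 1))"
        by (rule mult_mono) (use I0 v0(1) in simp_all)
      then show ?thesis by (simp add: \<kappa>_def indicator_def)
    qed
    then have "(\<integral>\<^sup>+x. ennreal (\<kappa> x \<xi>) \<partial>lborel) \<le> (\<integral>\<^sup>+x. ennreal (N powr (2 - r) / v0 * N powr (r - 1)) * indicator X x \<partial>lborel)"
      using v0(1) by (intro nn_integral_mono) (auto simp: ennreal_indicator[symmetric] ennreal_mult[symmetric] intro!: ennreal_leI)
    also have "\<dots> = ennreal \<Gamma>"
      using V v0(1) by (simp add: nn_integral_cmult_indicator \<Gamma>_def flip: ennreal_mult)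
    finally show ?thesis .
  qed
  define g where "g \<xi> = enn2real (\<integral>\<^sup>+x. ennreal (\<kappa> x \<xi>) \<partial>lborel)" for \<xi>
  have g: "ennreal (g \<xi>) = (\<integral>\<^sup>+x. ennreal (\<kappa> x \<xi>) \<partial>lborel)" for \<xi>
    using le_less_trans[OF gn_le[of \<xi>]] by (simp add: g_def)
  have g0: "0 \<le> g \<xi>" for \<xi> by (simp add: g_def)
  have g_le: "ennreal (g \<xi>) \<le> ennreal \<Gamma>" for \<xi> using gn_le by (simp add: g)
  have [measurable]: "g \<in> borel_measurable borel"
    unfolding g_def by measurable
  have g_integral: "(\<integral>\<^sup>+\<xi>. ennreal (g \<xi>) * Y \<xi> \<partial>lborel) = (\<integral>\<^sup>+x. \<integral>\<^sup>+\<xi>. ennreal (\<kappa> x \<xi>) * Y \<xi> \<partial>lborel \<partial>lborel)"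
    if [measurable]: "Y \<in> borel_measurable borel" for Y
  proof -
    have "(\<integral>\<^sup>+\<xi>. ennreal (g \<xi>) * Y \<xi> \<partial>lborel) = (\<integral>\<^sup>+\<xi>. \<integral>\<^sup>+x. ennreal (\<kappa> x \<xi>) * Y \<xi> \<partial>lborel \<partial>lborel)"
      unfolding g by (intro nn_integral_cong nn_integral_multc[symmetric]) measurable
    also have "\<dots> = (\<integral>\<^sup>+x. \<integral>\<^sup>+\<xi>. ennreal (\<kappa> x \<xi>) * Y \<xi> \<partial>lborel \<partial>lborel)"
      by (rule lborel_pair.Fubini') measurable
    finally show ?thesis .
  qed

  have S_eq: "(\<integral>\<^sup>+\<xi>. ennreal (g \<xi> * h \<xi>) \<partial>lborel) = ennreal S"
  proof -
    have "(\<integral>\<^sup>+\<xi>. ennreal (g \<xi> * h \<xi>) \<partial>lborel) = (\<integral>\<^sup>+\<xi>. ennreal (g \<xi>) * ennreal (h \<xi>) \<partial>lborel)"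
      using g0 h0 by (simp add: ennreal_mult)
    also have "\<dots> = (\<integral>\<^sup>+x. \<integral>\<^sup>+\<xi>. ennreal (\<kappa> x \<xi>) * ennreal (h \<xi>) \<partial>lborel \<partial>lborel)"
      by (rule g_integral) measurable
    also have "\<dots> = (\<integral>\<^sup>+x\<in>X. ennreal ((m x)\<^sup>2) \<partial>lborel)"
    proof (rule nn_integral_cong)
      fix x
      have "h \<xi> powr (r - 1) * h \<xi> = h \<xi> powr r" for \<xi>
        using h0[of \<xi>] powr_add[of "h \<xi>" "r - 1" 1] by simp
      then have "(\<integral>\<^sup>+\<xi>. ennreal (\<kappa> x \<xi>) * ennreal (h \<xi>) \<partial>lborel) = indicator X x * ennreal (c x) * J x"
        using h0 by (simp add: \<kappa>_integral J_def flip: ennreal_mult)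
      also have "\<dots> = ennreal (c x * (a x * v x)) * indicator X x"
        using c0[of x] a0[of x] v_pos[of x] by (simp add: J_a ennreal_mult mult_ac)
      also have "c x * (a x * v x) = (m x)\<^sup>2"
      proof -
        have "c x * (a x * v x) = m x powr (2 - r) * m x powr r"
          using v_pos[of x] a0[of x] r by (simp add: c_def m_powr[of x r])
        also have "\<dots> = (m x)\<^sup>2"
          using m0[of x] powr_add[of "m x" "2 - r" r] by simp
        finally show ?thesis .
      qed
      finally show "(\<integral>\<^sup>+\<xi>. ennreal (\<kappa> x \<xi>) * ennreal (h \<xi>) \<partial>lborel) = ennreal ((m x)\<^sup>2) * indicator X x" .
    qed
    finally show ?thesis using S by simp
  qed

  have g_fin: "(\<integral>\<^sup>+\<xi>. ennreal (g \<xi>) \<partial>lborel) < top"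
  proof -
    have "(\<integral>\<^sup>+\<xi>. ennreal (g \<xi>) * 1 \<partial>lborel) = (\<integral>\<^sup>+x. \<integral>\<^sup>+\<xi>. ennreal (\<kappa> x \<xi>) * 1 \<partial>lborel \<partial>lborel)"
      by (rule g_integral) measurable
    also have "\<dots> \<le> (\<integral>\<^sup>+x. ennreal (N powr (2 - r) * N powr (r - 1)) * indicator X x \<partial>lborel)"
    proof (rule nn_integral_mono)
      fix x
      have "(\<integral>\<^sup>+\<xi>\<in>ball x (\<rho> x). ennreal (h \<xi> powr (r - 1)) * 1 \<partial>lborel) \<le> (\<integral>\<^sup>+\<xi>. ennreal (N powr (r - 1)) * indicator (ball x (\<rho> x)) \<xi> \<partial>lborel)"
        using h_powr_le by (intro nn_integral_mono mult_right_mono) (auto intro!: ennreal_leI)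
      also have "\<dots> = ennreal (N powr (r - 1) * v x)"
        using v_pos[of x] by (subst nn_integral_cmult_indicator) (simp_all add: v ennreal_mult)
      finally have "indicator X x * ennreal (c x) * (\<integral>\<^sup>+\<xi>\<in>ball x (\<rho> x). ennreal (h \<xi> powr (r - 1)) * 1 \<partial>lborel)
         \<le> indicator X x * ennreal (c x) * ennreal (N powr (r - 1) * v x)"
        by (intro mult_left_mono) auto
      also have "\<dots> = ennreal (c x * (N powr (r - 1) * v x)) * indicator X x"
        using c0[of x] v_pos[of x] by (simp add: ennreal_mult mult_ac)
      also have "\<dots> \<le> ennreal (N powr (2 - r) * N powr (r - 1)) * indicator X x"
        using m_powr_le[of x] v_pos[of x] by (intro mult_right_mono ennreal_leI) (simp_all add: c_def mult_right_mono)
      finally show "(\<integral>\<^sup>+\<xi>. ennreal (\<kappa> x \<xi>) * 1 \<partial>lborel) \<le> ennreal (N powr (2 - r) * N powr (r - 1)) * indicator X x"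
        by (subst \<kappa>_integral) auto
    qed
    also have "\<dots> < top"
      using V by (simp add: nn_integral_cmult_indicator ennreal_mult_less_top)
    finally show ?thesis by simp
  qed

  define \<phi> where "\<phi> \<xi> = cnj (sgn (fourier f \<xi>))" for \<xi>
  define G where "G \<xi> = \<phi> \<xi> * of_real (g \<xi>)" for \<xi>
  have [measurable]: "\<phi> \<in> borel_measurable borel" unfolding \<phi>_def by measurable
  have [measurable]: "G \<in> borel_measurable borel" unfolding G_def by measurable
  have norm_G: "norm (G \<xi>) \<le> g \<xi>" for \<xi>
  proof -
    have "norm (\<phi> \<xi>) * g \<xi> \<le> 1 * g \<xi>"
      using g0 by (intro mult_right_mono) (auto simp: \<phi>_def norm_sgn)
    then show ?thesis using g0[of \<xi>] by (simp add: G_def norm_mult)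
  qed
  have G_int: "integrable lborel G"
  proof (rule integrableI_bounded)
    have "(\<integral>\<^sup>+\<xi>. ennreal (norm (G \<xi>)) \<partial>lborel) \<le> (\<integral>\<^sup>+\<xi>. ennreal (g \<xi>) \<partial>lborel)"
      by (intro nn_integral_mono ennreal_leI norm_G)
    then show "(\<integral>\<^sup>+\<xi>. ennreal (norm (G \<xi>)) \<partial>lborel) < \<infinity>"
      using g_fin by (simp add: le_less_trans)
  qed measurable
  have G_f: "fourier f \<xi> * G \<xi> = of_real (g \<xi> * h \<xi>)" for \<xi>
    using cnj_sgn_mult[of "fourier f \<xi>"] by (simp add: G_def \<phi>_def h_def mult_ac)

  define W where "W u = (\<integral>\<^sup>+x. ennreal (g x) * ennreal (g (u - x)) \<partial>lborel)" for u
  have [measurable]: "W \<in> borel_measurable borel" unfolding W_def by measurable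
  have W_le: "W u \<le> ennreal \<Gamma> * (\<integral>\<^sup>+x. ennreal (g x) \<partial>lborel)" for u
  proof -
    have "W u \<le> (\<integral>\<^sup>+x. ennreal (g x) * ennreal \<Gamma> \<partial>lborel)"
      unfolding W_def by (intro nn_integral_mono mult_left_mono g_le) auto
    also have "\<dots> = (\<integral>\<^sup>+x. ennreal (g x) \<partial>lborel) * ennreal \<Gamma>"
      by (rule nn_integral_multc) measurable
    finally show ?thesis by (simp add: mult.commute)
  qed
  obtain B where B: "ennreal \<Gamma> * (\<integral>\<^sup>+x. ennreal (g x) \<partial>lborel) = ennreal B" "0 \<le> B"
    using g_fin by (cases "ennreal \<Gamma> * (\<integral>\<^sup>+x. ennreal (g x) \<partial>lborel)") (auto simp: ennreal_mult_eq_top_iff)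
  define w where "w u = enn2real (W u)" for u
  have [measurable]: "w \<in> borel_measurable borel" unfolding w_def by measurable
  have w0: "0 \<le> w u" for u by (simp add: w_def)
  have W_w: "W u = ennreal (w u)" for u
    using le_less_trans[OF W_le[of u, unfolded B]] by (simp add: w_def)
  have wB: "w u \<le> B" for u
    using W_le[of u] B(2) by (simp add: B W_w)
  have "(\<integral>\<^sup>+u. ennreal ((w u)\<^sup>2) \<partial>lborel) \<le> (\<integral>\<^sup>+u. ennreal B * W u \<partial>lborel)"
    using w0 wB B(2) by (intro nn_integral_mono) (auto simp: W_w power2_eq_square simp flip: ennreal_mult intro!: ennreal_leI mult_right_mono)
  also have "\<dots> = ennreal B * ((\<integral>\<^sup>+x. ennreal (g x) \<partial>lborel) * (\<integral>\<^sup>+x. ennreal (g x) \<partial>lborel))"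
    unfolding W_def by (subst nn_integral_cmult) (measurable, subst nn_integral_convolution, auto)
  also have "\<dots> < top" using g_fin by (simp add: ennreal_mult_less_top)
  finally obtain q where q: "(\<integral>\<^sup>+u. ennreal ((w u)\<^sup>2) \<partial>lborel) = ennreal q" "0 \<le> q"
    by (cases "\<integral>\<^sup>+u. ennreal ((w u)\<^sup>2) \<partial>lborel") auto

  have q_le: "ennreal q \<le> ennreal (sqrt (shell_const r) * \<delta> * S * sqrt q)"
  proof -
    \<comment> \<open>Expanding both factors \<open>|G|\<close> in the pairing of \<open>|G| * |G|\<close> with \<open>W\<close> leaves one term for each pair of centres.\<close>
    define T where "T x x' = (\<integral>\<^sup>+\<xi>. ennreal (\<kappa> x \<xi>) * (\<integral>\<^sup>+\<xi>'. ennreal (\<kappa> x' \<xi>') * W (\<xi> + \<xi>') \<partial>lborel) \<partial>lborel)" for x x'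
    have W3 [measurable]: "(\<lambda>z. W (snd (fst z) + snd z)) \<in> borel_measurable ((lborel \<Otimes>\<^sub>M lborel) \<Otimes>\<^sub>M lborel)"
      by (rule measurable_compose[OF _ \<open>W \<in> borel_measurable borel\<close>]) measurable
    have "ennreal q = (\<integral>\<^sup>+u. W u * W u \<partial>lborel)"
      unfolding q(1)[symmetric] using w0 by (simp add: W_w power2_eq_square ennreal_mult)
    also have "\<dots> = (\<integral>\<^sup>+u. \<integral>\<^sup>+\<xi>. W u * (ennreal (g \<xi>) * ennreal (g (u - \<xi>))) \<partial>lborel \<partial>lborel)"
    proof (rule nn_integral_cong)
      fix u
      have "(\<integral>\<^sup>+\<xi>. W u * (ennreal (g \<xi>) * ennreal (g (u - \<xi>))) \<partial>lborel) = W u * (\<integral>\<^sup>+\<xi>. ennreal (g \<xi>) * ennreal (g (u - \<xi>)) \<partial>lborel)"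
        by (rule nn_integral_cmult) measurable
      then show "W u * W u = (\<integral>\<^sup>+\<xi>. W u * (ennreal (g \<xi>) * ennreal (g (u - \<xi>))) \<partial>lborel)"
        by (simp only: W_def)
    qed
    also have "\<dots> = (\<integral>\<^sup>+\<xi>. \<integral>\<^sup>+u. W u * (ennreal (g \<xi>) * ennreal (g (u - \<xi>))) \<partial>lborel \<partial>lborel)"
      by (rule lborel_pair.Fubini') measurable
    also have "\<dots> = (\<integral>\<^sup>+\<xi>. ennreal (g \<xi>) * (\<integral>\<^sup>+\<xi>'. ennreal (g \<xi>') * W (\<xi> + \<xi>') \<partial>lborel) \<partial>lborel)"
    proof (rule nn_integral_cong)
      fix \<xi>
      have "(\<integral>\<^sup>+u. W u * (ennreal (g \<xi>) * ennreal (g (u - \<xi>))) \<partial>lborel)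
         = (\<integral>\<^sup>+\<xi>'. W (\<xi> + \<xi>') * (ennreal (g \<xi>) * ennreal (g ((\<xi> + \<xi>') - \<xi>))) \<partial>lborel)"
        by (rule nn_integral_lborel_translate[symmetric]) measurable
      also have "\<dots> = (\<integral>\<^sup>+\<xi>'. ennreal (g \<xi>) * (ennreal (g \<xi>') * W (\<xi> + \<xi>')) \<partial>lborel)"
        by (intro nn_integral_cong) (simp add: mult_ac)
      also have "\<dots> = ennreal (g \<xi>) * (\<integral>\<^sup>+\<xi>'. ennreal (g \<xi>') * W (\<xi> + \<xi>') \<partial>lborel)"
        by (rule nn_integral_cmult) measurable
      finally show "(\<integral>\<^sup>+u. W u * (ennreal (g \<xi>) * ennreal (g (u - \<xi>))) \<partial>lborel) = ennreal (g \<xi>) * (\<integral>\<^sup>+\<xi>'. ennreal (g \<xi>') * W (\<xi> + \<xi>') \<partial>lborel)" .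
    qed
    also have "\<dots> = (\<integral>\<^sup>+x. \<integral>\<^sup>+\<xi>. ennreal (\<kappa> x \<xi>) * (\<integral>\<^sup>+\<xi>'. ennreal (g \<xi>') * W (\<xi> + \<xi>') \<partial>lborel) \<partial>lborel \<partial>lborel)"
      by (rule g_integral) measurable
    also have "\<dots> = (\<integral>\<^sup>+x. \<integral>\<^sup>+\<xi>. \<integral>\<^sup>+x'. ennreal (\<kappa> x \<xi>) * (\<integral>\<^sup>+\<xi>'. ennreal (\<kappa> x' \<xi>') * W (\<xi> + \<xi>') \<partial>lborel) \<partial>lborel \<partial>lborel \<partial>lborel)"
    proof (intro nn_integral_cong)
      fix x \<xi>
      have "(\<integral>\<^sup>+\<xi>'. ennreal (g \<xi>') * W (\<xi> + \<xi>') \<partial>lborel) = (\<integral>\<^sup>+x'. \<integral>\<^sup>+\<xi>'. ennreal (\<kappa> x' \<xi>') * W (\<xi> + \<xi>') \<partial>lborel \<partial>lborel)"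
        by (rule g_integral) measurable
      then show "ennreal (\<kappa> x \<xi>) * (\<integral>\<^sup>+\<xi>'. ennreal (g \<xi>') * W (\<xi> + \<xi>') \<partial>lborel) = (\<integral>\<^sup>+x'. ennreal (\<kappa> x \<xi>) * (\<integral>\<^sup>+\<xi>'. ennreal (\<kappa> x' \<xi>') * W (\<xi> + \<xi>') \<partial>lborel) \<partial>lborel)"
        by (simp only:) (rule nn_integral_cmult[symmetric], measurable)
    qed
    also have "\<dots> = (\<integral>\<^sup>+x. \<integral>\<^sup>+x'. T x x' \<partial>lborel \<partial>lborel)"
      unfolding T_def by (rule nn_integral_cong, rule lborel_pair.Fubini') measurable
    also have "\<dots> \<le> (\<integral>\<^sup>+x. \<integral>\<^sup>+x'. ennreal (m x * m x' * (8 * enn2real (HL_max (\<lambda>u. w u powr r) (x + x'))) powr (1 / r)) * indicator X x' * indicator X x \<partial>lborel \<partial>lborel)"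
    proof (rule nn_integral_mono, rule nn_integral_mono)
      fix x x'
      define M where "M = enn2real (HL_max (\<lambda>u. w u powr r) (x + x'))"
      have M0: "0 \<le> M" by (simp add: M_def)
      have M: "HL_max (\<lambda>u. w u powr r) (x + x') = ennreal M"
      proof -
        have "HL_max (\<lambda>u. w u powr r) (x + x') \<le> ennreal (B powr r)"
          using w0 wB r by (intro HL_max_le_bound) (auto intro!: powr_mono2)
        then have "HL_max (\<lambda>u. w u powr r) (x + x') < top" by (rule le_less_trans) simp
        then show ?thesis by (simp add: M_def)
      qed
      have avg: "(\<integral>\<^sup>+\<xi>\<in>ball x (\<rho> x). (\<integral>\<^sup>+\<xi>'\<in>ball x' (\<rho> x'). ennreal (w (\<xi> + \<xi>') powr r) \<partial>lborel) \<partial>lborel) \<le> ennreal (8 * M * v x * v x')"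
      proof -
        have "(\<integral>\<^sup>+\<xi>\<in>ball x (\<rho> x). (\<integral>\<^sup>+\<xi>'\<in>ball x' (\<rho> x'). ennreal (w (\<xi> + \<xi>') powr r) \<partial>lborel) \<partial>lborel)
          \<le> 2 ^ DIM(real^3) * HL_max (\<lambda>u. w u powr r) (x + x') * emeasure lborel (ball x (\<rho> x)) * emeasure lborel (ball x' (\<rho> x'))"
          using \<rho>_pos by (intro ball_sum_average_le_HL_max) auto
        also have "\<dots> = ennreal (8 * M * v x * v x')"
          using M0 v_pos[of x] v_pos[of x'] by (simp add: M v ennreal_mult)
        finally show ?thesis .
      qed
      have "T x x' = indicator X x * ennreal (c x) * (\<integral>\<^sup>+\<xi>\<in>ball x (\<rho> x). ennreal (h \<xi> powr (r - 1)) *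
          (indicator X x' * ennreal (c x') * (\<integral>\<^sup>+\<xi>'\<in>ball x' (\<rho> x'). ennreal (h \<xi>' powr (r - 1)) * W (\<xi> + \<xi>') \<partial>lborel)) \<partial>lborel)"
        unfolding T_def by (subst \<kappa>_integral) (measurable, subst \<kappa>_integral, measurable)
      also have "(\<integral>\<^sup>+\<xi>\<in>ball x (\<rho> x). ennreal (h \<xi> powr (r - 1)) *
          (indicator X x' * ennreal (c x') * (\<integral>\<^sup>+\<xi>'\<in>ball x' (\<rho> x'). ennreal (h \<xi>' powr (r - 1)) * W (\<xi> + \<xi>') \<partial>lborel)) \<partial>lborel)
         = indicator X x' * ennreal (c x') * (\<integral>\<^sup>+\<xi>\<in>ball x (\<rho> x). ennreal (h \<xi> powr (r - 1)) *
          (\<integral>\<^sup>+\<xi>'\<in>ball x' (\<rho> x'). ennreal (h \<xi>' powr (r - 1)) * ennreal (w (\<xi> + \<xi>')) \<partial>lborel) \<partial>lborel)"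
        (is "?L = _ * ?R")
      proof -
        have [measurable]: "ball x (\<rho> x) \<in> sets borel" "ball x' (\<rho> x') \<in> sets borel" by simp_all
        have "?L = (\<integral>\<^sup>+\<xi>. (indicator X x' * ennreal (c x')) * (ennreal (h \<xi> powr (r - 1)) *
          (\<integral>\<^sup>+\<xi>'\<in>ball x' (\<rho> x'). ennreal (h \<xi>' powr (r - 1)) * ennreal (w (\<xi> + \<xi>')) \<partial>lborel) * indicator (ball x (\<rho> x)) \<xi>) \<partial>lborel)"
          unfolding W_w by (intro nn_integral_cong) (simp only: mult_ac)
        also have "\<dots> = indicator X x' * ennreal (c x') * ?R"
          by (rule nn_integral_cmult) measurable
        finally show ?thesis .
      qed
      also have "indicator X x * ennreal (c x) * (indicator X x' * ennreal (c x') * ?R)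
          \<le> indicator X x * ennreal (c x) * (indicator X x' * ennreal (c x') * ennreal (v x * v x' * (a x * a x') powr (1 - 1 / r) * (8 * M) powr (1 / r)))"
      proof (intro mult_left_mono trilinear_ball_average)
        show "(\<integral>\<^sup>+\<xi>\<in>ball x (\<rho> x). ennreal (h \<xi> powr r) \<partial>lborel) \<le> ennreal (a x * v x)"
          "(\<integral>\<^sup>+\<xi>\<in>ball x' (\<rho> x'). ennreal (h \<xi> powr r) \<partial>lborel) \<le> ennreal (a x' * v x')"
          using J_a by (simp_all add: J_def)
        show "(\<integral>\<^sup>+\<xi>\<in>ball x (\<rho> x). (\<integral>\<^sup>+\<xi>'\<in>ball x' (\<rho> x'). ennreal (w (\<xi> + \<xi>') powr r) \<partial>lborel) \<partial>lborel) \<le> ennreal (8 * M * v x * v x')"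
          by (rule avg)
      qed (use a0 v_pos h0 w0 r M0 in auto)
      also have "\<dots> = ennreal (c x * (c x' * (v x * v x' * (a x * a x') powr (1 - 1 / r) * (8 * M) powr (1 / r)))) * indicator X x' * indicator X x"
        using c0 a0 v_pos[of x] v_pos[of x'] M0 by (simp add: ennreal_mult mult_ac)
      also have "c x * (c x' * (v x * v x' * (a x * a x') powr (1 - 1 / r) * (8 * M) powr (1 / r))) = m x * m x' * (8 * M) powr (1 / r)"
      proof -
        have m: "c z * v z * a z powr (1 - 1 / r) = m z" for z
        proof -
          have "a z powr (1 - 1 / r) = m z powr (r - 1)"
            using r by (simp add: m_powr diff_divide_distrib)
          then have "c z * v z * a z powr (1 - 1 / r) = m z powr (2 - r) * m z powr (r - 1)"
            using v_pos[of z] by (simp add: c_def)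
          also have "\<dots> = m z" using m0[of z] powr_add[of "m z" "2 - r" "r - 1"] by simp
          finally show ?thesis .
        qed
        have "c x * (c x' * (v x * v x' * (a x * a x') powr (1 - 1 / r) * (8 * M) powr (1 / r)))
          = (c x * v x * a x powr (1 - 1 / r)) * (c x' * v x' * a x' powr (1 - 1 / r)) * (8 * M) powr (1 / r)"
          using a0 by (simp add: powr_mult mult_ac)
        then show ?thesis by (simp only: m)
      qed
      finally show "T x x' \<le> ennreal (m x * m x' * (8 * enn2real (HL_max (\<lambda>u. w u powr r) (x + x'))) powr (1 / r)) * indicator X x' * indicator X x"
        by (simp only: M_def)
    qed
    also have "\<dots> = (\<integral>\<^sup>+x\<in>X. (\<integral>\<^sup>+x'\<in>X. ennreal (m x * m x' * (8 * enn2real (HL_max (\<lambda>u. w u powr r) (x + x'))) powr (1 / r)) \<partial>lborel) \<partial>lborel)"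
      by (intro nn_integral_cong nn_integral_multc) measurable
    also have "\<dots> \<le> ennreal (sqrt (shell_const r) * \<delta> * S * sqrt q)"
      by (rule shell_bilinear_bound[OF _ _ _ w0 m0 wB r \<delta> X_shell sep S q]) measurable
    finally show ?thesis .
  qed

  have S_le: "S \<le> \<Phi> powr (3/4) * q powr (1/4)"
  proof -
    have G4: "(\<integral>\<^sup>+\<xi>. ennreal (norm (fourier G \<xi>) powr 4) \<partial>lborel) \<le> ennreal q"
    proof -
      have "(\<integral>\<^sup>+\<xi>. ennreal (norm (fourier G \<xi>) powr 4) \<partial>lborel) = (\<integral>\<^sup>+\<xi>. ennreal (norm (fourier G \<xi>) ^ 4) \<partial>lborel)"
        by simp
      also have "\<dots> \<le> (\<integral>\<^sup>+u. (\<integral>\<^sup>+x. ennreal (norm (G x)) * ennreal (norm (G (u - x))) \<partial>lborel)\<^sup>2 \<partial>lborel)"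
        by (rule fourier_L4_bound[OF G_int])
      also have "\<dots> \<le> (\<integral>\<^sup>+u. (W u)\<^sup>2 \<partial>lborel)"
        unfolding W_def by (intro nn_integral_mono power_mono mult_mono ennreal_leI norm_G) auto
      also have "\<dots> = ennreal q"
        using w0 q by (simp add: W_w ennreal_power)
      finally show ?thesis .
    qed
    \<comment> \<open>Both \<open>g\<close> and \<open>h\<close> are nonnegative, so \<open>S\<close> is the modulus of a complex integral, to which the multiplication formula applies.\<close>
    have gh_int: "integrable lborel (\<lambda>\<xi>. g \<xi> * h \<xi>)"
      using g0 h0 S_eq by (intro integrableI_bounded) (auto simp: abs_mult)
    have "ennreal S = ennreal (LINT \<xi>|lborel. g \<xi> * h \<xi>)"
      unfolding S_eq[symmetric] using gh_int g0 h0 by (intro nn_integral_eq_integral) auto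
    also have "\<dots> \<le> ennreal (norm (of_real (LINT \<xi>|lborel. g \<xi> * h \<xi>) :: complex))"
      by (intro ennreal_leI) simp
    also have "of_real (LINT \<xi>|lborel. g \<xi> * h \<xi>) = (LINT \<xi>|lborel. fourier f \<xi> * G \<xi>)"
      by (simp only: G_f integral_complex_of_real)
    also have "\<dots> = (LINT x|lborel. f x * fourier G x)"
      by (rule fourier_multiplication_formula[OF f G_int])
    also have "ennreal (norm \<dots>) \<le> (\<integral>\<^sup>+x. ennreal (norm (f x * fourier G x)) \<partial>lborel)"
      by (rule integral_norm_bound_nn_integral)
    also have "\<dots> = (\<integral>\<^sup>+x. ennreal (norm (f x) * norm (fourier G x)) \<partial>lborel)"
      by (simp add: norm_mult)
    also have "\<dots> \<le> ennreal (\<Phi> powr (1 / (4/3)) * q powr (1 / 4))"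
      by (rule Holder_nn_integral[OF _ _ _ _ _ _ _ \<Phi> G4]) (use q in auto)
    finally show ?thesis using \<Phi> q by simp
  qed

  have sc0: "0 \<le> shell_const r"
    using r by (intro shell_const_nonneg) auto
  have "S \<le> sqrt (shell_const r) * \<delta> * \<Phi> powr (3/2)"
  proof (cases "S = 0")
    case True
    then show ?thesis using sc0 \<delta> by simp
  next
    case False
    then have S_pos: "0 < S" using S by simp
    then have q_pos: "0 < q" using S_le q by (cases "q = 0") auto
    have "q \<le> sqrt (shell_const r) * \<delta> * S * sqrt q"
      using q_le q_pos by (simp add: ennreal_le_iff2)
    then have "sqrt q * sqrt q \<le> (sqrt (shell_const r) * \<delta> * S) * sqrt q"
      using q_pos by simp
    then have sq: "sqrt q \<le> sqrt (shell_const r) * \<delta> * S"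
      using q_pos by (subst (asm) mult_le_cancel_right) auto
    have "S\<^sup>2 \<le> (\<Phi> powr (3/4) * q powr (1/4))\<^sup>2"
      using S_le S_pos by (intro power_mono) auto
    also have "\<dots> = \<Phi> powr (3/2) * sqrt q"
    proof -
      have "(q powr (1/4))\<^sup>2 = sqrt q" "(\<Phi> powr (3/4))\<^sup>2 = \<Phi> powr (3/2)"
        using q_pos powr_powr[of \<Phi> "3/4" 2] by (simp_all add: powr_power powr_half_sqrt)
      then show ?thesis by (simp add: power_mult_distrib)
    qed
    also have "\<dots> \<le> \<Phi> powr (3/2) * (sqrt (shell_const r) * \<delta> * S)"
      by (intro mult_left_mono sq) auto
    finally have "S * S \<le> (sqrt (shell_const r) * \<delta> * \<Phi> powr (3/2)) * S"
      by (simp add: power2_eq_square mult_ac)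
    then show ?thesis using S_pos by (subst (asm) mult_le_cancel_right) auto
  qed
  then have "(\<integral>\<^sup>+x\<in>X. ennreal ((m x)\<^sup>2) \<partial>lborel) \<le> ennreal (sqrt (shell_const r) * \<delta> * \<Phi> powr (3/2))"
    unfolding S(1) by (rule ennreal_leI)
  then show ?thesis
    unfolding goal_eq[symmetric] by (simp add: J_def h_def)
qed

section \<open>From thin shells to the sphere\<close>

lemma epowr_mono: "a \<le> b \<Longrightarrow> 0 < s \<Longrightarrow> epowr a s \<le> epowr b s"
  by (cases a; cases b) (auto simp: epowr_def top_unique intro!: ennreal_leI powr_mono2)

lemma epowr_epowr: "0 < s \<Longrightarrow> 0 < t \<Longrightarrow> epowr (epowr a s) t = epowr a (s * t)"
  by (cases a) (auto simp: epowr_def powr_powr)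

lemma epowr_one [simp]: "epowr a 1 = a"
  by (cases a) (auto simp: epowr_def)

lemma epowr_ennreal: "0 \<le> x \<Longrightarrow> epowr (ennreal x) s = ennreal (x powr s)"
  by (simp add: epowr_def)

lemma epowr_top [simp]: "epowr top s = top"
  by (simp add: epowr_def)

lemma epowr_mult: "0 \<le> c \<Longrightarrow> 0 < s \<Longrightarrow> epowr (ennreal c * a) s = ennreal (c powr s) * epowr a s"
proof (cases a)
  case (real x)
  assume "0 \<le> c" "0 < s"
  with real show ?thesis
    by (simp add: epowr_def powr_mult flip: ennreal_mult)
next
  case top
  assume "0 \<le> c" "0 < s"
  with top show ?thesis
    by (cases "c = 0") (simp_all add: epowr_def ennreal_mult_top)
qed

text \<open>
  Continuity from below, obtained from monotonicity alone: powers have inverse powers.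
\<close>
lemma epowr_SUP_le:
  assumes s: "0 < s"
  shows "epowr (SUP i\<in>I. f i) s \<le> (SUP i\<in>I. epowr (f i) s)"
proof -
  let ?b = "SUP i\<in>I. epowr (f i) s"
  have "(SUP i\<in>I. f i) \<le> epowr ?b (1 / s)"
  proof (rule SUP_least)
    fix i assume "i \<in> I"
    then have "epowr (epowr (f i) s) (1 / s) \<le> epowr ?b (1 / s)"
      using s by (intro epowr_mono SUP_upper) auto
    then show "f i \<le> epowr ?b (1 / s)" using s by (simp add: epowr_epowr)
  qed
  then have "epowr (SUP i\<in>I. f i) s \<le> epowr (epowr ?b (1 / s)) s"
    using s by (intro epowr_mono) auto
  then show ?thesis using s by (simp add: epowr_epowr)
qed

lemma measurable_epowr [measurable]:
  assumes "f \<in> borel_measurable M"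
  shows "(\<lambda>x. epowr (f x) s) \<in> borel_measurable M"
  unfolding epowr_def using assms by measurable

lemma measurable_sphere_measure:
  assumes "f \<in> borel_measurable borel"
  shows "f \<in> borel_measurable (sphere_measure :: 'a::euclidean_space measure)"
  using measurable_restrict_space1[OF assms, of "sphere 0 1"]
  by (simp only: measurable_cong_sets[OF sets_sphere_measure refl])

text \<open>
  Over finitely many candidates a maximiser can be chosen measurably. This makes the radius at which
  a truncated maximal function is attained a measurable function of the centre.
\<close>
lemma measurable_argmax:
  fixes F :: "'i \<Rightarrow> 'a \<Rightarrow> ennreal" and g :: "'i \<Rightarrow> real"
  assumes "finite J" "J \<noteq> {}" and "\<And>j. j \<in> J \<Longrightarrow> F j \<in> borel_measurable M"
  shows "\<exists>\<rho> Fm. \<rho> \<in> borel_measurable M \<and> Fm \<in> borel_measurable M \<and>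
    (\<forall>x. \<exists>j\<in>J. \<rho> x = g j \<and> Fm x = F j x \<and> (\<forall>i\<in>J. F i x \<le> Fm x))"
  using assms
proof (induction J rule: finite_ne_induct)
  case (singleton j)
  then show ?case by (intro exI[of _ "\<lambda>_. g j"] exI[of _ "F j"]) auto
next
  case (insert j J)
  then obtain \<rho> Fm where IH: "\<rho> \<in> borel_measurable M" "Fm \<in> borel_measurable M"
    "\<And>x. \<exists>j\<in>J. \<rho> x = g j \<and> Fm x = F j x \<and> (\<forall>i\<in>J. F i x \<le> Fm x)"
    by auto
  have [measurable]: "F j \<in> borel_measurable M" using insert by simp
  note [measurable] = IH(1,2)
  show ?case
  proof (intro exI conjI allI)
    show "(\<lambda>x. if Fm x \<le> F j x then g j else \<rho> x) \<in> borel_measurable M"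
      "(\<lambda>x. if Fm x \<le> F j x then F j x else Fm x) \<in> borel_measurable M"
      by measurable
    fix x
    obtain i where i: "i \<in> J" "\<rho> x = g i" "Fm x = F i x" "\<forall>i\<in>J. F i x \<le> Fm x" using IH(3) by blast
    show "\<exists>i\<in>insert j J. (if Fm x \<le> F j x then g j else \<rho> x) = g i \<and>
          (if Fm x \<le> F j x then F j x else Fm x) = F i x \<and>
          (\<forall>i\<in>insert j J. F i x \<le> (if Fm x \<le> F j x then F j x else Fm x))"
    proof (cases "Fm x \<le> F j x")
      case True
      then show ?thesis using i(4) by (intro bexI[of _ j]) (auto intro: order_trans)
    next
      case False
      then show ?thesis using i by (intro bexI[of _ i]) auto
    qed
  qed
qed

definition ball_avg :: "('a::euclidean_space \<Rightarrow> real) \<Rightarrow> real \<Rightarrow> 'a \<Rightarrow> ennreal" where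
  "ball_avg H \<rho> x = (\<integral>\<^sup>+y\<in>ball x \<rho>. ennreal (H y) \<partial>lborel) / emeasure lborel (ball x \<rho>)"

lemma HL_max_eq_SUP_ball_avg:
  assumes "\<And>y. 0 \<le> H y"
  shows "HL_max H x = (SUP \<rho>\<in>{0<..}. ball_avg H \<rho> x)"
  using assms by (simp add: HL_max_def ball_avg_def)

lemma measurable_ball_avg:
  fixes H :: "'a::euclidean_space \<Rightarrow> real"
  assumes [measurable]: "H \<in> borel_measurable borel"
  shows "ball_avg H \<rho> \<in> borel_measurable borel"
proof (cases "0 < \<rho>")
  case True
  have eq: "ball_avg H \<rho> = (\<lambda>x. (\<integral>\<^sup>+y. ennreal (H y) * (if dist x y < \<rho> then 1 else 0) \<partial>lborel) / emeasure lborel (ball (0::'a) \<rho>))"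
  proof (rule ext)
    fix x :: 'a
    have "(\<integral>\<^sup>+y\<in>ball x \<rho>. ennreal (H y) \<partial>lborel) = (\<integral>\<^sup>+y. ennreal (H y) * (if dist x y < \<rho> then 1 else 0) \<partial>lborel)"
      by (intro nn_integral_cong) (auto simp: indicator_def)
    then show "ball_avg H \<rho> x = (\<integral>\<^sup>+y. ennreal (H y) * (if dist x y < \<rho> then 1 else 0) \<partial>lborel) / emeasure lborel (ball (0::'a) \<rho>)"
      using True by (simp add: ball_avg_def emeasure_ball)
  qed
  show ?thesis
    unfolding eq by measurable
next
  case False
  then have "ball_avg H \<rho> = (\<lambda>x. 0)" by (simp add: ball_avg_def fun_eq_iff ball_empty)
  then show ?thesis by simp
qed

text \<open>
  Moving the centre by an amount that the larger radius absorbs costs only the volume ratio of the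
  balls.
\<close>
lemma ball_avg_le_shifted:
  fixes H :: "'a::euclidean_space \<Rightarrow> real"
  assumes \<rho>: "0 < \<rho>" "\<rho> + dist x y \<le> \<rho>'" "\<rho>' \<le> 2 * \<rho>"
  shows "ball_avg H \<rho> x \<le> 2 ^ DIM('a) * ball_avg H \<rho>' y"
proof -
  have \<rho>': "0 < \<rho>'" using \<rho> by (smt (verit) zero_le_dist)
  have sub: "ball x \<rho> \<subseteq> ball y \<rho>'"
  proof
    fix z assume "z \<in> ball x \<rho>"
    then show "z \<in> ball y \<rho>'"
      using dist_triangle[of y z x] \<rho> by (simp add: dist_commute)
  qed
  define I I' where "I = (\<integral>\<^sup>+z\<in>ball x \<rho>. ennreal (H z) \<partial>lborel)" and "I' = (\<integral>\<^sup>+z\<in>ball y \<rho>'. ennreal (H z) \<partial>lborel)"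
  have I_le: "I \<le> I'"
    unfolding I_def I'_def using sub by (intro nn_integral_mono mult_left_mono) (auto simp: indicator_def)
  define v v' where "v = unit_ball_vol (real DIM('a)) * \<rho> ^ DIM('a)" and "v' = unit_ball_vol (real DIM('a)) * \<rho>' ^ DIM('a)"
  have v: "emeasure lborel (ball x \<rho>) = ennreal v" "emeasure lborel (ball y \<rho>') = ennreal v'" "0 < v" "0 < v'"
    using \<rho> \<rho>' by (simp_all add: v_def v'_def emeasure_ball)
  have v'_le: "v' \<le> 2 ^ DIM('a) * v"
  proof -
    have "\<rho>' ^ DIM('a) \<le> (2 * \<rho>) ^ DIM('a)" using \<rho> \<rho>' by (intro power_mono) auto
    then have "unit_ball_vol (real DIM('a)) * \<rho>' ^ DIM('a) \<le> unit_ball_vol (real DIM('a)) * (2 * \<rho>) ^ DIM('a)"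
      by (intro mult_left_mono) auto
    then show ?thesis by (simp add: v_def v'_def power_mult_distrib mult_ac)
  qed
  have div: "z / ennreal s = z * ennreal (1 / s)" if "0 < s" for z s
    using that by (simp add: divide_ennreal_def inverse_ennreal divide_inverse)
  have "I / ennreal v \<le> I' / ennreal v" by (rule divide_right_mono_ennreal[OF I_le])
  also have "\<dots> = I' * ennreal (1 / v)"
    by (rule div[OF v(3)])
  also have "\<dots> \<le> I' * ennreal (2 ^ DIM('a) * (1 / v'))"
  proof (intro mult_left_mono ennreal_leI)
    have "1 / v = 2 ^ DIM('a) / (2 ^ DIM('a) * v)" by simp
    also have "\<dots> \<le> 2 ^ DIM('a) / v'"
      using v v'_le by (intro divide_left_mono) auto
    finally show "1 / v \<le> 2 ^ DIM('a) * (1 / v')" by simp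
  qed simp
  also have "\<dots> = 2 ^ DIM('a) * (I' * ennreal (1 / v'))"
    using v(4) by (subst ennreal_mult) (simp_all add: mult_ac flip: ennreal_power)
  also have "I' * ennreal (1 / v') = I' / ennreal v'"
    by (rule div[OF v(4), symmetric])
  finally show ?thesis by (simp add: ball_avg_def I_def I'_def v)
qed

text \<open>
  The octants cover space, and any two elements of the same one have a nonnegative inner product.
\<close>
definition octant :: "('n::finite \<Rightarrow> bool) \<Rightarrow> (real^'n) set" where
  "octant b = {x. \<forall>i. if b i then 0 \<le> x $ i else x $ i \<le> 0}"

lemma octant_cover: "\<exists>b. x \<in> octant b"
  by (rule exI[of _ "\<lambda>i. 0 \<le> x $ i"]) (auto simp: octant_def)

lemma measurable_octant [measurable]: "octant b \<in> sets borel"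
  unfolding octant_def by measurable

text \<open>
  A nonnegative inner product makes the norm of the sum at least the norm of either summand.
\<close>
lemma octant_shell_separated:
  assumes "x \<in> shell \<delta> \<inter> octant b" "y \<in> shell \<delta> \<inter> octant b"
  shows "1 \<le> norm (x + y)"
proof -
  have "0 \<le> x \<bullet> y"
    unfolding inner_vec_def using assms
    by (intro sum_nonneg) (auto simp: octant_def zero_le_mult_iff split: if_splits)
  moreover have "1 \<le> norm x" "0 \<le> (norm y)\<^sup>2" using assms by (auto simp: shell_def)
  moreover have "1\<^sup>2 \<le> (norm x)\<^sup>2" using \<open>1 \<le> norm x\<close> by (intro power_mono) auto
  moreover have "(norm (x + y))\<^sup>2 = (norm x)\<^sup>2 + 2 * (x \<bullet> y) + (norm y)\<^sup>2"
    by (simp add: power2_norm_eq_inner inner_add inner_commute)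
  ultimately have "1\<^sup>2 \<le> (norm (x + y))\<^sup>2" by linarith
  then show ?thesis by (rule power2_le_imp_le) simp
qed

text \<open>
  One summand for each octant; the factor \<open>8\<close> comes from moving the centre from the sphere to the
  shell.
\<close>
definition sphere_const :: "real \<Rightarrow> real" where
  "sphere_const r = real CARD(3 \<Rightarrow> bool) * (8 powr (2 / r) * sqrt (shell_const r))"

text \<open>
  With the thickness \<open>\<delta> = 2\<^bsup>-n\<^esup>\<close> equal to the smallest radius, the maximal function at a point of
  the sphere is comparable to averages over balls centred at any point of the shell above it, with
  doubled radii. So the integral over the sphere is at most \<open>1 / \<delta>\<close> times one over the shell, and this
  factor cancels the volume of the shell.
\<close>
lemma sphere_truncated_maximal:
  fixes f :: "real^3 \<Rightarrow> complex" and n :: nat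
  assumes f: "integrable lborel f" and r: "1 < r" "r < 2"
    and \<Phi>: "(\<integral>\<^sup>+x. ennreal (norm (f x) powr (4/3)) \<partial>lborel) \<le> ennreal \<Phi>" "0 \<le> \<Phi>"
  defines "H \<equiv> \<lambda>y. norm (fourier f y) powr r"
  shows "(\<integral>\<^sup>+\<omega>. epowr (SUP j\<in>{- int n..int n}. ball_avg H (2 powr real_of_int j) \<omega>) (2 / r) \<partial>sphere_measure)
    \<le> ennreal (sphere_const r * \<Phi> powr (3/2))"
proof -
  have [measurable]: "f \<in> borel_measurable borel" using f by auto
  have [measurable]: "H \<in> borel_measurable borel" unfolding H_def by measurable
  have H0: "0 \<le> H y" for y by (simp add: H_def)
  note [measurable] = measurable_ball_avg
  obtain \<rho> Fm where \<rho> [measurable]: "\<rho> \<in> borel_measurable borel" and Fm [measurable]: "Fm \<in> borel_measurable borel"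
    and sel: "\<And>x. \<exists>j\<in>{- int n..int n}. \<rho> x = 2 powr real_of_int j \<and> Fm x = ball_avg H (2 powr real_of_int j) x
        \<and> (\<forall>i\<in>{- int n..int n}. ball_avg H (2 powr real_of_int i) x \<le> Fm x)"
    using measurable_argmax[of "{- int n..int n}" "\<lambda>j. ball_avg H (2 powr real_of_int j)" borel "\<lambda>j. 2 powr real_of_int j"]
    by (auto simp: measurable_ball_avg)
  have sup_eq: "(SUP j\<in>{- int n..int n}. ball_avg H (2 powr real_of_int j) x) = Fm x" for x
  proof (rule antisym)
    show "(SUP j\<in>{- int n..int n}. ball_avg H (2 powr real_of_int j) x) \<le> Fm x"
      using sel[of x] by (intro SUP_least) blast
    obtain j where j: "j \<in> {- int n..int n}" "Fm x = ball_avg H (2 powr real_of_int j) x"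
      using sel[of x] by blast
    show "Fm x \<le> (SUP j\<in>{- int n..int n}. ball_avg H (2 powr real_of_int j) x)"
      unfolding j(2) by (rule SUP_upper[OF j(1)])
  qed
  have Fm_avg: "Fm x = ball_avg H (\<rho> x) x" for x using sel[of x] by auto
  define \<delta> where "\<delta> = 2 powr (- real n)"
  have \<delta>: "0 < \<delta>" "\<delta> \<le> 1" by (simp_all add: \<delta>_def powr_minus_divide ge_one_powr_ge_zero)
  have \<rho>_ge: "\<delta> \<le> \<rho> x" for x using sel[of x] by (auto simp: \<delta>_def)
  have \<rho>_pos: "0 < \<rho> x" for x using \<rho>_ge[of x] \<delta> by linarith
  define N where "N = (LINT x|lborel. norm (f x))"
  have Fm_le: "Fm x \<le> ennreal (N powr r)" for x
  proof -
    have "Fm x \<le> HL_max H x"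
      unfolding Fm_avg HL_max_eq_SUP_ball_avg[OF H0] using \<rho>_pos by (intro SUP_upper) auto
    also have "\<dots> \<le> ennreal (N powr r)"
      using norm_fourier_le[OF f] r by (intro HL_max_le_bound) (auto simp: H_def N_def intro!: powr_mono2)
    finally show ?thesis .
  qed
  define \<phi> where "\<phi> x = epowr (Fm x) (2 / r)" for x
  have [measurable]: "\<phi> \<in> borel_measurable borel" unfolding \<phi>_def by measurable
  have \<phi>_le: "\<phi> x \<le> ennreal ((N powr r) powr (2 / r))" for x
    unfolding \<phi>_def using epowr_mono[OF Fm_le, of "2 / r" x] r by (simp add: epowr_ennreal)
  \<comment> \<open>The radius chosen at the projection to the sphere, doubled to absorb the distance to it.\<close>
  define \<rho>2 where "\<rho>2 x = 2 * \<rho> (sgn x)" for x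
  have [measurable]: "\<rho>2 \<in> borel_measurable borel" unfolding \<rho>2_def by measurable
  define \<psi> where "\<psi> x = epowr (ball_avg H (\<rho>2 x) x) (2 / r)" for x
  have psi_meas [measurable]: "\<psi> \<in> borel_measurable borel"
  proof -
    have "ball_avg H (\<rho>2 x) x = (\<integral>\<^sup>+y. ennreal (H y) * (if dist x y < \<rho>2 x then 1 else 0) \<partial>lborel) / ennreal (unit_ball_vol 3 * \<rho>2 x ^ 3)" for x
    proof -
      have "(\<integral>\<^sup>+y\<in>ball x (\<rho>2 x). ennreal (H y) \<partial>lborel) = (\<integral>\<^sup>+y. ennreal (H y) * (if dist x y < \<rho>2 x then 1 else 0) \<partial>lborel)"
        by (intro nn_integral_cong) (auto simp: indicator_def)
      then show ?thesis using \<rho>_pos[of "sgn x"] by (simp add: ball_avg_def emeasure_ball \<rho>2_def)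
    qed
    then show ?thesis unfolding \<psi>_def by simp
  qed
  have shift: "\<phi> (sgn x) \<le> ennreal (8 powr (2 / r)) * \<psi> x" if x: "x \<in> shell \<delta>" for x
  proof -
    have x1: "1 \<le> norm x" "norm x < 1 + \<delta>" using x by (auto simp: shell_def)
    have x0: "x \<noteq> 0" using x1(1) by auto
    have "dist (sgn x) x = norm x - 1"
    proof -
      have "x - sgn x = (1 - 1 / norm x) *\<^sub>R x" by (simp add: sgn_div_norm algebra_simps divide_inverse)
      moreover have "0 \<le> 1 - 1 / norm x" using x1 x0 by (simp add: divide_le_eq)
      ultimately have "norm (x - sgn x) = (1 - 1 / norm x) * norm x" by simp
      also have "\<dots> = norm x - 1" using x0 by (simp add: left_diff_distrib)
      finally show ?thesis by (simp add: dist_norm norm_minus_commute)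
    qed
    then have "Fm (sgn x) \<le> 2 ^ DIM(real^3) * ball_avg H (\<rho>2 x) x"
      unfolding Fm_avg \<rho>2_def using x1 \<rho>_ge[of "sgn x"] \<rho>_pos[of "sgn x"] by (intro ball_avg_le_shifted) auto
    then have "\<phi> (sgn x) \<le> epowr (ennreal 8 * ball_avg H (\<rho>2 x) x) (2 / r)"
      unfolding \<phi>_def using r by (intro epowr_mono) auto
    also have "\<dots> = ennreal (8 powr (2 / r)) * \<psi> x"
      unfolding \<psi>_def using r by (intro epowr_mult) auto
    finally show ?thesis .
  qed
  have "ennreal \<delta> * (\<integral>\<^sup>+\<omega>. \<phi> \<omega> \<partial>sphere_measure) \<le> (\<integral>\<^sup>+x\<in>shell \<delta>. \<phi> (sgn x) \<partial>lborel)"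
    by (rule nn_integral_sphere_le_shell[OF _ \<phi>_le \<delta>(1)]) measurable
  also have "\<dots> \<le> (\<integral>\<^sup>+x. (\<Sum>b\<in>UNIV. ennreal (8 powr (2 / r)) * (\<psi> x * indicator (shell \<delta> \<inter> octant b) x)) \<partial>lborel)"
  proof (rule nn_integral_mono)
    fix x :: "real^3"
    show "\<phi> (sgn x) * indicator (shell \<delta>) x \<le> (\<Sum>b\<in>UNIV. ennreal (8 powr (2 / r)) * (\<psi> x * indicator (shell \<delta> \<inter> octant b) x))"
    proof (cases "x \<in> shell \<delta>")
      case True
      obtain b where b: "x \<in> octant b" using octant_cover by blast
      have "\<phi> (sgn x) * indicator (shell \<delta>) x \<le> ennreal (8 powr (2 / r)) * (\<psi> x * indicator (shell \<delta> \<inter> octant b) x)"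
        using shift[OF True] True b by simp
      also have "\<dots> \<le> (\<Sum>b\<in>UNIV. ennreal (8 powr (2 / r)) * (\<psi> x * indicator (shell \<delta> \<inter> octant b) x))"
        by (rule member_le_sum) auto
      finally show ?thesis .
    qed simp
  qed
  also have "\<dots> = (\<Sum>b\<in>UNIV. ennreal (8 powr (2 / r)) * (\<integral>\<^sup>+x\<in>shell \<delta> \<inter> octant b. \<psi> x \<partial>lborel))"
    by (subst nn_integral_sum) (auto intro!: sum.cong nn_integral_cmult)
  also have "\<dots> \<le> (\<Sum>b\<in>(UNIV :: (3 \<Rightarrow> bool) set). ennreal (8 powr (2 / r)) * ennreal (sqrt (shell_const r) * \<delta> * \<Phi> powr (3/2)))"
  proof (intro sum_mono mult_left_mono)
    fix b :: "3 \<Rightarrow> bool"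
    show "(\<integral>\<^sup>+x\<in>shell \<delta> \<inter> octant b. \<psi> x \<partial>lborel) \<le> ennreal (sqrt (shell_const r) * \<delta> * \<Phi> powr (3/2))"
      unfolding \<psi>_def ball_avg_def H_def
    proof (rule shell_maximal_restriction[OF f _ \<delta>(1) _ _ r \<delta> _ octant_shell_separated \<Phi>])
      show "\<delta> \<le> \<rho>2 x" for x using \<rho>_ge[of "sgn x"] \<delta> by (simp add: \<rho>2_def)
    qed auto
  qed auto
  also have "\<dots> = ennreal \<delta> * ennreal (sphere_const r * \<Phi> powr (3/2))"
    using \<delta> shell_const_nonneg[of r] r
    by (simp add: sphere_const_def ennreal_of_nat_eq_real_of_nat mult_ac flip: ennreal_mult)
  finally have "ennreal (1 / \<delta>) * (ennreal \<delta> * (\<integral>\<^sup>+\<omega>. \<phi> \<omega> \<partial>sphere_measure)) \<le> ennreal (1 / \<delta>) * (ennreal \<delta> * ennreal (sphere_const r * \<Phi> powr (3/2)))"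
    by (rule mult_left_mono) simp
  moreover have "ennreal (1 / \<delta>) * (ennreal \<delta> * z) = z" for z
    using \<delta> by (simp add: mult.assoc[symmetric] flip: ennreal_mult)
  ultimately have "(\<integral>\<^sup>+\<omega>. \<phi> \<omega> \<partial>sphere_measure) \<le> ennreal (sphere_const r * \<Phi> powr (3/2))"
    by simp
  then show ?thesis by (simp add: sup_eq \<phi>_def)
qed

text \<open>
  Every ball is contained in the concentric ball whose radius is the next power of two, at most
  twice as large.
\<close>
lemma HL_max_le_dyadic:
  fixes H :: "'a::euclidean_space \<Rightarrow> real"
  assumes H0: "\<And>y. 0 \<le> H y"
  shows "HL_max H x \<le> 2 ^ DIM('a) * (SUP n. SUP j\<in>{- int n..int n}. ball_avg H (2 powr real_of_int j) x)"
  unfolding HL_max_eq_SUP_ball_avg[OF H0]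
proof (rule SUP_least)
  fix \<rho> :: real assume "\<rho> \<in> {0<..}"
  then have \<rho>: "0 < \<rho>" by simp
  define j where "j = \<lceil>log 2 \<rho>\<rceil>"
  have "\<rho> = 2 powr (log 2 \<rho>)" using \<rho> by simp
  then have j: "\<rho> \<le> 2 powr real_of_int j"
    unfolding j_def by (metis le_of_int_ceiling one_le_numeral powr_mono)
  have "2 powr real_of_int j \<le> 2 powr (1 + log 2 \<rho>)"
    unfolding j_def by (intro powr_mono) linarith+
  also have "\<dots> = 2 * \<rho>" using \<rho> by (simp add: powr_add)
  finally have j2: "2 powr real_of_int j \<le> 2 * \<rho>" .
  have "ball_avg H \<rho> x \<le> 2 ^ DIM('a) * ball_avg H (2 powr real_of_int j) x"
    using \<rho> j j2 by (intro ball_avg_le_shifted) auto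
  also have "ball_avg H (2 powr real_of_int j) x \<le> (SUP j\<in>{- int (nat \<bar>j\<bar>)..int (nat \<bar>j\<bar>)}. ball_avg H (2 powr real_of_int j) x)"
    by (rule SUP_upper) auto
  also have "\<dots> \<le> (SUP n. SUP j\<in>{- int n..int n}. ball_avg H (2 powr real_of_int j) x)"
    by (rule SUP_upper) simp
  finally show "ball_avg H \<rho> x \<le> 2 ^ DIM('a) * (SUP n. SUP j\<in>{- int n..int n}. ball_avg H (2 powr real_of_int j) x)"
    by (simp add: mult_left_mono)
qed

theorem sphere_maximal_endpoint:
  fixes f :: "real^3 \<Rightarrow> complex"
  assumes f: "integrable lborel f" and r: "1 < r" "r < 2"
    and \<Phi>: "(\<integral>\<^sup>+x. ennreal (norm (f x) powr (4/3)) \<partial>lborel) \<le> ennreal \<Phi>" "0 \<le> \<Phi>"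
  shows "(\<integral>\<^sup>+\<omega>. epowr (HL_max (\<lambda>y. norm (fourier f y) powr r) \<omega>) (2 / r) \<partial>sphere_measure)
    \<le> ennreal (8 powr (2 / r) * sphere_const r * \<Phi> powr (3/2))"
proof -
  define H where "H y = norm (fourier f y) powr r" for y
  have [measurable]: "f \<in> borel_measurable borel" using f by auto
  have [measurable]: "H \<in> borel_measurable borel" unfolding H_def by measurable
  have H0: "0 \<le> H y" for y by (simp add: H_def)
  define A where "A n x = (SUP j\<in>{- int n..int n}. ball_avg H (2 powr real_of_int j) x)" for n :: nat and x
  have A_inc: "incseq (\<lambda>n x. epowr (A n x) (2 / r))"
    unfolding A_def incseq_def le_fun_def using r by (auto intro!: epowr_mono SUP_subset_mono)
  have A_meas: "A n \<in> borel_measurable borel" for n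
    unfolding A_def by (intro borel_measurable_SUP measurable_ball_avg) auto
  have s: "0 < 2 / r" using r by simp
  have "epowr (HL_max H \<omega>) (2 / r) \<le> ennreal (8 powr (2 / r)) * (SUP n. epowr (A n \<omega>) (2 / r))" for \<omega>
  proof -
    have "HL_max H \<omega> \<le> ennreal 8 * (SUP n. A n \<omega>)"
      using HL_max_le_dyadic[OF H0, where x = \<omega>] by (simp add: A_def)
    then have "epowr (HL_max H \<omega>) (2 / r) \<le> epowr (ennreal 8 * (SUP n. A n \<omega>)) (2 / r)"
      by (rule epowr_mono[OF _ s])
    also have "\<dots> = ennreal (8 powr (2 / r)) * epowr (SUP n. A n \<omega>) (2 / r)"
      using s by (intro epowr_mult) auto
    also have "\<dots> \<le> ennreal (8 powr (2 / r)) * (SUP n. epowr (A n \<omega>) (2 / r))"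
      by (intro mult_left_mono epowr_SUP_le s) simp
    finally show ?thesis .
  qed
  then have "(\<integral>\<^sup>+\<omega>. epowr (HL_max H \<omega>) (2 / r) \<partial>sphere_measure)
    \<le> (\<integral>\<^sup>+\<omega>. ennreal (8 powr (2 / r)) * (SUP n. epowr (A n \<omega>) (2 / r)) \<partial>sphere_measure)"
    by (intro nn_integral_mono) auto
  also have "\<dots> = ennreal (8 powr (2 / r)) * (\<integral>\<^sup>+\<omega>. (SUP n. epowr (A n \<omega>) (2 / r)) \<partial>sphere_measure)"
    by (intro nn_integral_cmult borel_measurable_SUP measurable_sphere_measure measurable_epowr A_meas) auto
  also have "(\<integral>\<^sup>+\<omega>. (SUP n. epowr (A n \<omega>) (2 / r)) \<partial>sphere_measure) = (SUP n. \<integral>\<^sup>+\<omega>. epowr (A n \<omega>) (2 / r) \<partial>sphere_measure)"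
    by (intro nn_integral_monotone_convergence_SUP A_inc measurable_sphere_measure measurable_epowr A_meas)
  also have "\<dots> \<le> ennreal (sphere_const r * \<Phi> powr (3/2))"
    unfolding A_def H_def by (intro SUP_least sphere_truncated_maximal[OF f r \<Phi>])
  finally have "(\<integral>\<^sup>+\<omega>. epowr (HL_max H \<omega>) (2 / r) \<partial>sphere_measure) \<le> ennreal (8 powr (2 / r)) * ennreal (sphere_const r * \<Phi> powr (3/2))"
    by (simp add: mult_left_mono)
  also have "\<dots> = ennreal (8 powr (2 / r) * sphere_const r * \<Phi> powr (3/2))"
    using shell_const_nonneg[of r] r by (simp add: sphere_const_def mult.assoc flip: ennreal_mult)
  finally show ?thesis unfolding H_def[abs_def] .
qed

section \<open>Below the endpoint: the quadratic maximal function\<close>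

lemma HL_max_le_suminf:
  fixes F :: "'a::euclidean_space \<Rightarrow> real" and G :: "nat \<Rightarrow> 'a \<Rightarrow> real"
  assumes [measurable]: "\<And>n. G n \<in> borel_measurable borel"
    and le: "\<And>y. ennreal (norm (F y)) \<le> (\<Sum>n. ennreal (c n) * ennreal (norm (G n y)))"
  shows "HL_max F x \<le> (\<Sum>n. ennreal (c n) * HL_max (G n) x)"
  unfolding HL_max_def[of F]
proof (rule SUP_least)
  fix \<rho> :: real assume "\<rho> \<in> {0<..}"
  then have \<rho>: "0 < \<rho>" by simp
  have [measurable]: "ball x \<rho> \<in> sets borel" by simp
  have "(\<integral>\<^sup>+y\<in>ball x \<rho>. ennreal (norm (F y)) \<partial>lborel)
     \<le> (\<integral>\<^sup>+y. (\<Sum>n. ennreal (c n) * (ennreal (norm (G n y)) * indicator (ball x \<rho>) y)) \<partial>lborel)"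
    using le by (intro nn_integral_mono) (auto simp: indicator_def)
  also have "\<dots> = (\<Sum>n. \<integral>\<^sup>+y. ennreal (c n) * (ennreal (norm (G n y)) * indicator (ball x \<rho>) y) \<partial>lborel)"
    by (rule nn_integral_suminf) measurable
  also have "\<dots> = (\<Sum>n. ennreal (c n) * (\<integral>\<^sup>+y\<in>ball x \<rho>. ennreal (norm (G n y)) \<partial>lborel))"
    by (intro suminf_cong nn_integral_cmult) measurable
  also have "\<dots> \<le> (\<Sum>n. ennreal (c n) * (HL_max (G n) x * emeasure lborel (ball x \<rho>)))"
    using \<rho> by (intro suminf_le mult_left_mono HL_max_ge) auto
  also have "\<dots> = emeasure lborel (ball x \<rho>) * (\<Sum>n. ennreal (c n) * HL_max (G n) x)"
    by (subst ennreal_suminf_cmult[symmetric]) (simp add: mult_ac)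
  finally show "(\<integral>\<^sup>+y\<in>ball x \<rho>. ennreal (norm (F y)) \<partial>lborel) / emeasure lborel (ball x \<rho>) \<le> (\<Sum>n. ennreal (c n) * HL_max (G n) x)"
    using emeasure_lborel_ball_pos[OF \<rho>, of x]
    by (intro divide_le_posI_ennreal) (auto simp: zero_less_iff_neq_zero)
qed

lemma HL_max_cmult_le:
  fixes F G :: "'a::euclidean_space \<Rightarrow> real"
  assumes [measurable]: "G \<in> borel_measurable borel"
    and le: "\<And>y. norm (F y) \<le> c * norm (G y)" and c: "0 \<le> c"
  shows "HL_max F x \<le> ennreal c * HL_max G x"
proof -
  have sum1: "(\<Sum>n. ennreal (if n = 0 then c else 0) * z) = ennreal c * z" for z
    by (subst suminf_finite[of "{0}"]) auto
  have "HL_max F x \<le> (\<Sum>n. ennreal (if n = 0 then c else 0) * HL_max G x)"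
  proof (rule HL_max_le_suminf)
    show "ennreal (norm (F y)) \<le> (\<Sum>n. ennreal (if n = 0 then c else 0) * ennreal (norm (G y)))" for y
      unfolding sum1 using le[of y] c by (simp add: ennreal_leI flip: ennreal_mult)
  qed simp
  then show ?thesis unfolding sum1 .
qed

lemma nn_integral_sphere_const:
  "(\<integral>\<^sup>+\<omega>. ennreal c \<partial>(sphere_measure :: (real^3) measure)) = ennreal c * ennreal (4 * pi)"
  by (simp add: space_sphere_measure emeasure_sphere_measure_3)

lemma sphere_const_nonneg:
  assumes "0 < r" "r < 2"
  shows "0 \<le> sphere_const r"
  using shell_const_nonneg[OF assms] by (simp add: sphere_const_def)

text \<open>
  Either \<open>u\<close> is at most \<open>B\<^sup>r\<close>, or raising \<open>u\<close> to the power \<open>2 / r > 1\<close> gains a power of \<open>B\<close>. Integrated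
  over a space of finite measure, this passes from an \<open>L\<^bsup>2/r\<^esup>\<close> bound to an \<open>L\<^sup>1\<close> bound with the
  correct homogeneity in \<open>B\<close>.
\<close>
lemma ennreal_interpolate:
  assumes r: "0 < r" "r < 2" and B: "0 < B"
  shows "u \<le> ennreal (B powr r) + ennreal (B powr (r - 2)) * epowr u (2 / r)"
proof (cases u)
  case (real t)
  show ?thesis
  proof (cases "t \<le> B powr r")
    case True
    then have "u \<le> ennreal (B powr r)" using real by (simp add: ennreal_leI)
    then show ?thesis by (rule order_trans) simp
  next
    case False
    then have t: "B powr r < t" "0 < t" using B by (auto intro: less_trans[of 0 "B powr r"])
    have "t = t powr (1 - 2 / r) * t powr (2 / r)"
      using t by (simp flip: powr_add)
    also have "t powr (1 - 2 / r) \<le> (B powr r) powr (1 - 2 / r)"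
      using t B r by (intro powr_mono2') (auto simp: field_simps)
    also have "(B powr r) powr (1 - 2 / r) = B powr (r - 2)"
      using r by (simp add: powr_powr right_diff_distrib)
    finally have "t \<le> B powr (r - 2) * t powr (2 / r)" by (simp add: mult_right_mono)
    then have "u \<le> ennreal (B powr (r - 2)) * epowr u (2 / r)"
      using real t by (simp add: epowr_ennreal ennreal_leI flip: ennreal_mult)
    then show ?thesis by (rule order_trans) simp
  qed
next
  case top
  then show ?thesis using B by (simp add: ennreal_mult_top)
qed

text \<open>
  The area of the sphere plus the constant of \<open>sphere_maximal_endpoint\<close>: the two terms of
  \<open>ennreal_interpolate\<close>.
\<close>
definition interpolation_const :: "real \<Rightarrow> real" where
  "interpolation_const r = 4 * pi + 8 powr (2 / r) * sphere_const r"

text \<open>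
  Interpolation between the \<open>L\<^sup>1\<close> bound for the Fourier transform and the endpoint: writing the square
  as the power \<open>2 - r\<close> times the power \<open>r\<close>, the first factor is bounded by \<open>N\<close>.
\<close>
lemma quadratic_maximal_interpolated:
  fixes g :: "real^3 \<Rightarrow> complex"
  assumes g: "integrable lborel g" and r: "1 < r" "r < 2"
    and N: "(LINT x|lborel. norm (g x)) \<le> N" and B: "0 < B"
    and \<Phi>: "(\<integral>\<^sup>+x. ennreal (norm (g x) powr (4/3)) \<partial>lborel) \<le> ennreal (B powr (4/3))"
  shows "(\<integral>\<^sup>+\<omega>. HL_max (\<lambda>y. (norm (fourier g y))\<^sup>2) \<omega> \<partial>sphere_measure)
    \<le> ennreal (interpolation_const r * N powr (2 - r) * B powr r)"
proof -
  have [measurable]: "g \<in> borel_measurable borel" using g by auto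
  define H where "H = (\<lambda>y. norm (fourier g y) powr r)"
  have [measurable]: "H \<in> borel_measurable borel" unfolding H_def by measurable
  have HLm [measurable]: "HL_max H \<in> borel_measurable (sphere_measure :: (real^3) measure)"
    by (intro measurable_sphere_measure) measurable
  have "HL_max (\<lambda>y. (norm (fourier g y))\<^sup>2) \<omega> \<le> ennreal (N powr (2 - r)) * HL_max H \<omega>" for \<omega>
  proof (rule HL_max_cmult_le)
    fix y
    define t where "t = norm (fourier g y)"
    have t: "0 \<le> t" "t \<le> N" using norm_fourier_le[OF g, of y] N by (auto simp: t_def)
    have "t\<^sup>2 = t powr (2 - r) * t powr r"
      using t by (simp flip: powr_add)
    also have "\<dots> \<le> N powr (2 - r) * t powr r"
      using t r by (intro mult_right_mono powr_mono2) auto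
    finally show "norm ((norm (fourier g y))\<^sup>2) \<le> N powr (2 - r) * norm (H y)"
      by (simp add: H_def t_def)
  qed auto
  then have "(\<integral>\<^sup>+\<omega>. HL_max (\<lambda>y. (norm (fourier g y))\<^sup>2) \<omega> \<partial>sphere_measure)
     \<le> (\<integral>\<^sup>+\<omega>. ennreal (N powr (2 - r)) * HL_max H \<omega> \<partial>sphere_measure)"
    by (intro nn_integral_mono) auto
  also have "\<dots> = ennreal (N powr (2 - r)) * (\<integral>\<^sup>+\<omega>. HL_max H \<omega> \<partial>sphere_measure)"
    by (rule nn_integral_cmult) measurable
  also have "(\<integral>\<^sup>+\<omega>. HL_max H \<omega> \<partial>sphere_measure)
     \<le> (\<integral>\<^sup>+\<omega>. ennreal (B powr r) + ennreal (B powr (r - 2)) * epowr (HL_max H \<omega>) (2 / r) \<partial>sphere_measure)"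
    using r B by (intro nn_integral_mono ennreal_interpolate) auto
  also have "\<dots> = ennreal (B powr r) * ennreal (4 * pi) + ennreal (B powr (r - 2)) * (\<integral>\<^sup>+\<omega>. epowr (HL_max H \<omega>) (2 / r) \<partial>sphere_measure)"
    by (subst nn_integral_add) (auto simp: nn_integral_cmult nn_integral_sphere_const[simplified])
  also have "(\<integral>\<^sup>+\<omega>. epowr (HL_max H \<omega>) (2 / r) \<partial>sphere_measure)
     \<le> ennreal (8 powr (2 / r) * sphere_const r * (B powr (4/3)) powr (3/2))"
    unfolding H_def by (rule sphere_maximal_endpoint[OF g r \<Phi>]) simp
  finally have "(\<integral>\<^sup>+\<omega>. HL_max (\<lambda>y. (norm (fourier g y))\<^sup>2) \<omega> \<partial>sphere_measure)
    \<le> ennreal (N powr (2 - r)) * (ennreal (B powr r) * ennreal (4 * pi) + ennreal (B powr (r - 2)) * ennreal (8 powr (2 / r) * sphere_const r * (B powr (4/3)) powr (3/2)))"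
    by (simp add: add_left_mono mult_left_mono)
  also have "\<dots> = ennreal (N powr (2 - r) * (B powr r * (4 * pi) + B powr (r - 2) * (8 powr (2 / r) * sphere_const r * (B powr (4/3)) powr (3/2))))"
    using sphere_const_nonneg[of r] r by (simp flip: ennreal_mult ennreal_plus)
  also have "N powr (2 - r) * (B powr r * (4 * pi) + B powr (r - 2) * (8 powr (2 / r) * sphere_const r * (B powr (4/3)) powr (3/2)))
    = interpolation_const r * N powr (2 - r) * B powr r"
  proof -
    have "B powr (r - 2) * (B powr (4/3)) powr (3/2) = B powr r"
      by (simp add: powr_powr flip: powr_add)
    then have "B powr (r - 2) * (8 powr (2 / r) * sphere_const r * (B powr (4/3)) powr (3/2)) = 8 powr (2 / r) * sphere_const r * B powr r"
      by (metis mult.left_commute)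
    then show ?thesis unfolding interpolation_const_def by (simp only:) (simp add: algebra_simps)
  qed
  finally show ?thesis .
qed

lemma fourier_add:
  assumes "integrable lborel f" "integrable lborel g"
  shows "fourier (\<lambda>x. f x + g x) \<xi> = fourier f \<xi> + fourier g \<xi>"
  using integrable_kernel_mult[OF assms(1), of "\<lambda>x. character x \<xi>"] integrable_kernel_mult[OF assms(2), of "\<lambda>x. character x \<xi>"]
  by (simp add: fourier_eq_character_integral distrib_left)

text \<open>
  Split \<open>f\<close> by size into the part above \<open>A\<close> and the pieces between \<open>A 2\<^bsup>-k-1\<^esup>\<close> and \<open>A 2\<^bsup>-k\<^esup>\<close>. The
  large part has \<open>L\<^sup>1\<close> norm at most \<open>A\<close>. A piece has \<open>L\<^sup>1\<close> norm at most \<open>A 2\<^bsup>(k+1)(p-1)\<^esup>\<close> and \<open>L\<^bsup>4/3\<^esup>\<close>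
  norm at most \<open>A 2\<^bsup>-k\<theta>\<^esup>\<close>, so with \<open>r = 2 - \<theta>\<close> the interpolated estimate for it decays like
  \<open>2\<^bsup>-k\<theta>\<^esup>\<close>. Half of this decay, in the form of the weights \<open>q\<^sup>k\<close>, is spent on replacing the square of
  the sum of the pieces by a sum of squares.
\<close>
lemma quadratic_maximal_below_endpoint:
  fixes f :: "real^3 \<Rightarrow> complex"
  assumes f: "integrable lborel f" and p: "1 \<le> p" "p < 4/3" and A: "0 < A"
    and fA: "(\<integral>\<^sup>+x. ennreal (norm (f x) powr p) \<partial>lborel) \<le> ennreal (A powr p)"
  defines "\<theta> \<equiv> 1 - 3 * p / 4"
  defines "q \<equiv> 2 powr (- \<theta> / 2)"
  shows "(\<integral>\<^sup>+\<omega>. HL_max (\<lambda>y. (norm (fourier f y))\<^sup>2) \<omega> \<partial>sphere_measure)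
    \<le> ennreal ((1 / (1 - sqrt q))\<^sup>2 * ((4 * pi + 2 * interpolation_const (2 - \<theta>) / q\<^sup>2) / (1 - q)) * A\<^sup>2)"
proof -
  have fm [measurable]: "f \<in> borel_measurable borel" using f by auto
  have \<theta>: "0 < \<theta>" "\<theta> \<le> 1 / 4" using p by (auto simp: \<theta>_def)
  have q: "0 < q" "q < 1" using \<theta> powr_less_cancel_iff[of 2 "- \<theta> / 2" 0] by (auto simp: q_def)
  have sq: "0 < sqrt q" "sqrt q < 1" using q by auto
  define r where "r = 2 - \<theta>"
  have r: "1 < r" "r < 2" using \<theta> by (auto simp: r_def)
  define s where "s n x = (if A * (1/2) ^ n < norm (f x) then f x else 0)" for n x
  define g where "g n = (\<lambda>x. case n of 0 \<Rightarrow> s 0 x | Suc k \<Rightarrow> s (Suc k) x - s k x)" for n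
  have s_meas [measurable]: "s n \<in> borel_measurable borel" for n unfolding s_def by measurable
  have s_int: "integrable lborel (s n)" for n
    by (rule Bochner_Integration.integrable_bound[OF f]) (auto simp: s_def)
  have g_int: "integrable lborel (g n)" for n
    using s_int by (cases n) (simp_all add: g_def)
  have [measurable]: "g n \<in> borel_measurable borel" for n using g_int[of n] by auto
  have g_Suc: "g (Suc n) x = (if A * (1/2) ^ Suc n < norm (f x) \<and> norm (f x) \<le> A * (1/2) ^ n then f x else 0)" for n x
    using A norm_ge_zero[of "f x"] by (auto simp: g_def s_def simp del: norm_ge_zero)
  have s_sum: "norm (fourier (s n) y) \<le> (\<Sum>k\<le>n. norm (fourier (g k) y))" for n y
  proof (induction n)
    case 0
    then show ?case by (simp add: g_def)
  next
    case (Suc n)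
    have "s (Suc n) = (\<lambda>x. s n x + g (Suc n) x)" by (simp add: g_def)
    then have "fourier (s (Suc n)) y = fourier (s n) y + fourier (g (Suc n)) y"
      using fourier_add[OF s_int g_int] by simp
    then have "norm (fourier (s (Suc n)) y) \<le> norm (fourier (s n) y) + norm (fourier (g (Suc n)) y)"
      by (simp add: norm_triangle_ineq)
    then show ?case using Suc by simp
  qed
  have s_lim: "(\<lambda>n. fourier (s n) y) \<longlonglongrightarrow> fourier f y" for y
    unfolding fourier_eq_character_integral
  proof (rule integral_dominated_convergence[where w = "\<lambda>x. norm (f x)"])
    show "AE x in lborel. (\<lambda>n. character x y * s n x) \<longlonglongrightarrow> character x y * f x"
    proof (intro AE_I2 tendsto_mult tendsto_const)
      fix x
      show "(\<lambda>n. s n x) \<longlonglongrightarrow> f x"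
      proof (cases "f x = 0")
        case True
        then have "s n x = f x" for n by (simp add: s_def)
        then show ?thesis by simp
      next
        case False
        have "(\<lambda>n. A * (1/2) ^ n) \<longlonglongrightarrow> A * 0"
          by (intro tendsto_mult tendsto_const LIMSEQ_realpow_zero) auto
        then have "\<forall>\<^sub>F n in sequentially. A * (1/2) ^ n < norm (f x)"
          using False by (intro order_tendstoD(2)) auto
        then have "\<forall>\<^sub>F n in sequentially. s n x = f x"
          by eventually_elim (simp add: s_def)
        then show ?thesis by (rule tendsto_eventually)
      qed
    qed
    show "AE x in lborel. norm (character x y * s n x) \<le> norm (f x)" for n
      by (auto simp: norm_mult s_def)
  qed (use f in \<open>auto intro: borel_measurable_times measurable_character1\<close>)
  \<comment> \<open>If the weighted sum of squares is \<open>T\<close>, each term is at most \<open>sqrt (T q\<^sup>n)\<close>; these bounds are summed as a geometric series, whence the first factor.\<close>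
  define c where "c n = (1 / (1 - sqrt q))\<^sup>2 * (1 / q) ^ n" for n :: nat
  have c0: "0 \<le> c n" for n using q by (simp add: c_def)
  define F where "F n y = (norm (fourier (g n) y))\<^sup>2" for n y
  have [measurable]: "F n \<in> borel_measurable borel" for n unfolding F_def by measurable
  have F0: "0 \<le> F n y" for n y by (simp add: F_def)
  have pointwise: "ennreal (norm ((norm (fourier f y))\<^sup>2)) \<le> (\<Sum>n. ennreal (c n) * ennreal (norm (F n y)))" for y
  proof (cases "\<Sum>n. ennreal ((1 / q) ^ n) * ennreal (F n y)")
    case (real T)
    have F_le: "F n y \<le> T * q ^ n" for n
    proof -
      have "ennreal ((1 / q) ^ n) * ennreal (F n y) \<le> (\<Sum>n. ennreal ((1 / q) ^ n) * ennreal (F n y))"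
        using sum_le_suminf[of "\<lambda>n. ennreal ((1 / q) ^ n) * ennreal (F n y)" "{n}"] by (simp add: summableI)
      then have "(1 / q) ^ n * F n y \<le> T"
        using real q F0[of n y] by (simp flip: ennreal_mult)
      then show ?thesis using q by (simp add: power_one_over field_simps)
    qed
    have a_le: "norm (fourier (g n) y) \<le> sqrt T * sqrt q ^ n" for n
    proof -
      have "sqrt (F n y) \<le> sqrt (T * q ^ n)" by (intro real_sqrt_le_mono F_le)
      then show ?thesis by (simp add: F_def real_sqrt_mult real_sqrt_power)
    qed
    have part: "norm (fourier (s n) y) \<le> sqrt T * (1 / (1 - sqrt q))" for n
    proof -
      have "norm (fourier (s n) y) \<le> (\<Sum>k\<le>n. norm (fourier (g k) y))" by (rule s_sum)
      also have "\<dots> \<le> (\<Sum>k\<le>n. sqrt T * sqrt q ^ k)" by (intro sum_mono a_le)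
      also have "\<dots> = sqrt T * (\<Sum>k\<le>n. sqrt q ^ k)" by (simp add: sum_distrib_left)
      also have "(\<Sum>k\<le>n. sqrt q ^ k) \<le> (\<Sum>k. sqrt q ^ k)"
        using sq by (intro sum_le_suminf summable_geometric) auto
      also have "\<dots> = 1 / (1 - sqrt q)" using sq by (intro suminf_geometric) auto
      finally show ?thesis using real by (simp add: mult_left_mono)
    qed
    have "norm (fourier f y) \<le> sqrt T * (1 / (1 - sqrt q))"
      by (rule LIMSEQ_le_const2[OF tendsto_norm[OF s_lim]]) (use part in blast)
    then have "(norm (fourier f y))\<^sup>2 \<le> (sqrt T * (1 / (1 - sqrt q)))\<^sup>2" by (intro power_mono) auto
    also have "\<dots> = (1 / (1 - sqrt q))\<^sup>2 * T" using real by (simp add: power_mult_distrib power_divide)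
    finally have "ennreal (norm ((norm (fourier f y))\<^sup>2)) \<le> ennreal ((1 / (1 - sqrt q))\<^sup>2) * ennreal T"
      using real by (simp add: ennreal_leI flip: ennreal_mult)
    also have "\<dots> = (\<Sum>n. ennreal ((1 / (1 - sqrt q))\<^sup>2) * (ennreal ((1 / q) ^ n) * ennreal (F n y)))"
      using real by simp
    also have "\<dots> = (\<Sum>n. ennreal (c n) * ennreal (norm (F n y)))"
      using F0 q by (simp add: c_def ennreal_mult mult.assoc)
    finally show ?thesis .
  next
    case top
    have "(\<Sum>n. ennreal (c n) * ennreal (norm (F n y))) = (\<Sum>n. ennreal ((1 / (1 - sqrt q))\<^sup>2) * (ennreal ((1 / q) ^ n) * ennreal (F n y)))"
      using F0 q by (simp add: c_def ennreal_mult mult.assoc)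
    also have "\<dots> = top" using top sq by (simp add: ennreal_mult_top)
    finally show ?thesis by simp
  qed
  define D where "D = 4 * pi + 2 * interpolation_const r / q\<^sup>2"
  have pc0: "0 \<le> interpolation_const r" using sphere_const_nonneg[of r] r by (simp add: interpolation_const_def)
  have D0: "0 \<le> D" using pc0 q by (simp add: D_def)
  have piece: "(\<integral>\<^sup>+\<omega>. HL_max (F n) \<omega> \<partial>sphere_measure) \<le> ennreal (D * A\<^sup>2 * (q\<^sup>2) ^ n)" for n
  proof (cases n)
    case 0
    have "(\<integral>\<^sup>+x. ennreal (norm (g 0 x)) \<partial>lborel) \<le> (\<integral>\<^sup>+x. ennreal (A powr (1 - p)) * ennreal (norm (f x) powr p) \<partial>lborel)"
    proof (rule nn_integral_mono)
      fix x
      have "norm (f x) \<le> A powr (1 - p) * norm (f x) powr p" if "A < norm (f x)"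
      proof -
        have "norm (f x) powr (1 - p) \<le> A powr (1 - p)"
          using that A p by (intro powr_mono2') auto
        then have "norm (f x) powr (1 - p) * norm (f x) powr p \<le> A powr (1 - p) * norm (f x) powr p"
          by (intro mult_right_mono) auto
        moreover have "norm (f x) powr (1 - p) * norm (f x) powr p = norm (f x)"
          using that A by (simp flip: powr_add)
        ultimately show ?thesis by simp
      qed
      then show "ennreal (norm (g 0 x)) \<le> ennreal (A powr (1 - p)) * ennreal (norm (f x) powr p)"
        by (auto simp: g_def s_def simp flip: ennreal_mult intro!: ennreal_leI)
    qed
    also have "\<dots> = ennreal (A powr (1 - p)) * (\<integral>\<^sup>+x. ennreal (norm (f x) powr p) \<partial>lborel)"
      by (rule nn_integral_cmult) measurable
    also have "\<dots> \<le> ennreal (A powr (1 - p)) * ennreal (A powr p)"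
      by (intro mult_left_mono fA) simp
    also have "\<dots> = ennreal A"
      using A by (simp flip: ennreal_mult powr_add)
    finally have "ennreal (LINT x|lborel. norm (g 0 x)) \<le> ennreal A"
      using g_int[of 0] by (subst nn_integral_eq_integral[symmetric]) auto
    then have g0: "(LINT x|lborel. norm (g 0 x)) \<le> A" using A by simp
    have "HL_max (F 0) \<omega> \<le> ennreal (A\<^sup>2)" for \<omega>
    proof (rule HL_max_le_bound)
      show "norm (F 0 y) \<le> A\<^sup>2" for y
        using order_trans[OF norm_fourier_le[OF g_int] g0, of y] by (simp add: F_def power_mono)
    qed
    then have "(\<integral>\<^sup>+\<omega>. HL_max (F 0) \<omega> \<partial>sphere_measure) \<le> (\<integral>\<^sup>+\<omega>. ennreal (A\<^sup>2) \<partial>(sphere_measure :: (real^3) measure))"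
      by (intro nn_integral_mono) auto
    also have "\<dots> = ennreal (A\<^sup>2 * (4 * pi))"
      unfolding nn_integral_sphere_const by (simp flip: ennreal_mult)
    also have "\<dots> \<le> ennreal (D * A\<^sup>2)"
      using pc0 q by (intro ennreal_leI) (simp add: D_def distrib_right)
    finally show ?thesis using 0 by simp
  next
    case (Suc k)
    define N where "N = A * 2 powr (real (Suc k) * (p - 1))"
    define B where "B = A * 2 powr (- real k * \<theta>)"
    have B0: "0 < B" using A by (simp add: B_def)
    have half: "(1/2) ^ j = 2 powr (- real j)" for j :: nat
    proof -
      have "2 powr (- real j) = inverse (2 powr real j)" by (rule powr_minus)
      also have "2 powr real j = 2 ^ j" by (rule powr_realpow) simp
      finally show ?thesis by (simp only: power_one_over inverse_eq_divide)
    qed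
    have "(\<integral>\<^sup>+x. ennreal (norm (g n x)) \<partial>lborel) \<le> (\<integral>\<^sup>+x. ennreal ((A * (1/2) ^ Suc k) powr (1 - p)) * ennreal (norm (f x) powr p) \<partial>lborel)"
    proof (rule nn_integral_mono)
      fix x
      have "norm (f x) \<le> (A * (1/2) ^ Suc k) powr (1 - p) * norm (f x) powr p" if "A * (1/2) ^ Suc k < norm (f x)"
      proof -
        have pos: "0 < A * (1/2) ^ Suc k" using A by simp
        have "norm (f x) powr (1 - p) \<le> (A * (1/2) ^ Suc k) powr (1 - p)"
          using that pos p by (intro powr_mono2') auto
        then have "norm (f x) powr (1 - p) * norm (f x) powr p \<le> (A * (1/2) ^ Suc k) powr (1 - p) * norm (f x) powr p"
          by (intro mult_right_mono) auto
        moreover have "norm (f x) powr (1 - p) * norm (f x) powr p = norm (f x)"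
          using that pos by (simp flip: powr_add)
        ultimately show ?thesis by simp
      qed
      then show "ennreal (norm (g n x)) \<le> ennreal ((A * (1/2) ^ Suc k) powr (1 - p)) * ennreal (norm (f x) powr p)"
        unfolding Suc g_Suc by (auto simp flip: ennreal_mult simp del: power_Suc intro!: ennreal_leI)
    qed
    also have "\<dots> = ennreal ((A * (1/2) ^ Suc k) powr (1 - p)) * (\<integral>\<^sup>+x. ennreal (norm (f x) powr p) \<partial>lborel)"
      by (rule nn_integral_cmult) measurable
    also have "\<dots> \<le> ennreal ((A * (1/2) ^ Suc k) powr (1 - p)) * ennreal (A powr p)"
      by (intro mult_left_mono fA) simp
    also have "\<dots> = ennreal N"
    proof -
      have "(A * (1/2) ^ Suc k) powr (1 - p) * A powr p = (A powr (1 - p) * A powr p) * (2 powr (- real (Suc k))) powr (1 - p)"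
        using A unfolding half by (simp add: powr_mult del: of_nat_Suc)
      also have "A powr (1 - p) * A powr p = A" using A by (simp flip: powr_add)
      also have "(2 powr (- real (Suc k))) powr (1 - p) = 2 powr (real (Suc k) * (p - 1))"
        by (simp add: powr_powr algebra_simps)
      finally show ?thesis by (simp add: N_def flip: ennreal_mult)
    qed
    finally have "ennreal (LINT x|lborel. norm (g n x)) \<le> ennreal N"
      using g_int[of n] by (subst nn_integral_eq_integral[symmetric]) auto
    then have gN: "(LINT x|lborel. norm (g n x)) \<le> N" using A by (simp add: N_def)
    have "(\<integral>\<^sup>+x. ennreal (norm (g n x) powr (4/3)) \<partial>lborel) \<le> (\<integral>\<^sup>+x. ennreal ((A * (1/2) ^ k) powr (4/3 - p)) * ennreal (norm (f x) powr p) \<partial>lborel)"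
    proof (rule nn_integral_mono)
      fix x
      have "norm (f x) powr (4/3) \<le> (A * (1/2) ^ k) powr (4/3 - p) * norm (f x) powr p" if "norm (f x) \<le> A * (1/2) ^ k"
      proof -
        have "norm (f x) powr (4/3) = norm (f x) powr (4/3 - p) * norm (f x) powr p"
          by (simp flip: powr_add)
        also have "\<dots> \<le> (A * (1/2) ^ k) powr (4/3 - p) * norm (f x) powr p"
          using that p by (intro mult_right_mono powr_mono2) auto
        finally show ?thesis .
      qed
      then show "ennreal (norm (g n x) powr (4/3)) \<le> ennreal ((A * (1/2) ^ k) powr (4/3 - p)) * ennreal (norm (f x) powr p)"
        unfolding Suc g_Suc by (auto simp flip: ennreal_mult simp del: power_Suc intro!: ennreal_leI)
    qed
    also have "\<dots> = ennreal ((A * (1/2) ^ k) powr (4/3 - p)) * (\<integral>\<^sup>+x. ennreal (norm (f x) powr p) \<partial>lborel)"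
      by (rule nn_integral_cmult) measurable
    also have "\<dots> \<le> ennreal ((A * (1/2) ^ k) powr (4/3 - p)) * ennreal (A powr p)"
      by (intro mult_left_mono fA) simp
    also have "\<dots> = ennreal (B powr (4/3))"
    proof -
      have "(A * (1/2) ^ k) powr (4/3 - p) * A powr p = (A powr (4/3 - p) * A powr p) * (2 powr (- real k)) powr (4/3 - p)"
        using A unfolding half by (simp add: powr_mult)
      also have "A powr (4/3 - p) * A powr p = A powr (4/3)" by (simp flip: powr_add)
      also have "(2 powr (- real k)) powr (4/3 - p) = (2 powr (- real k * \<theta>)) powr (4/3)"
        by (simp add: powr_powr \<theta>_def algebra_simps)
      finally show ?thesis using A by (simp add: B_def powr_mult flip: ennreal_mult)
    qed
    finally have gB: "(\<integral>\<^sup>+x. ennreal (norm (g n x) powr (4/3)) \<partial>lborel) \<le> ennreal (B powr (4/3))" .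
    have "(\<integral>\<^sup>+\<omega>. HL_max (F n) \<omega> \<partial>sphere_measure) \<le> ennreal (interpolation_const r * N powr (2 - r) * B powr r)"
      unfolding F_def[abs_def] by (rule quadratic_maximal_interpolated[OF g_int r gN B0 gB])
    also have "\<dots> \<le> ennreal (D * A\<^sup>2 * (q\<^sup>2) ^ n)"
    proof (rule ennreal_leI)
      have "N powr (2 - r) * B powr r = (A powr (2 - r) * A powr r) * (2 powr (real (Suc k) * (p - 1) * (2 - r)) * 2 powr (- real k * \<theta> * r))"
        using A by (simp add: N_def B_def powr_mult powr_powr mult_ac)
      also have "A powr (2 - r) * A powr r = A\<^sup>2" using A by (simp flip: powr_add)
      also have "2 powr (real (Suc k) * (p - 1) * (2 - r)) * 2 powr (- real k * \<theta> * r)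
         = 2 powr (real (Suc k) * (p - 1) * \<theta> - real k * \<theta> * r)"
        by (simp add: r_def flip: powr_add)
      also have "\<dots> \<le> 2 powr (1 - real k * \<theta>)"
      proof (rule powr_mono)
        \<comment> \<open>Since \<open>p - 1 < 1/3\<close> and \<open>r > 3/2\<close>, the growth \<open>(p - 1) \<theta>\<close> per step loses against the decay \<open>r \<theta>\<close> by more than \<open>\<theta>\<close>.\<close>
        have "(p - 1) * \<theta> \<le> 1 * 1" using p \<theta> by (intro mult_mono) auto
        moreover have "real k * \<theta> * ((p - 1) - r) \<le> real k * \<theta> * (- 1)"
          using p \<theta> by (intro mult_left_mono) (auto simp: r_def)
        ultimately show "real (Suc k) * (p - 1) * \<theta> - real k * \<theta> * r \<le> 1 - real k * \<theta>"
          by (simp add: algebra_simps)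
      qed simp
      also have "2 powr (1 - real k * \<theta>) = 2 * (q\<^sup>2) ^ k"
      proof -
        have "q\<^sup>2 = 2 powr (- \<theta>)"
          unfolding q_def by (subst powr_numeral[symmetric]) (simp_all add: powr_powr)
        then have "(q\<^sup>2) ^ k = 2 powr (- \<theta> * real k)"
          by (simp add: powr_powr flip: powr_realpow)
        then show ?thesis by (simp add: powr_diff powr_minus divide_inverse mult.commute)
      qed
      finally have "N powr (2 - r) * B powr r \<le> A\<^sup>2 * (2 * (q\<^sup>2) ^ k)"
        by (simp add: mult_left_mono)
      then have "interpolation_const r * (N powr (2 - r) * B powr r) \<le> interpolation_const r * (A\<^sup>2 * (2 * (q\<^sup>2) ^ k))"
        by (rule mult_left_mono[OF _ pc0])
      also have "\<dots> = 2 * interpolation_const r / q\<^sup>2 * A\<^sup>2 * (q\<^sup>2) ^ n"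
        using q by (simp add: Suc)
      also have "\<dots> \<le> D * A\<^sup>2 * (q\<^sup>2) ^ n"
        by (intro mult_right_mono) (auto simp: D_def)
      finally show "interpolation_const r * N powr (2 - r) * B powr r \<le> D * A\<^sup>2 * (q\<^sup>2) ^ n"
        by (simp add: mult.assoc)
    qed
    finally show ?thesis .
  qed
  have HLm [measurable]: "HL_max (F n) \<in> borel_measurable (sphere_measure :: (real^3) measure)" for n
    by (intro measurable_sphere_measure) measurable
  have "(\<integral>\<^sup>+\<omega>. HL_max (\<lambda>y. (norm (fourier f y))\<^sup>2) \<omega> \<partial>sphere_measure)
     \<le> (\<integral>\<^sup>+\<omega>. (\<Sum>n. ennreal (c n) * HL_max (F n) \<omega>) \<partial>sphere_measure)"
    by (intro nn_integral_mono HL_max_le_suminf pointwise) measurable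
  also have "\<dots> = (\<Sum>n. \<integral>\<^sup>+\<omega>. ennreal (c n) * HL_max (F n) \<omega> \<partial>sphere_measure)"
    by (rule nn_integral_suminf) measurable
  also have "\<dots> = (\<Sum>n. ennreal (c n) * (\<integral>\<^sup>+\<omega>. HL_max (F n) \<omega> \<partial>sphere_measure))"
    by (intro suminf_cong nn_integral_cmult) measurable
  also have "\<dots> \<le> (\<Sum>n. ennreal (c n) * ennreal (D * A\<^sup>2 * (q\<^sup>2) ^ n))"
    by (intro suminf_le mult_left_mono piece) auto
  also have "\<dots> = (\<Sum>n. ennreal ((1 / (1 - sqrt q))\<^sup>2 * D * A\<^sup>2 * q ^ n))"
  proof (rule suminf_cong)
    fix n
    have qn: "(1 / q) ^ n * (q\<^sup>2) ^ n = q ^ n"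
      using q by (simp add: power_mult_distrib[symmetric] power2_eq_square)
    have "c n * (D * A\<^sup>2 * (q\<^sup>2) ^ n) = (1 / (1 - sqrt q))\<^sup>2 * D * A\<^sup>2 * ((1 / q) ^ n * (q\<^sup>2) ^ n)"
      by (simp only: c_def mult_ac)
    then have "c n * (D * A\<^sup>2 * (q\<^sup>2) ^ n) = (1 / (1 - sqrt q))\<^sup>2 * D * A\<^sup>2 * q ^ n"
      by (simp only: qn)
    then show "ennreal (c n) * ennreal (D * A\<^sup>2 * (q\<^sup>2) ^ n) = ennreal ((1 / (1 - sqrt q))\<^sup>2 * D * A\<^sup>2 * q ^ n)"
      using c0 D0 q by (simp flip: ennreal_mult)
  qed
  also have "\<dots> = ennreal (\<Sum>n. (1 / (1 - sqrt q))\<^sup>2 * D * A\<^sup>2 * q ^ n)"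
    using D0 q by (intro suminf_ennreal2 summable_mult summable_geometric) auto
  also have "(\<Sum>n. (1 / (1 - sqrt q))\<^sup>2 * D * A\<^sup>2 * q ^ n) = (1 / (1 - sqrt q))\<^sup>2 * D * A\<^sup>2 * (1 / (1 - q))"
    using q by (subst suminf_mult) (auto simp: suminf_geometric summable_geometric)
  finally show ?thesis by (simp add: D_def r_def)
qed

section \<open>Schwartz functions\<close>

lemma schwartz_measurable:
  assumes "schwartz f"
  shows "f \<in> borel_measurable borel"
proof -
  have "iter_partial [] f differentiable (at x)" for x
    using assms unfolding schwartz_def by blast
  then have "continuous_on UNIV f"
    by (intro continuous_at_imp_continuous_on) (auto intro: differentiable_imp_continuous_within)
  then show ?thesis by (rule borel_measurable_continuous_onI)
qed

lemma nn_integral_inverse_square: "(\<integral>\<^sup>+t. ennreal (inverse (1 + t\<^sup>2)) \<partial>lborel) < top"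
proof -
  have "integrable lborel (\<lambda>t::real. inverse (1 + t\<^sup>2))"
    using integrable_inverse_1_plus_square by (simp add: set_integrable_def einterval_def)
  then show ?thesis
    by (subst nn_integral_eq_integral) (auto simp: add_nonneg_nonneg)
qed

text \<open>
  Expanding the product of the \<open>1 + x\<^sub>i\<^sup>2\<close> gives finitely many monomials, each of which is controlled by
  one of the seminorms. A majorant of product form is integrable by Tonelli's theorem.
\<close>
lemma schwartz_decay:
  fixes f :: "real^'n::finite \<Rightarrow> complex"
  assumes "schwartz f"
  obtains K where "0 \<le> K" "\<And>x. norm (f x) \<le> K * (\<Prod>i\<in>UNIV. inverse (1 + (x $ i)\<^sup>2))"
proof -
  have bounded_all: "\<forall>(\<alpha>::'n \<Rightarrow> nat) js. bounded (range (\<lambda>x. (\<Prod>i\<in>UNIV. (x $ i) ^ \<alpha> i) *\<^sub>R iter_partial js f x))"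
    using assms unfolding schwartz_def by (rule conjunct2)
  have "\<exists>K. \<forall>x. (\<Prod>i\<in>S. (x $ i)\<^sup>2) * norm (f x) \<le> K" for S :: "'n set"
  proof -
    have "bounded (range (\<lambda>x. (\<Prod>i\<in>UNIV. (x $ i) ^ (if i \<in> S then 2 else 0)) *\<^sub>R iter_partial [] f x))"
      using bounded_all[rule_format, of "\<lambda>i. if i \<in> S then 2 else 0" "[]"] .
    then obtain K where K: "\<And>x. norm ((\<Prod>i\<in>UNIV. (x $ i) ^ (if i \<in> S then 2 else 0)) *\<^sub>R f x) \<le> K"
      by (auto simp: bounded_iff)
    have "(\<Prod>i\<in>UNIV. (x $ i) ^ (if i \<in> S then 2 else 0)) = (\<Prod>i\<in>S. (x $ i)\<^sup>2)" for x :: "real^'n"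
      by (subst prod.mono_neutral_right[of UNIV S]) auto
    then have "(\<Prod>i\<in>S. (x $ i)\<^sup>2) * norm (f x) \<le> K" for x
      using K[of x] by (simp add: prod_nonneg)
    then show ?thesis by blast
  qed
  then obtain K where K: "\<And>S x. (\<Prod>i\<in>S. (x $ i)\<^sup>2) * norm (f x) \<le> K S" by metis
  define K' where "K' = (\<Sum>S\<in>Pow UNIV. K S)"
  have le: "(\<Prod>i\<in>UNIV. 1 + (x $ i)\<^sup>2) * norm (f x) \<le> K'" for x
  proof -
    have "(\<Prod>i\<in>UNIV. (x $ i)\<^sup>2 + 1) = (\<Sum>S\<in>Pow UNIV. \<Prod>i\<in>S. (x $ i)\<^sup>2)"
      by (subst prod_add) auto
    then have "(\<Prod>i\<in>UNIV. 1 + (x $ i)\<^sup>2) * norm (f x) = (\<Sum>S\<in>Pow UNIV. (\<Prod>i\<in>S. (x $ i)\<^sup>2) * norm (f x))"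
      by (simp add: add.commute sum_distrib_right)
    also have "\<dots> \<le> K'" unfolding K'_def by (intro sum_mono K)
    finally show ?thesis .
  qed
  have pos: "0 < (\<Prod>i\<in>UNIV. 1 + (x $ i)\<^sup>2)" for x :: "real^'n"
    by (intro prod_pos) (auto intro: add_pos_nonneg)
  show ?thesis
  proof (rule that[of K'])
    have "0 \<le> (\<Prod>i\<in>UNIV. 1 + ((0::real^'n) $ i)\<^sup>2) * norm (f 0)" by simp
    then show "0 \<le> K'" using le[of 0] by linarith
    show "norm (f x) \<le> K' * (\<Prod>i\<in>UNIV. inverse (1 + (x $ i)\<^sup>2))" for x
    proof -
      have "(\<Prod>i\<in>UNIV. inverse (1 + (x $ i)\<^sup>2)) = inverse (\<Prod>i\<in>UNIV. 1 + (x $ i)\<^sup>2)"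
        using prod_inversef[of "\<lambda>i. 1 + (x $ i)\<^sup>2" UNIV] by (simp only: o_def)
      moreover have "norm (f x) \<le> K' * inverse (\<Prod>i\<in>UNIV. 1 + (x $ i)\<^sup>2)"
        using le[of x] pos[of x] by (simp only: divide_inverse[symmetric] pos_le_divide_eq mult.commute)
      ultimately show ?thesis by simp
    qed
  qed
qed

lemma schwartz_integrable:
  fixes f :: "real^'n::finite \<Rightarrow> complex"
  assumes f: "schwartz f"
  shows "integrable lborel f"
proof (rule integrableI_bounded)
  show "f \<in> borel_measurable lborel" using schwartz_measurable[OF f] by simp
  obtain K where K: "0 \<le> K" "\<And>x. norm (f x) \<le> K * (\<Prod>i\<in>UNIV. inverse (1 + (x $ i)\<^sup>2))"
    using schwartz_decay[OF f] by blast
  have prod_eq: "(\<Prod>i\<in>UNIV. inverse (1 + (x $ i)\<^sup>2)) = (\<Prod>b\<in>Basis. inverse (1 + (x \<bullet> b)\<^sup>2))" for x :: "real^'n"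
  proof -
    have B: "(Basis :: (real^'n) set) = (\<lambda>i. axis i 1) ` UNIV" by (auto simp: Basis_vec_def)
    have "inj (\<lambda>i::'n. axis i (1::real))" by (auto simp: inj_on_def axis_eq_axis)
    then show ?thesis unfolding B by (simp add: prod.reindex inner_axis)
  qed
  have "(\<integral>\<^sup>+x. ennreal (norm (f x)) \<partial>lborel) \<le> (\<integral>\<^sup>+x. ennreal K * (\<Prod>b\<in>Basis. ennreal (inverse (1 + ((x::real^'n) \<bullet> b)\<^sup>2))) \<partial>lborel)"
  proof (rule nn_integral_mono)
    fix x :: "real^'n"
    have "ennreal (norm (f x)) \<le> ennreal (K * (\<Prod>b\<in>Basis. inverse (1 + (x \<bullet> b)\<^sup>2)))"
      using K(2)[of x] by (intro ennreal_leI) (simp add: prod_eq)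
    also have "\<dots> = ennreal K * (\<Prod>b\<in>Basis. ennreal (inverse (1 + (x \<bullet> b)\<^sup>2)))"
      using K(1) by (subst prod_ennreal) (auto simp: ennreal_mult prod_nonneg add_nonneg_nonneg)
    finally show "ennreal (norm (f x)) \<le> ennreal K * (\<Prod>b\<in>Basis. ennreal (inverse (1 + (x \<bullet> b)\<^sup>2)))" .
  qed
  also have "\<dots> = ennreal K * (\<integral>\<^sup>+x. (\<Prod>b\<in>Basis. ennreal (inverse (1 + ((x::real^'n) \<bullet> b)\<^sup>2))) \<partial>lborel)"
    by (rule nn_integral_cmult) measurable
  also have "(\<integral>\<^sup>+x. (\<Prod>b\<in>Basis. ennreal (inverse (1 + ((x::real^'n) \<bullet> b)\<^sup>2))) \<partial>lborel)
     = (\<Prod>b\<in>(Basis :: (real^'n) set). \<integral>\<^sup>+t. ennreal (inverse (1 + t\<^sup>2)) \<partial>lborel)"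
    by (rule nn_integral_lborel_prod) simp_all
  also have "ennreal K * \<dots> < \<infinity>"
    using nn_integral_inverse_square by (simp add: ennreal_mult_less_top power_less_top_ennreal)
  finally show "(\<integral>\<^sup>+x. ennreal (norm (f x)) \<partial>lborel) < \<infinity>" .
qed

section \<open>Monotonicity in the exponent and the restriction theorem\<close>

text \<open>
  Hoelder's inequality on each ball, against the constant function \<open>1\<close>.
\<close>
lemma HL_max_pow_mono:
  fixes h :: "'a::euclidean_space \<Rightarrow> 'b::real_normed_vector"
  assumes h: "h \<in> borel_measurable borel" and r: "0 < r" "r < s"
  shows "HL_max_pow r h x \<le> HL_max_pow s h x"
proof -
  define u where "u y = norm (h y)" for y
  have [measurable]: "u \<in> borel_measurable borel" unfolding u_def using h by measurable
  have u0: "0 \<le> u y" for y by (simp add: u_def)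
  have "HL_max (\<lambda>y. u y powr r) x \<le> epowr (HL_max (\<lambda>y. u y powr s) x) (r / s)"
  proof (cases "HL_max (\<lambda>y. u y powr s) x")
    case (real T)
    show ?thesis
      unfolding HL_max_def[of "\<lambda>y. u y powr r"]
    proof (rule SUP_least)
      fix \<rho> :: real assume "\<rho> \<in> {0<..}"
      then have \<rho>: "0 < \<rho>" by simp
      have [measurable]: "ball x \<rho> \<in> sets borel" by simp
      obtain v where v: "emeasure lborel (ball x \<rho>) = ennreal v" "0 < v"
        using emeasure_lborel_ball_pos[OF \<rho>, of x]
        by (cases "emeasure lborel (ball x \<rho>)") (auto simp: less_le)
      define p where "p = s / r"
      define q where "q = s / (s - r)"
      have pq: "1 < p" "1 < q" "1 / p + 1 / q = 1"
        using r by (auto simp: p_def q_def field_simps)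
      have "(\<integral>\<^sup>+y. ennreal ((u y powr r * indicat_real (ball x \<rho>) y) * indicat_real (ball x \<rho>) y) \<partial>lborel) \<le> ennreal ((T * v) powr (1 / p) * v powr (1 / q))"
      proof (rule Holder_nn_integral[OF _ _ _ _ pq])
        have "(\<integral>\<^sup>+y. ennreal ((u y powr r * indicat_real (ball x \<rho>) y) powr p) \<partial>lborel) = (\<integral>\<^sup>+y\<in>ball x \<rho>. ennreal (norm (u y powr s)) \<partial>lborel)"
          using r by (intro nn_integral_cong) (auto simp: indicator_def powr_powr p_def)
        also have "\<dots> \<le> HL_max (\<lambda>y. u y powr s) x * emeasure lborel (ball x \<rho>)"
          by (rule HL_max_ge[OF \<rho>])
        also have "\<dots> = ennreal (T * v)" using real v by (simp add: ennreal_mult)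
        finally show "(\<integral>\<^sup>+y. ennreal ((u y powr r * indicat_real (ball x \<rho>) y) powr p) \<partial>lborel) \<le> ennreal (T * v)" .
        have "(\<integral>\<^sup>+y. ennreal (indicat_real (ball x \<rho>) y powr q) \<partial>lborel) = (\<integral>\<^sup>+y. indicator (ball x \<rho>) y \<partial>lborel)"
          by (intro nn_integral_cong) (auto simp: indicator_def)
        then show "(\<integral>\<^sup>+y. ennreal (indicat_real (ball x \<rho>) y powr q) \<partial>lborel) \<le> ennreal v"
          using v by simp
      qed (use real v in auto)
      also have "(T * v) powr (1 / p) * v powr (1 / q) = T powr (r / s) * v"
      proof -
        have "(T * v) powr (1 / p) * v powr (1 / q) = T powr (1 / p) * (v powr (1 / p) * v powr (1 / q))"
          using real v by (simp add: powr_mult)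
        also have "v powr (1 / p) * v powr (1 / q) = v" using pq v by (simp flip: powr_add)
        finally show ?thesis by (simp add: p_def)
      qed
      also have "(\<integral>\<^sup>+y. ennreal ((u y powr r * indicat_real (ball x \<rho>) y) * indicat_real (ball x \<rho>) y) \<partial>lborel) = (\<integral>\<^sup>+y\<in>ball x \<rho>. ennreal (norm (u y powr r)) \<partial>lborel)"
        by (intro nn_integral_cong) (auto simp: indicator_def)
      finally have "(\<integral>\<^sup>+y\<in>ball x \<rho>. ennreal (norm (u y powr r)) \<partial>lborel) / ennreal v \<le> ennreal (T powr (r / s))"
        using v by (intro divide_le_posI_ennreal) (auto simp: ennreal_mult mult.commute)
      then show "(\<integral>\<^sup>+y\<in>ball x \<rho>. ennreal (norm (u y powr r)) \<partial>lborel) / emeasure lborel (ball x \<rho>) \<le> epowr (HL_max (\<lambda>y. u y powr s) x) (r / s)"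
        using real v by (simp add: epowr_ennreal)
    qed
  qed simp
  then have "epowr (HL_max (\<lambda>y. u y powr r) x) (1 / r) \<le> epowr (epowr (HL_max (\<lambda>y. u y powr s) x) (r / s)) (1 / r)"
    using r by (intro epowr_mono) auto
  then show ?thesis
    using r by (simp add: HL_max_pow_def u_def epowr_epowr)
qed

lemma Lp_norm_mono:
  assumes "\<And>x. F x \<le> G x" "0 < p"
  shows "Lp_norm M p F \<le> Lp_norm M p G"
  unfolding Lp_norm_def using assms by (intro epowr_mono nn_integral_mono) auto

lemma Lp_norm_real:
  assumes p: "0 < p" and A: "Lp_norm lborel p (\<lambda>x. ennreal (norm (f x))) = ennreal A" "0 \<le> A"
  shows "(\<integral>\<^sup>+x. ennreal (norm (f x) powr p) \<partial>lborel) = ennreal (A powr p)"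
proof -
  have "(\<integral>\<^sup>+x. ennreal (norm (f x) powr p) \<partial>lborel) = epowr (Lp_norm lborel p (\<lambda>x. ennreal (norm (f x)))) p"
    using p by (simp add: Lp_norm_def epowr_epowr epowr_ennreal)
  then show ?thesis using A by (simp add: epowr_ennreal)
qed

lemma sphere_maximal_norm:
  assumes "0 < r"
  shows "Lp_norm sphere_measure 2 (HL_max_pow r h)
    = epowr (\<integral>\<^sup>+\<omega>. epowr (HL_max (\<lambda>y. norm (h y) powr r) \<omega>) (2 / r) \<partial>sphere_measure) (1 / 2)"
  using assms by (simp add: Lp_norm_def HL_max_pow_def epowr_epowr)

lemma bound_from_square:
  assumes "I \<le> ennreal (C * A\<^sup>2)" "0 \<le> C" "0 \<le> A"
  shows "epowr I (1 / 2) \<le> ennreal (sqrt C) * ennreal A"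
proof -
  have "epowr I (1 / 2) \<le> epowr (ennreal (C * A\<^sup>2)) (1 / 2)"
    using assms by (intro epowr_mono) auto
  also have "\<dots> = ennreal (sqrt C * A)"
    using assms by (simp add: epowr_ennreal powr_half_sqrt real_sqrt_mult)
  finally show ?thesis using assms by (simp add: ennreal_mult)
qed

text \<open>
  The constant is made positive so that the claim is trivial when the right-hand norm is infinite.
\<close>
lemma endpoint_bound:
  assumes r: "1 < r" "r < 2"
  shows "\<exists>C>0. \<forall>f :: real^3 \<Rightarrow> complex. schwartz f \<longrightarrow>
              Lp_norm sphere_measure 2 (HL_max_pow r (fourier f))
                \<le> ennreal C * Lp_norm lborel (4/3) (\<lambda>x. ennreal (norm (f x)))"
proof -
  define D where "D = 8 powr (2 / r) * sphere_const r"
  have D: "0 \<le> D" using sphere_const_nonneg[of r] r by (simp add: D_def)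
  have "Lp_norm sphere_measure 2 (HL_max_pow r (fourier f))
                \<le> ennreal (sqrt D + 1) * Lp_norm lborel (4/3) (\<lambda>x. ennreal (norm (f x)))"
    if f: "schwartz f" for f :: "real^3 \<Rightarrow> complex"
  proof (cases "Lp_norm lborel (4/3) (\<lambda>x. ennreal (norm (f x)))")
    case (real A)
    have "(\<integral>\<^sup>+\<omega>. epowr (HL_max (\<lambda>y. norm (fourier f y) powr r) \<omega>) (2 / r) \<partial>sphere_measure)
       \<le> ennreal (D * (A powr (4/3)) powr (3/2))"
      unfolding D_def
      by (rule sphere_maximal_endpoint[OF schwartz_integrable[OF f] r]) (use real Lp_norm_real[of "4/3" f A] in simp_all)
    also have "(A powr (4/3)) powr (3/2) = A\<^sup>2" using real by (simp add: powr_powr)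
    finally have "Lp_norm sphere_measure 2 (HL_max_pow r (fourier f)) \<le> ennreal (sqrt D) * ennreal A"
      using r D real by (subst sphere_maximal_norm) (auto intro: bound_from_square)
    also have "\<dots> \<le> ennreal (sqrt D + 1) * ennreal A"
      by (intro mult_right_mono ennreal_leI) auto
    finally show ?thesis using real by simp
  next
    case top
    then show ?thesis using D by (simp add: ennreal_mult_top add_nonneg_pos)
  qed
  then show ?thesis using D by (intro exI[of _ "sqrt D + 1"]) (auto intro: add_nonneg_pos)
qed

text \<open>
  The estimate below the endpoint is applied with every \<open>A'\<close> above the norm \<open>A\<close>, and then
  \<open>A'\<close> tends to \<open>A\<close>; this covers \<open>A = 0\<close> as well.
\<close>
lemma quadratic_bound:
  assumes p: "1 \<le> p" "p < 4/3"
  shows "\<exists>C>0. \<forall>f :: real^3 \<Rightarrow> complex. schwartz f \<longrightarrow>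
              Lp_norm sphere_measure 2 (HL_max_pow 2 (fourier f))
                \<le> ennreal C * Lp_norm lborel p (\<lambda>x. ennreal (norm (f x)))"
proof -
  define \<theta> where "\<theta> = 1 - 3 * p / 4"
  define q where "q = 2 powr (- \<theta> / 2)"
  define D where "D = \<bar>(1 / (1 - sqrt q))\<^sup>2 * ((4 * pi + 2 * interpolation_const (2 - \<theta>) / q\<^sup>2) / (1 - q))\<bar>"
  have D: "0 \<le> D" by (simp add: D_def)
  have "Lp_norm sphere_measure 2 (HL_max_pow 2 (fourier f))
                \<le> ennreal (sqrt D + 1) * Lp_norm lborel p (\<lambda>x. ennreal (norm (f x)))"
    if f: "schwartz f" for f :: "real^3 \<Rightarrow> complex"
  proof (cases "Lp_norm lborel p (\<lambda>x. ennreal (norm (f x)))")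
    case (real A)
    define I where "I = (\<integral>\<^sup>+\<omega>. HL_max (\<lambda>y. (norm (fourier f y))\<^sup>2) \<omega> \<partial>sphere_measure)"
    have bound: "I \<le> ennreal (D * A'\<^sup>2)" if A': "A < A'" for A'
    proof -
      have A'0: "0 < A'" using A' real by linarith
      have fA: "(\<integral>\<^sup>+x. ennreal (norm (f x) powr p) \<partial>lborel) \<le> ennreal (A' powr p)"
        using Lp_norm_real[of p f A] real p A' by (simp add: ennreal_leI powr_mono2)
      have "I \<le> ennreal ((1 / (1 - sqrt q))\<^sup>2 * ((4 * pi + 2 * interpolation_const (2 - \<theta>) / q\<^sup>2) / (1 - q)) * A'\<^sup>2)"
        unfolding I_def \<theta>_def q_def
        by (rule quadratic_maximal_below_endpoint[OF schwartz_integrable[OF f] p A'0 fA])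
      also have "\<dots> \<le> ennreal (D * A'\<^sup>2)"
        unfolding D_def by (intro ennreal_leI mult_right_mono abs_ge_self) auto
      finally show ?thesis .
    qed
    have "I \<le> ennreal (D * A\<^sup>2)"
    proof (rule tendsto_lowerbound)
      show "((\<lambda>A'. ennreal (D * A'\<^sup>2)) \<longlongrightarrow> ennreal (D * A\<^sup>2)) (at_right A)"
        by (intro tendsto_intros)
      show "\<forall>\<^sub>F A' in at_right A. I \<le> ennreal (D * A'\<^sup>2)"
        using bound by (auto intro!: eventually_at_rightI[of A "A + 1"])
    qed simp
    then have "epowr I (1 / 2) \<le> ennreal (sqrt D) * ennreal A"
      using D real by (intro bound_from_square) auto
    also have "\<dots> \<le> ennreal (sqrt D + 1) * ennreal A"
      by (intro mult_right_mono ennreal_leI) auto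
    finally show ?thesis
      using real by (subst sphere_maximal_norm) (simp_all add: I_def)
  next
    case top
    then show ?thesis using D by (simp add: ennreal_mult_top add_nonneg_pos)
  qed
  then show ?thesis using D by (intro exI[of _ "sqrt D + 1"]) (auto intro: add_nonneg_pos)
qed

theorem theorem4:
  shows "(\<forall>r p :: real. 1 \<le> r \<and> r < 2 \<and> 1 \<le> p \<and> p \<le> 4/3 \<longrightarrow>
           (\<exists>C::real. \<forall>f :: real^3 \<Rightarrow> complex. schwartz f \<longrightarrow>
              Lp_norm sphere_measure 2 (HL_max_pow r (fourier f))
                \<le> ennreal C * Lp_norm lborel p (\<lambda>x. ennreal (norm (f x)))))
       \<and> (\<forall>p :: real. 1 \<le> p \<and> p < 4/3 \<longrightarrow>
           (\<exists>C::real. \<forall>f :: real^3 \<Rightarrow> complex. schwartz f \<longrightarrow>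
              Lp_norm sphere_measure 2 (HL_max_pow 2 (fourier f))
                \<le> ennreal C * Lp_norm lborel p (\<lambda>x. ennreal (norm (f x)))))"
proof (intro conjI allI impI)
  fix r p :: real assume rp: "1 \<le> r \<and> r < 2 \<and> 1 \<le> p \<and> p \<le> 4/3"
  \<comment> \<open>It suffices to bound \<open>M\<^sub>s\<close> for one \<open>s > r\<close>: at the endpoint any \<open>s\<close> between \<open>r\<close> and \<open>2\<close>, below it \<open>s = 2\<close>.\<close>
  obtain s C where s: "r < s" and C: "\<And>f :: real^3 \<Rightarrow> complex. schwartz f \<Longrightarrow>
       Lp_norm sphere_measure 2 (HL_max_pow s (fourier f)) \<le> ennreal C * Lp_norm lborel p (\<lambda>x. ennreal (norm (f x)))"
  proof (cases "p = 4/3")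
    case True
    define s where "s = (r + 2) / 2"
    have "1 < s" "s < 2" "r < s" using rp by (auto simp: s_def)
    then show ?thesis using endpoint_bound[of s] True that[of s] by blast
  next
    case False
    then show ?thesis using quadratic_bound[of p] rp that[of 2] by force
  qed
  have "Lp_norm sphere_measure 2 (HL_max_pow r (fourier f)) \<le> ennreal C * Lp_norm lborel p (\<lambda>x. ennreal (norm (f x)))"
    if f: "schwartz f" for f :: "real^3 \<Rightarrow> complex"
  proof -
    have "fourier f \<in> borel_measurable borel" by (intro measurable_fourier schwartz_measurable f)
    then have "Lp_norm sphere_measure 2 (HL_max_pow r (fourier f)) \<le> Lp_norm sphere_measure 2 (HL_max_pow s (fourier f))"
      using s rp by (intro Lp_norm_mono HL_max_pow_mono) auto
    also note C[OF f]
    finally show ?thesis .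
  qed
  then show "\<exists>C::real. \<forall>f :: real^3 \<Rightarrow> complex. schwartz f \<longrightarrow>
      Lp_norm sphere_measure 2 (HL_max_pow r (fourier f)) \<le> ennreal C * Lp_norm lborel p (\<lambda>x. ennreal (norm (f x)))"
    by blast
next
  fix p :: real assume "1 \<le> p \<and> p < 4/3"
  then show "\<exists>C::real. \<forall>f :: real^3 \<Rightarrow> complex. schwartz f \<longrightarrow>
      Lp_norm sphere_measure 2 (HL_max_pow 2 (fourier f)) \<le> ennreal C * Lp_norm lborel p (\<lambda>x. ennreal (norm (f x)))"
    using quadratic_bound[of p] by blast
qed

end
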